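(* Let $\mathcal X_d=\mathbb R^d$, $\nu=N(0,I_d)$, $\sigma_2(z)=z$, and $f^*(x)=g^*(w^*\cdot x)$ with $\|w^*\|_2=1$, where $g^*,(g^* )',(g^* )''$ are polynomially bounded and $\mathbb E_{z\sim N(0,1)}[(g^* )'(z)]\neq0$. Then, for suitable choices of the hyperparameters $\eta_1,\eta_2,\lambda$ and $T=\mathrm{poly}(d,n,m_1,m_2)$, with high probability the output $\hat\theta$ of the layer-wise training algorithm satisfies $$\mathbb E_x\big[(f(x;\hat\theta)-f^*(x))^2\big]=\tilde O\Big(\frac{d^2}{\min(n,m_1,m_2)}+\frac1{\sqrt n}\Big).$$
   Context: Standing normalization $\mathbb E_{x\sim\nu}[f^*(x)^2]\le1$. Two independent datasets $\mathcal D_1,\mathcal D_2$ each of $n$ i.i.d. samples from $\nu$. Network: $f(x;\theta)=\frac1{m_1}a^T\sigma_1(W\sigma_2(Vx)+b)$ with $\sigma_1(z)=\max(z,0)$, $\theta=(a,W,b,V)$, $a,b\in\mathbb R^{m_1}$, $W\in\mathbb R^{m_1\times m_2}$, $V\in\mathbb R^{m_2\times d}$. Initialization: $a_i$ i.i.d. uniform on $\{\pm1\}$, $W=0$, $b_i$ i.i.d. $N(0,1)$, rows of $V$ i.i.d. uniform on the unit sphere. Losses $L_i(\theta)=\frac1n\sum_{x\in\mathcal D_i}(f(x;\theta)-f^*(x))^2$. Algorithm: one gradient step $W^{(1)}=-\eta_1\nabla_WL_1(\theta^{(0)})$ (with $a,b,V$ at initialization), then $T-1$ steps $a^{(t)}=a^{(t-1)}-\eta_2[\nabla_aL_2(\theta^{(t-1)})+\lambda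 a^{(t-1)}]$ with $W=W^{(1)}$ and $b,V$ fixed; output $\hat\theta=(a^{(T)},W^{(1)},b^{(0)},V^{(0)})$. "With high probability" means probability at least $1-\mathrm{poly}(d,n,m_1,m_2)e^{-\iota}$ with $\iota=C\log(dnm_1m_2)$, $C$ a large constant; $\tilde O$ hides constants depending on $g^*$ and polylogarithmic factors in $dnm_1m_2$. *)

theory Defs
  imports "HOL-Probability.Probability"
begin

definition std_normal :: "real measure" where
  "std_normal = density lborel std_normal_density"

definition gauss_vec :: "nat \<Rightarrow> (nat \<Rightarrow> real) measure" where
  "gauss_vec d = PiM {..<d} (\<lambda>_. std_normal)"

definition vnorm :: "nat \<Rightarrow> (nat \<Rightarrow> real) \<Rightarrow> real" where
  "vnorm d x = sqrt (\<Sum>k<d. (x k)\<^sup>2)"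

definition dotp :: "nat \<Rightarrow> (nat \<Rightarrow> real) \<Rightarrow> (nat \<Rightarrow> real) \<Rightarrow> real" where
  "dotp d u x = (\<Sum>k<d. u k * x k)"

definition sphere_unif :: "nat \<Rightarrow> (nat \<Rightarrow> real) measure" where
  "sphere_unif d = distr (gauss_vec d) (PiM {..<d} (\<lambda>_. borel))
      (\<lambda>x. \<lambda>k\<in>{..<d}. x k / vnorm d x)"

definition rademacher :: "real measure" where
  "rademacher = measure_pmf (pmf_of_set {-1, 1})"

definition dataset :: "nat \<Rightarrow> nat \<Rightarrow> (nat \<Rightarrow> nat \<Rightarrow> real) measure" where
  "dataset n d = PiM {..<n} (\<lambda>_. gauss_vec d)"

(* Joint law of (D1, D2, a^(0), b^(0), V^(0)); W^(0) = 0 is deterministic *)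
definition sample_space :: "nat \<Rightarrow> nat \<Rightarrow> nat \<Rightarrow> nat \<Rightarrow>
   ((nat \<Rightarrow> nat \<Rightarrow> real) \<times> (nat \<Rightarrow> nat \<Rightarrow> real) \<times> (nat \<Rightarrow> real) \<times> (nat \<Rightarrow> real)
     \<times> (nat \<Rightarrow> nat \<Rightarrow> real)) measure" where
  "sample_space d n m1 m2 =
     dataset n d \<Otimes>\<^sub>M dataset n d \<Otimes>\<^sub>M PiM {..<m1} (\<lambda>_. rademacher)
       \<Otimes>\<^sub>M PiM {..<m1} (\<lambda>_. std_normal) \<Otimes>\<^sub>M PiM {..<m2} (\<lambda>_. sphere_unif d)"

definition relu :: "real \<Rightarrow> real" where
  "relu z = max z 0"

(* derivative of ReLU, with the convention relu'(0) = 0 *)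
definition relu' :: "real \<Rightarrow> real" where
  "relu' z = (if z > 0 then 1 else 0)"

(* sigma_2 = identity: hidden features (V x)_j, j < m2 *)
definition feat :: "nat \<Rightarrow> (nat \<Rightarrow> nat \<Rightarrow> real) \<Rightarrow> (nat \<Rightarrow> real) \<Rightarrow> nat \<Rightarrow> real" where
  "feat d V x j = (\<Sum>k<d. V j k * x k)"

definition preact :: "nat \<Rightarrow> nat \<Rightarrow> (nat \<Rightarrow> nat \<Rightarrow> real) \<Rightarrow> (nat \<Rightarrow> real)
    \<Rightarrow> (nat \<Rightarrow> nat \<Rightarrow> real) \<Rightarrow> (nat \<Rightarrow> real) \<Rightarrow> nat \<Rightarrow> real" where
  "preact d m2 W b V x i = (\<Sum>j<m2. W i j * feat d V x j) + b i"

definition net :: "nat \<Rightarrow> nat \<Rightarrow> nat \<Rightarrow> (nat \<Rightarrow> real) \<Rightarrow> (nat \<Rightarrow> nat \<Rightarrow> real)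
    \<Rightarrow> (nat \<Rightarrow> real) \<Rightarrow> (nat \<Rightarrow> nat \<Rightarrow> real) \<Rightarrow> (nat \<Rightarrow> real) \<Rightarrow> real" where
  "net d m1 m2 a W b V x = (1 / real m1) * (\<Sum>i<m1. a i * relu (preact d m2 W b V x i))"

(* gradient of L(theta) = (1/n) sum_{s<n} (f(D s;theta) - fstar(D s))^2 w.r.t. W_{ij} *)
definition grad_W :: "nat \<Rightarrow> nat \<Rightarrow> nat \<Rightarrow> nat \<Rightarrow> ((nat \<Rightarrow> real) \<Rightarrow> real)
    \<Rightarrow> (nat \<Rightarrow> nat \<Rightarrow> real) \<Rightarrow> (nat \<Rightarrow> real) \<Rightarrow> (nat \<Rightarrow> nat \<Rightarrow> real)
    \<Rightarrow> (nat \<Rightarrow> real) \<Rightarrow> (nat \<Rightarrow> nat \<Rightarrow> real) \<Rightarrow> nat \<Rightarrow> nat \<Rightarrow> real" where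
  "grad_W d n m1 m2 fstar D a W b V i j =
     (2 / real n) * (\<Sum>s<n. (net d m1 m2 a W b V (D s) - fstar (D s))
        * (a i / real m1) * relu' (preact d m2 W b V (D s) i) * feat d V (D s) j)"

definition grad_a :: "nat \<Rightarrow> nat \<Rightarrow> nat \<Rightarrow> nat \<Rightarrow> ((nat \<Rightarrow> real) \<Rightarrow> real)
    \<Rightarrow> (nat \<Rightarrow> nat \<Rightarrow> real) \<Rightarrow> (nat \<Rightarrow> real) \<Rightarrow> (nat \<Rightarrow> nat \<Rightarrow> real)
    \<Rightarrow> (nat \<Rightarrow> real) \<Rightarrow> (nat \<Rightarrow> nat \<Rightarrow> real) \<Rightarrow> nat \<Rightarrow> real" where
  "grad_a d n m1 m2 fstar D a W b V i =
     (2 / real n) * (\<Sum>s<n. (net d m1 m2 a W b V (D s) - fstar (D s))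
        * (1 / real m1) * relu (preact d m2 W b V (D s) i))"

(* Layer-wise training algorithm; returns theta_hat = (a^(T), W^(1), b^(0), V^(0)) *)
definition layerwise_train :: "nat \<Rightarrow> nat \<Rightarrow> nat \<Rightarrow> nat \<Rightarrow> real \<Rightarrow> real \<Rightarrow> real \<Rightarrow> nat
    \<Rightarrow> ((nat \<Rightarrow> real) \<Rightarrow> real)
    \<Rightarrow> (nat \<Rightarrow> nat \<Rightarrow> real) \<times> (nat \<Rightarrow> nat \<Rightarrow> real) \<times> (nat \<Rightarrow> real) \<times> (nat \<Rightarrow> real)
        \<times> (nat \<Rightarrow> nat \<Rightarrow> real)
    \<Rightarrow> (nat \<Rightarrow> real) \<times> (nat \<Rightarrow> nat \<Rightarrow> real) \<times> (nat \<Rightarrow> real) \<times> (nat \<Rightarrow> nat \<Rightarrow> real)" where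
  "layerwise_train d n m1 m2 \<eta>1 \<eta>2 lam T fstar \<omega> =
     (case \<omega> of (D1, D2, a0, b0, V0) \<Rightarrow>
       let W1 = (\<lambda>i j. - \<eta>1 * grad_W d n m1 m2 fstar D1 a0 (\<lambda>_ _. 0) b0 V0 i j);
           step = (\<lambda>a. \<lambda>i. a i - \<eta>2 * (grad_a d n m1 m2 fstar D2 a W1 b0 V0 i + lam * a i))
       in ((step ^^ (T - 1)) a0, W1, b0, V0))"

definition poly_bounded :: "(real \<Rightarrow> real) \<Rightarrow> bool" where
  "poly_bounded h \<longleftrightarrow> (\<exists>C (k::nat). \<forall>z. \<bar>h z\<bar> \<le> C * (1 + \<bar>z\<bar>) ^ k)"

end

theory Submission
  imports Defs
begin

text \<open>
  After the first gradient step the pre-activation of neuron \<open>i\<close> is \<open>b i + [b i > 0] a i (u \<bullet> x) / R\<close>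
  with a common direction \<open>u\<close> that estimates \<open>w\<close>: since \<open>W = 0\<close> at initialization, the gradient is
  \<open>V\<close> times the empirical correlation of \<open>f\<^sup>* - c\<close> with \<open>x\<close>, Stein's identity gives
  \<open>E[g (w \<bullet> x) x] = E[g'] w\<close>, and \<open>(d / m\<^sub>2) V\<^sup>T V\<close> is close to the identity. Entrywise concentration gives
  \<open>\<parallel>u - w\<parallel>\<^sup>2 = O(d\<^sup>2 / min n m\<^sub>2)\<close> up to logarithms. The network is therefore a one-dimensional random feature model
  in \<open>u \<bullet> x\<close>, Lipschitz in its argument, so \<open>u\<close> may be replaced by \<open>w\<close> everywhere; this removes
  the dependence of the features on the samples. A Taylor formula with ReLU kernels provides bounded
  output weights approximating \<open>g\<close> up to \<open>1 / \<surd>m\<^sub>1\<close>, gradient descent on the ridge-regularized convex quadratic loss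
  competes with these weights, and generalization follows from the concentration of the empirical
  distribution function of \<open>w \<bullet> x\<close>, uniformly over Lipschitz functions of one variable. If
  \<open>min n (min m\<^sub>1 m\<^sub>2) < d\<^sup>2\<close>, the untrained network already satisfies the bound.
\<close>

section \<open>Concentration of empirical means\<close>

text \<open>The trained network depends on the sample in a complicated way, so probability and
  training are kept apart. \<open>typical_sample\<close> collects inequalities about one fixed
  sample, and training is analysed deterministically from them. Each inequality concerns one matrix
  entry, one sample point, one bias or one grid threshold, so that a union bound over polynomially
  many events is enough. A single radius R of order sqrt (1 + ln N) serves as truncation level, as
  deviation parameter and as range of the projection. It is tuned so that exp (- R^2 / 4) swallows
  all polynomial factors; the remaining constants are collected in \<open>B R\<close>, a constant
  times a power of R. The first step size carries an extra factor 1 / R. It moves the projection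
  into [-1, 1], where a representation by ReLU units with biases in (0, 2] is available. The ridge
  weight e / m1, where e is the target rate, acts in two directions: it charges the bounded
  competitor only O(e) up to powers of \<open>B\<close>, and it bounds the mean absolute trained
  weight, hence the Lipschitz constant of the trained network. That constant drives both the
  exchange of \<open>u\<close> for \<open>w\<close> and the uniform deviation bound.\<close>

lemma indep_vars_PiM_coordinates:
  assumes I: "I \<noteq> {}" and M: "\<And>i. i \<in> I \<Longrightarrow> prob_space (M i)"
  shows "prob_space.indep_vars (PiM I M) M (\<lambda>i \<omega>. \<omega> i) I"
proof -
  interpret prob_space "PiM I M"
    by (rule prob_space_PiM) (rule M)
  have "distr (PiM I M) (PiM I M) (\<lambda>x. \<lambda>i\<in>I. x i) = distr (PiM I M) (PiM I M) (\<lambda>x. x)"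
    by (intro distr_cong) (auto simp: space_PiM PiE_def extensional_restrict)
  also have "\<dots> = PiM I M"
    by (rule distr_id)
  also have "\<dots> = PiM I (\<lambda>i. distr (PiM I M) (M i) (\<lambda>\<omega>. \<omega> i))"
    using M by (intro PiM_cong) (auto simp: distr_PiM_component)
  finally show ?thesis
    using I by (subst indep_vars_iff_distr_eq_PiM') auto
qed

lemma integral_PiM_component:
  fixes f :: "'a \<Rightarrow> real"
  assumes "\<And>i. i \<in> I \<Longrightarrow> prob_space (M i)" "i \<in> I" and [measurable]: "f \<in> borel_measurable (M i)"
  shows "(\<integral>\<omega>. f (\<omega> i) \<partial>PiM I M) = integral\<^sup>L (M i) f"
proof -
  have [measurable]: "(\<lambda>\<omega>. \<omega> i) \<in> measurable (PiM I M) (M i)"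
    using assms(2) by (rule measurable_component_singleton)
  have "integral\<^sup>L (distr (PiM I M) (M i) (\<lambda>\<omega>. \<omega> i)) f = (\<integral>\<omega>. f (\<omega> i) \<partial>PiM I M)"
    by (rule integral_distr) measurable
  thus ?thesis
    using assms by (simp add: distr_PiM_component)
qed

lemma measure_PiM_component:
  assumes "\<And>i. i \<in> I \<Longrightarrow> prob_space (M i)" "i \<in> I" and [measurable]: "Measurable.pred (M i) P"
  shows "measure (PiM I M) {\<omega> \<in> space (PiM I M). P (\<omega> i)} = measure (M i) {x \<in> space (M i). P x}"
proof -
  have [measurable]: "(\<lambda>\<omega>. \<omega> i) \<in> measurable (PiM I M) (M i)"
    using assms(2) by (rule measurable_component_singleton)
  have "measure (M i) {x \<in> space (M i). P x}
      = measure (distr (PiM I M) (M i) (\<lambda>\<omega>. \<omega> i)) {x \<in> space (M i). P x}"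
    using assms by (simp add: distr_PiM_component)
  also have "\<dots> = measure (PiM I M) ((\<lambda>\<omega>. \<omega> i) -` {x \<in> space (M i). P x} \<inter> space (PiM I M))"
    by (rule measure_distr) measurable
  also have "(\<lambda>\<omega>. \<omega> i) -` {x \<in> space (M i). P x} \<inter> space (PiM I M) = {\<omega> \<in> space (PiM I M). P (\<omega> i)}"
    using assms(2) by (auto simp: space_PiM)
  finally show ?thesis by simp
qed

text \<open>Factors and functions may vary with the index: once the signs are frozen in
  \<open>whp_units\<close>, each bias is fed to its own feature function.\<close>

lemma Hoeffding_PiM:
  fixes f :: "nat \<Rightarrow> 'a \<Rightarrow> real" and n :: nat
  assumes M: "\<And>i. i < n \<Longrightarrow> prob_space (M i)"
    and f: "\<And>i. i < n \<Longrightarrow> f i \<in> borel_measurable (M i)"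
    and bd: "\<And>i x. i < n \<Longrightarrow> x \<in> space (M i) \<Longrightarrow> \<bar>f i x\<bar> \<le> B"
    and "B > 0" "n \<ge> 1" "t \<ge> 0"
  shows "measure (PiM {..<n} M) {D \<in> space (PiM {..<n} M).
      B * t / sqrt n \<le> \<bar>(\<Sum>i<n. f i (D i)) / n - (\<Sum>i<n. integral\<^sup>L (M i) (f i)) / n\<bar>} \<le> 2 * exp (- t\<^sup>2 / 2)"
proof -
  let ?P = "PiM {..<n} M"
  interpret prob_space ?P
    by (rule prob_space_PiM) (use M in auto)
  have ne: "{..<n} \<noteq> {}" using \<open>n \<ge> 1\<close> by (auto simp: lessThan_empty_iff)
  have "indep_vars (\<lambda>_. borel) (\<lambda>i \<omega>. f i (\<omega> i)) {..<n}"
    by (rule indep_vars_compose2[OF indep_vars_PiM_coordinates[OF ne]]) (use M f in auto)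
  moreover have "AE \<omega> in ?P. f i (\<omega> i) \<in> {- B..B}" if "i \<in> {..<n}" for i
    using bd[of i] that by (intro AE_I2) (auto simp: space_PiM PiE_iff abs_le_iff, smt (verit) lessThan_iff)
  ultimately interpret H: Hoeffding_ineq ?P "{..<n}" "\<lambda>i \<omega>. f i (\<omega> i)" "\<lambda>_. - B" "\<lambda>_. B"
      "\<Sum>i<n. expectation (\<lambda>\<omega>. f i (\<omega> i))"
    by unfold_locales auto
  have E: "(\<Sum>i<n. expectation (\<lambda>\<omega>. f i (\<omega> i))) = (\<Sum>i<n. integral\<^sup>L (M i) (f i))"
    using M f by (intro sum.cong integral_PiM_component) auto
  have n0: "real n > 0" using \<open>n \<ge> 1\<close> by simp
  have "{D \<in> space ?P. B * t / sqrt n \<le> \<bar>(\<Sum>i<n. f i (D i)) / n - (\<Sum>i<n. integral\<^sup>L (M i) (f i)) / n\<bar>}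
      = {D \<in> space ?P. B * t * sqrt n \<le> \<bar>(\<Sum>i<n. f i (D i)) - (\<Sum>i<n. expectation (\<lambda>\<omega>. f i (\<omega> i)))\<bar>}"
  proof (intro Collect_cong conj_cong refl)
    fix D
    have eq: "B * t / sqrt n = (B * t * sqrt n) / n"
      using n0 by (simp add: field_simps flip: power2_eq_square)
    show "(B * t / sqrt n \<le> \<bar>(\<Sum>i<n. f i (D i)) / n - (\<Sum>i<n. integral\<^sup>L (M i) (f i)) / n\<bar>) =
      (B * t * sqrt n \<le> \<bar>(\<Sum>i<n. f i (D i)) - (\<Sum>i<n. expectation (\<lambda>\<omega>. f i (\<omega> i)))\<bar>)"
      unfolding E eq diff_divide_distrib[symmetric] abs_divide
      using n0 by (simp add: divide_le_cancel)
  qed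
  also have "measure ?P \<dots> \<le> 2 * exp (- 2 * (B * t * sqrt n)\<^sup>2 / (\<Sum>i<n. (B - - B)\<^sup>2))"
    by (rule H.Hoeffding_ineq_abs_ge) (use assms in \<open>auto simp: lessThan_empty_iff\<close>)
  also have "- 2 * (B * t * sqrt n)\<^sup>2 / (\<Sum>i<n. (B - - B)\<^sup>2) = - t\<^sup>2 / 2"
    using \<open>B > 0\<close> n0 by (simp add: power_mult_distrib field_simps)
  finally show ?thesis .
qed

text \<open>Set \<open>f\<close> to zero off \<open>G\<close>. The truncated function is bounded, so
  Hoeffding applies to it; the two empirical means differ only if some sample point leaves
  \<open>G\<close>, which costs probability \<open>n * \<epsilon>\<close>; the two expectations
  differ by at most \<open>\<delta>\<close>, controlled through the second moment.\<close>

lemma truncated_mean_concentration: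
  fixes f :: "'a \<Rightarrow> real" and n :: nat and \<epsilon> :: real
  assumes M: "prob_space M" and f[measurable]: "f \<in> borel_measurable M"
    and G[measurable]: "Measurable.pred M G"
    and bd: "\<And>x. x \<in> space M \<Longrightarrow> G x \<Longrightarrow> \<bar>f x\<bar> \<le> B"
    and eps: "measure M {x \<in> space M. \<not> G x} \<le> \<epsilon>" "\<epsilon> > 0"
    and int: "integrable M (\<lambda>x. (f x)\<^sup>2)" and mom: "(\<integral>x. (f x)\<^sup>2 \<partial>M) \<le> Mo"
    and "B > 0" "n \<ge> 1" "t \<ge> 0"
    and bias: "sqrt \<epsilon> * (Mo + 1) / 2 \<le> \<delta>"
  shows "measure (PiM {..<n} (\<lambda>_. M)) {D \<in> space (PiM {..<n} (\<lambda>_. M)).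
      B * t / sqrt n + \<delta> \<le> \<bar>(\<Sum>i<n. f (D i)) / n - integral\<^sup>L M f\<bar>} \<le> 2 * exp (- t\<^sup>2 / 2) + n * \<epsilon>"
proof -
  let ?P = "PiM {..<n} (\<lambda>_. M)"
  interpret M: prob_space M by fact
  interpret P: prob_space ?P by (rule prob_space_PiM) (rule M)
  define h where "h x = (if G x then f x else 0)" for x
  have h[measurable]: "h \<in> borel_measurable M" unfolding h_def by measurable
  have fi: "integrable M f" by (rule M.square_integrable_imp_integrable[OF f int])
  have hb: "\<bar>h x\<bar> \<le> B" if "x \<in> space M" for x using bd[OF that] \<open>B > 0\<close> by (auto simp: h_def)
  have hi: "integrable M h"
    by (rule M.integrable_const_bound[of _ B]) (auto simp: hb)
  have n0: "real n > 0" using \<open>n \<ge> 1\<close> by simp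
  have ind: "integrable M (\<lambda>x. indicator {x \<in> space M. \<not> G x} x :: real)"
    by (rule integrable_real_indicator) (auto simp: M.emeasure_eq_measure)
  have "\<bar>integral\<^sup>L M f - integral\<^sup>L M h\<bar> = \<bar>\<integral>x. f x - h x \<partial>M\<bar>"
    using fi hi by simp
  also have "\<dots> \<le> (\<integral>x. \<bar>f x - h x\<bar> \<partial>M)"
    by (rule integral_abs_bound)
  \<comment> \<open>A weighted arithmetic-geometric inequality takes the place of Cauchy-Schwarz.
    The weight \<open>sqrt \<epsilon>\<close> makes both summands of order
    \<open>sqrt \<epsilon>\<close> once the complement of \<open>G\<close> has probability at most
    \<open>\<epsilon>\<close>.\<close>
  also have "\<dots> \<le> (\<integral>x. sqrt \<epsilon> / 2 * (f x)\<^sup>2 + 1 / (2 * sqrt \<epsilon>) * indicator {x \<in> space M. \<not> G x} x \<partial>M)"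
  proof (rule integral_mono)
    show "integrable M (\<lambda>x. \<bar>f x - h x\<bar>)" using fi hi by simp
    show "integrable M (\<lambda>x. sqrt \<epsilon> / 2 * (f x)\<^sup>2 + 1 / (2 * sqrt \<epsilon>) * indicator {x \<in> space M. \<not> G x} x)"
      using int ind by simp
    fix x assume x: "x \<in> space M"
    show "\<bar>f x - h x\<bar> \<le> sqrt \<epsilon> / 2 * (f x)\<^sup>2 + 1 / (2 * sqrt \<epsilon>) * indicator {x \<in> space M. \<not> G x} x"
    proof (cases "G x")
      case True thus ?thesis using eps(2) by (simp add: h_def)
    next
      case False
      have "0 \<le> (sqrt \<epsilon> * \<bar>f x\<bar> - 1)\<^sup>2 / (2 * sqrt \<epsilon>)" using eps(2) by simp
      also have "\<dots> = sqrt \<epsilon> / 2 * (f x)\<^sup>2 + 1 / (2 * sqrt \<epsilon>) - \<bar>f x\<bar>"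
        using eps(2) by (simp add: power2_diff power_mult_distrib field_simps)
      finally show ?thesis using False x by (simp add: h_def)
    qed
  qed
  also have "\<dots> = sqrt \<epsilon> / 2 * (\<integral>x. (f x)\<^sup>2 \<partial>M) + 1 / (2 * sqrt \<epsilon>) * measure M {x \<in> space M. \<not> G x}"
    using int ind by (simp add: Int_def conj_commute cong: conj_cong)
  also have "\<dots> \<le> sqrt \<epsilon> / 2 * Mo + 1 / (2 * sqrt \<epsilon>) * \<epsilon>"
    using mom eps by (intro add_mono mult_left_mono) auto
  also have "\<dots> = sqrt \<epsilon> * (Mo + 1) / 2"
  proof -
    have "1 / (2 * sqrt \<epsilon>) * \<epsilon> = sqrt \<epsilon> / 2"
      using eps(2) real_div_sqrt[of \<epsilon>] by (simp add: field_simps)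
    thus ?thesis by (simp add: algebra_simps add_divide_distrib)
  qed
  finally have b: "\<bar>integral\<^sup>L M f - integral\<^sup>L M h\<bar> \<le> \<delta>" using bias by simp
  let ?A = "{D \<in> space ?P. B * t / sqrt n \<le> \<bar>(\<Sum>i<n. h (D i)) / n - (\<Sum>i<n. integral\<^sup>L M h) / n\<bar>}"
  let ?C = "\<lambda>i. {D \<in> space ?P. \<not> G (D i)}"
  have "{D \<in> space ?P. B * t / sqrt n + \<delta> \<le> \<bar>(\<Sum>i<n. f (D i)) / n - integral\<^sup>L M f\<bar>} \<subseteq> ?A \<union> (\<Union>i\<in>{..<n}. ?C i)"
  proof
    fix D assume D: "D \<in> {D \<in> space ?P. B * t / sqrt n + \<delta> \<le> \<bar>(\<Sum>i<n. f (D i)) / n - integral\<^sup>L M f\<bar>}"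
    show "D \<in> ?A \<union> (\<Union>i\<in>{..<n}. ?C i)"
    proof (cases "\<forall>i<n. G (D i)")
      case True
      hence "(\<Sum>i<n. h (D i)) = (\<Sum>i<n. f (D i))" by (intro sum.cong) (auto simp: h_def)
      thus ?thesis using D b n0 by auto
    qed (use D in auto)
  qed
  hence "measure ?P {D \<in> space ?P. B * t / sqrt n + \<delta> \<le> \<bar>(\<Sum>i<n. f (D i)) / n - integral\<^sup>L M f\<bar>}
      \<le> measure ?P (?A \<union> (\<Union>i\<in>{..<n}. ?C i))"
    by (rule P.finite_measure_mono) measurable
  also have "\<dots> \<le> measure ?P ?A + measure ?P (\<Union>i\<in>{..<n}. ?C i)"
    by (rule measure_Un_le) measurable
  also have "measure ?P ?A \<le> 2 * exp (- t\<^sup>2 / 2)"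
    by (rule Hoeffding_PiM) (use M hb assms in auto)
  also have "measure ?P (\<Union>i\<in>{..<n}. ?C i) \<le> (\<Sum>i<n. measure ?P (?C i))"
    by (rule measure_UNION_le) auto
  also have "\<dots> = (\<Sum>i<n. measure M {x \<in> space M. \<not> G x})"
    by (intro sum.cong refl measure_PiM_component[where M = "\<lambda>_. M"]) (auto simp: M)
  also have "\<dots> \<le> n * \<epsilon>" using eps by (simp add: mult_left_mono)
  finally show ?thesis by simp
qed

section \<open>Gradient descent on a ridge regression loss\<close>

text \<open>The exact second-order expansion lets the single form \<open>Q\<close> carry both
  properties of the loss: its nonnegativity is convexity, its upper bound is smoothness. The
  competitor \<open>a'\<close> is arbitrary, so the minimizer of the loss never has to be
  identified.\<close>

lemma gradient_descent_quadratic: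
  fixes J Q :: "(nat \<Rightarrow> real) \<Rightarrow> real" and G :: "(nat \<Rightarrow> real) \<Rightarrow> nat \<Rightarrow> real"
  assumes expand: "\<And>a v. J (\<lambda>i. a i + v i) = J a + (\<Sum>i<m. G a i * v i) + Q v"
    and Q0: "\<And>v. 0 \<le> Q v" and Qb: "\<And>v. Q v \<le> \<beta> / 2 * (\<Sum>i<m. (v i)\<^sup>2)"
    and eta: "\<eta> > 0" "\<eta> * \<beta> \<le> 1"
  shows "real T * (J (((\<lambda>a i. a i - \<eta> * G a i) ^^ T) a0) - J a')
    \<le> (\<Sum>i<m. (a0 i - a' i)\<^sup>2) / (2 * \<eta>)"
proof -
  let ?step = "\<lambda>a i. a i - \<eta> * G a i"
  let ?D = "\<lambda>a. \<Sum>i<m. (a i - a' i)\<^sup>2"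
  let ?N = "\<lambda>a. \<Sum>i<m. (G a i)\<^sup>2"
  have descent: "J (?step a) \<le> J a - \<eta> / 2 * ?N a" for a
  proof -
    have "Q (\<lambda>i. - \<eta> * G a i) \<le> \<beta> / 2 * (\<Sum>i<m. (- \<eta> * G a i)\<^sup>2)" by (rule Qb)
    also have "\<dots> = (\<eta> * \<beta>) * (\<eta> / 2 * ?N a)"
      by (simp add: power_mult_distrib power2_eq_square sum_distrib_left mult_ac)
    also have "\<dots> \<le> 1 * (\<eta> / 2 * ?N a)"
      using eta by (intro mult_right_mono) (auto intro!: sum_nonneg mult_nonneg_nonneg)
    finally have "Q (\<lambda>i. - \<eta> * G a i) \<le> \<eta> / 2 * ?N a" by simp
    moreover have "(\<Sum>i<m. G a i * (- \<eta> * G a i)) = - \<eta> * ?N a"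
      by (simp add: sum_distrib_left power2_eq_square mult_ac sum_negf)
    ultimately show ?thesis
      using expand[of a "\<lambda>i. - \<eta> * G a i"] by simp
  qed
  have conv: "J a \<le> J a' + (\<Sum>i<m. G a i * (a i - a' i))" for a
  proof -
    have "J a' = J a + (\<Sum>i<m. G a i * (a' i - a i)) + Q (\<lambda>i. a' i - a i)"
      using expand[of a "\<lambda>i. a' i - a i"] by simp
    moreover have "(\<Sum>i<m. G a i * (a i - a' i)) = - (\<Sum>i<m. G a i * (a' i - a i))"
      by (simp add: sum_negf[symmetric] algebra_simps)
    ultimately show ?thesis using Q0[of "\<lambda>i. a' i - a i"] by simp
  qed
  have dist: "?D (?step a) = ?D a - 2 * \<eta> * (\<Sum>i<m. G a i * (a i - a' i)) + \<eta>\<^sup>2 * ?N a" for a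
    by (simp add: sum_distrib_left sum.distrib sum_subtractf[symmetric] flip: sum.distrib)
       (intro sum.cong refl, simp add: power2_eq_square algebra_simps)
  have key: "J (?step a) - J a' + ?D (?step a) / (2 * \<eta>) \<le> ?D a / (2 * \<eta>)" for a
  proof -
    have "?D (?step a) / (2 * \<eta>) = ?D a / (2 * \<eta>) - (\<Sum>i<m. G a i * (a i - a' i)) + \<eta> / 2 * ?N a"
      unfolding dist using eta(1) by (simp add: field_simps power2_eq_square)
    thus ?thesis using descent[of a] conv[of a] by simp
  qed
  \<comment> \<open>The squared distance to \<open>a'\<close> is kept as a potential. Adding
    \<open>key\<close> pays for the new iterate, and the descent property lets the gap of the last
    iterate stand for the gaps of all earlier ones.\<close>
  have "real T * (J ((?step ^^ T) a0) - J a') + ?D ((?step ^^ T) a0) / (2 * \<eta>) \<le> ?D a0 / (2 * \<eta>)"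
  proof (induction T)
    case (Suc T)
    let ?a = "(?step ^^ T) a0"
    have N0: "\<eta> / 2 * ?N ?a \<ge> 0" using eta(1) by (intro mult_nonneg_nonneg sum_nonneg) auto
    have "real T * (J (?step ?a) - J a') \<le> real T * (J ?a - J a')"
      using descent[of ?a] N0 by (intro mult_left_mono) auto
    thus ?case using Suc key[of ?a] by (simp add: algebra_simps)
  qed simp
  moreover have "?D ((?step ^^ T) a0) / (2 * \<eta>) \<ge> 0"
    using eta(1) by (intro divide_nonneg_nonneg sum_nonneg) auto
  ultimately show ?thesis by simp
qed

lemma sum_abs_le_sqrt:
  "(\<Sum>i<(m::nat). \<bar>a i :: real\<bar>)\<^sup>2 \<le> real m * (\<Sum>i<m. (a i)\<^sup>2)"
proof -
  have "(\<Sum>i<m. \<bar>a i\<bar> * 1)\<^sup>2 \<le> (\<Sum>i<m. \<bar>a i\<bar>\<^sup>2) * (\<Sum>i<m. 1\<^sup>2)"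
    by (rule Cauchy_Schwarz_ineq_sum)
  thus ?thesis by (simp add: mult.commute)
qed

text \<open>The penalty has weight \<open>lam / 2\<close> because its gradient must be the term
  \<open>lam * a\<close> that the algorithm adds. The smoothness constant
  \<open>2 * P\<^sup>2 + lam\<close> comes from Cauchy-Schwarz for features bounded by
  \<open>P\<close>.\<close>

lemma gradient_descent_ridge:
  fixes p :: "nat \<Rightarrow> nat \<Rightarrow> real" and y a0 a' :: "nat \<Rightarrow> real" and lam \<eta> P :: real and n m T :: nat
  defines "J \<equiv> \<lambda>a. (1 / real n) * (\<Sum>s<n. ((1 / real m) * (\<Sum>i<m. a i * p s i) - y s)\<^sup>2)
      + lam / 2 * (\<Sum>i<m. (a i)\<^sup>2)"
  defines "G \<equiv> \<lambda>a i. (2 / real n) * (\<Sum>s<n. ((1 / real m) * (\<Sum>i<m. a i * p s i) - y s)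
      * (1 / real m) * p s i) + lam * a i"
  assumes n: "n \<ge> 1" and m: "m \<ge> 1" and lam: "lam \<ge> 0"
    and P: "\<And>s i. s < n \<Longrightarrow> i < m \<Longrightarrow> \<bar>p s i\<bar> \<le> P"
    and eta: "\<eta> > 0" "\<eta> * (2 * P\<^sup>2 + lam) \<le> 1" and T: "T \<ge> 1"
  shows "J (((\<lambda>a i. a i - \<eta> * G a i) ^^ T) a0)
    \<le> J a' + (\<Sum>i<m. (a0 i - a' i)\<^sup>2) / (2 * \<eta> * T)"
proof -
  let ?L = "\<lambda>v s. (1 / real m) * (\<Sum>i<m. v i * p s i)"
  define Q where "Q v = (1 / real n) * (\<Sum>s<n. (?L v s)\<^sup>2) + lam / 2 * (\<Sum>i<m. (v i)\<^sup>2)" for v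
  have n0: "real n > 0" and m0: "real m > 0" using n m by auto
  have L_add: "?L (\<lambda>i. a i + v i) s = ?L a s + ?L v s" for a v s
    by (simp add: algebra_simps sum.distrib)
  have Gsum: "(\<Sum>i<m. G a i * v i) = (2 / n) * (\<Sum>s<n. (?L a s - y s) * ?L v s) + lam * (\<Sum>i<m. a i * v i)" for a v
  proof -
    have "(\<Sum>i<m. G a i * v i) = (\<Sum>i<m. (2 / n) * (\<Sum>s<n. (?L a s - y s) * (1 / m) * p s i * v i) + lam * (a i * v i))"
      unfolding G_def by (intro sum.cong refl) (simp add: algebra_simps sum_distrib_left sum_distrib_right)
    also have "\<dots> = (2 / n) * (\<Sum>i<m. \<Sum>s<n. (?L a s - y s) * (1 / m) * p s i * v i) + lam * (\<Sum>i<m. a i * v i)"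
      by (simp add: sum.distrib sum_distrib_left)
    also have "(\<Sum>i<m. \<Sum>s<n. (?L a s - y s) * (1 / m) * p s i * v i) = (\<Sum>s<n. \<Sum>i<m. (?L a s - y s) * (1 / m) * p s i * v i)"
      by (rule sum.swap)
    also have "\<dots> = (\<Sum>s<n. (?L a s - y s) * ?L v s)"
    proof (intro sum.cong refl)
      fix s
      have "(\<Sum>i<m. c * (1 / m) * p s i * v i) = c * ?L v s" for c
        by (simp add: sum_distrib_left mult_ac)
      thus "(\<Sum>i<m. (?L a s - y s) * (1 / m) * p s i * v i) = (?L a s - y s) * ?L v s" .
    qed
    finally show ?thesis .
  qed
  have expand: "J (\<lambda>i. a i + v i) = J a + (\<Sum>i<m. G a i * v i) + Q v" for a v
  proof -
    have "(\<Sum>s<n. (u s + w s - y s)\<^sup>2)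
        = (\<Sum>s<n. (u s - y s)\<^sup>2) + 2 * (\<Sum>s<n. (u s - y s) * w s) + (\<Sum>s<n. (w s)\<^sup>2)" for u w :: "nat \<Rightarrow> real"
      unfolding sum_distrib_left sum.distrib[symmetric]
      by (intro sum.cong refl) (simp add: power2_eq_square algebra_simps)
    from this[of "?L a" "?L v"] have s1: "(\<Sum>s<n. (?L a s + ?L v s - y s)\<^sup>2)
        = (\<Sum>s<n. (?L a s - y s)\<^sup>2) + 2 * (\<Sum>s<n. (?L a s - y s) * ?L v s) + (\<Sum>s<n. (?L v s)\<^sup>2)" .
    have s2: "(\<Sum>i<m. (a i + v i)\<^sup>2) = (\<Sum>i<m. (a i)\<^sup>2) + 2 * (\<Sum>i<m. a i * v i) + (\<Sum>i<m. (v i)\<^sup>2)"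
      unfolding sum_distrib_left sum.distrib[symmetric]
      by (intro sum.cong refl) (simp add: power2_eq_square algebra_simps)
    have alg: "c' = 2 * c \<Longrightarrow> c * (X + 2 * Y + Z) + lam / 2 * (A + 2 * V + W)
        = (c * X + lam / 2 * A) + (c' * Y + lam * V) + (c * Z + lam / 2 * W)"
      for c c' X Y Z A V W :: real by (simp add: algebra_simps)
    show ?thesis
      unfolding Gsum unfolding J_def Q_def L_add s1 s2 by (rule alg) simp
  qed
  have Q0: "0 \<le> Q v" for v
    unfolding Q_def using lam by (intro add_nonneg_nonneg mult_nonneg_nonneg sum_nonneg) auto
  have Qb: "Q v \<le> (2 * P\<^sup>2 + lam) / 2 * (\<Sum>i<m. (v i)\<^sup>2)" for v
  proof -
    have one: "(?L v s)\<^sup>2 \<le> P\<^sup>2 * (\<Sum>i<m. (v i)\<^sup>2)" if s: "s < n" for s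
    proof -
      have P0: "P \<ge> 0" using P[OF s, of 0] m by auto
      have "(\<Sum>i<m. v i * p s i)\<^sup>2 \<le> (\<Sum>i<m. (v i)\<^sup>2) * (\<Sum>i<m. (p s i)\<^sup>2)"
        by (rule Cauchy_Schwarz_ineq_sum)
      also have "(\<Sum>i<m. (p s i)\<^sup>2) \<le> (\<Sum>i<m. P\<^sup>2)"
      proof (rule sum_mono)
        fix i assume "i \<in> {..<m}"
        thus "(p s i)\<^sup>2 \<le> P\<^sup>2" using power_mono[OF P[OF s, of i], of 2] by simp
      qed
      also have "\<dots> = m * P\<^sup>2" by simp
      \<comment> \<open>Gives away a factor \<open>m\<close>, so that the smoothness constant is
        free of the width; the only effect is a smaller admissible step size.\<close>
      also have "\<dots> \<le> real m * m * P\<^sup>2" using m by (intro mult_right_mono) auto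
      finally have *: "(\<Sum>i<m. v i * p s i)\<^sup>2 \<le> (\<Sum>i<m. (v i)\<^sup>2) * (real m * m * P\<^sup>2)"
        by (simp add: mult_left_mono sum_nonneg)
      show ?thesis
        using * m0 by (simp add: power_mult_distrib power_divide field_simps power2_eq_square)
    qed
    have "(\<Sum>s<n. (?L v s)\<^sup>2) \<le> (\<Sum>s<n. P\<^sup>2 * (\<Sum>i<m. (v i)\<^sup>2))"
      by (rule sum_mono) (use one in auto)
    hence "(1 / real n) * (\<Sum>s<n. (?L v s)\<^sup>2) \<le> P\<^sup>2 * (\<Sum>i<m. (v i)\<^sup>2)"
      using n0 by (simp add: field_simps)
    thus ?thesis unfolding Q_def by (simp add: algebra_simps add_divide_distrib)
  qed
  have "real T * (J (((\<lambda>a i. a i - \<eta> * G a i) ^^ T) a0) - J a') \<le> (\<Sum>i<m. (a0 i - a' i)\<^sup>2) / (2 * \<eta>)"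
    by (rule gradient_descent_quadratic[OF expand Q0 Qb eta])
  thus ?thesis using T eta(1) by (simp add: field_simps)
qed

text \<open>A hidden unit after the first step. The update of row \<open>i\<close> is multiplied by
  \<open>relu' (b i)\<close>, so a unit with nonpositive bias keeps its preactivation
  \<open>b i\<close> and outputs 0 for every input; this is the \<open>else\<close> branch.\<close>

definition cell :: "(nat \<Rightarrow> real) \<Rightarrow> (nat \<Rightarrow> real) \<Rightarrow> nat \<Rightarrow> real \<Rightarrow> real" where
  "cell a0 b i s = (if b i > 0 then relu (a0 i * s + b i) else 0)"

definition ridge_net :: "nat \<Rightarrow> (nat \<Rightarrow> real) \<Rightarrow> (nat \<Rightarrow> real) \<Rightarrow> (nat \<Rightarrow> real) \<Rightarrow> real \<Rightarrow> real" where
  "ridge_net m a0 b a s = (1 / real m) * (\<Sum>i<m. a i * cell a0 b i s)"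

lemma relu_Lipschitz: "\<bar>relu x - relu y\<bar> \<le> \<bar>x - y\<bar>"
  by (auto simp: relu_def max_def)

lemma cell_Lipschitz: "\<bar>a0 i\<bar> = 1 \<Longrightarrow> \<bar>cell a0 b i s - cell a0 b i t\<bar> \<le> \<bar>s - t\<bar>"
  using relu_Lipschitz[of "a0 i * s + b i" "a0 i * t + b i"]
  by (auto simp: cell_def right_diff_distrib[symmetric] abs_mult)

lemma cell_bound: "\<bar>a0 i\<bar> = 1 \<Longrightarrow> \<bar>b i\<bar> \<le> B \<Longrightarrow> \<bar>cell a0 b i s\<bar> \<le> \<bar>s\<bar> + B"
  using abs_mult[of "a0 i" s] by (auto simp: cell_def relu_def max_def)

text \<open>Each unit is 1-Lipschitz, so the mean absolute output weight is a Lipschitz constant.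
  The ridge penalty controls exactly this quantity, and it sets the price of evaluating the network
  at a slightly wrong direction.\<close>

lemma ridge_net_Lipschitz:
  assumes "\<And>i. i < m \<Longrightarrow> \<bar>a0 i\<bar> = 1" and A: "(\<Sum>i<m. \<bar>a i\<bar>) / real m \<le> A"
  shows "\<bar>ridge_net m a0 b a s - ridge_net m a0 b a t\<bar> \<le> A * \<bar>s - t\<bar>"
proof -
  have "\<bar>ridge_net m a0 b a s - ridge_net m a0 b a t\<bar>
      = (1 / m) * \<bar>\<Sum>i<m. a i * (cell a0 b i s - cell a0 b i t)\<bar>"
    by (simp add: ridge_net_def right_diff_distrib sum_subtractf abs_divide diff_divide_distrib[symmetric])
  also have "\<dots> \<le> (1 / m) * (\<Sum>i<m. \<bar>a i\<bar> * \<bar>s - t\<bar>)"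
  proof (intro mult_left_mono order_trans[OF sum_abs] sum_mono)
    fix i assume "i \<in> {..<m}"
    thus "\<bar>a i * (cell a0 b i s - cell a0 b i t)\<bar> \<le> \<bar>a i\<bar> * \<bar>s - t\<bar>"
      using cell_Lipschitz[of a0 i b s t] assms(1)[of i] by (simp add: abs_mult mult_left_mono)
  qed simp
  also have "\<dots> = (\<Sum>i<m. \<bar>a i\<bar>) / m * \<bar>s - t\<bar>" by (simp add: sum_distrib_right)
  also have "\<dots> \<le> A * \<bar>s - t\<bar>" using A by (intro mult_right_mono) auto
  finally show ?thesis .
qed

lemma ridge_net_bound:
  assumes "\<And>i. i < m \<Longrightarrow> \<bar>a0 i\<bar> = 1" "\<And>i. i < m \<Longrightarrow> \<bar>b i\<bar> \<le> B" and "B \<ge> 0" and A: "(\<Sum>i<m. \<bar>a i\<bar>) / real m \<le> A"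
  shows "\<bar>ridge_net m a0 b a s\<bar> \<le> A * (\<bar>s\<bar> + B)"
proof -
  have "\<bar>ridge_net m a0 b a s\<bar> = (1 / m) * \<bar>\<Sum>i<m. a i * cell a0 b i s\<bar>"
    by (simp add: ridge_net_def abs_divide)
  also have "\<dots> \<le> (1 / m) * (\<Sum>i<m. \<bar>a i\<bar> * (\<bar>s\<bar> + B))"
  proof (intro mult_left_mono order_trans[OF sum_abs] sum_mono)
    fix i assume "i \<in> {..<m}"
    thus "\<bar>a i * cell a0 b i s\<bar> \<le> \<bar>a i\<bar> * (\<bar>s\<bar> + B)"
      using cell_bound[of a0 i b B s] assms(1,2)[of i] by (simp add: abs_mult mult_left_mono)
  qed simp
  also have "\<dots> = (\<Sum>i<m. \<bar>a i\<bar>) / m * (\<bar>s\<bar> + B)" by (simp add: sum_distrib_right)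
  also have "\<dots> \<le> A * (\<bar>s\<bar> + B)" using A \<open>B \<ge> 0\<close> by (intro mult_right_mono) auto
  finally show ?thesis .
qed

section \<open>The direction learned by the first step\<close>

definition corr_vec :: "nat \<Rightarrow> ((nat \<Rightarrow> real) \<Rightarrow> real) \<Rightarrow> real \<Rightarrow> (nat \<Rightarrow> nat \<Rightarrow> real) \<Rightarrow> nat \<Rightarrow> real" where
  "corr_vec n y c D l = (1 / real n) * (\<Sum>s<n. (y (D s) - c) * D s l)"

text \<open>Equals \<open>d / (m * \<mu>)\<close> times V^T V h. The normalization makes it an
  estimate of \<open>w\<close>: rows uniform on the sphere give V^T V the mean (m / d) I, and the
  correlation vector \<open>h\<close> estimates \<open>\<mu> * w\<close>.\<close>

definition learned_dir :: "nat \<Rightarrow> nat \<Rightarrow> real \<Rightarrow> (nat \<Rightarrow> nat \<Rightarrow> real) \<Rightarrow> (nat \<Rightarrow> real) \<Rightarrow> nat \<Rightarrow> real" where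
  "learned_dir d m \<mu> V h k = real d / (real m * \<mu>) * (\<Sum>j<m. V j k * (\<Sum>l<d. V j l * h l))"

lemma net_W_zero: "net d m1 m2 a (\<lambda>_ _. 0) b V x = (1 / real m1) * (\<Sum>i<m1. a i * relu (b i))"
  by (simp add: net_def preact_def)

text \<open>With zero inner weights, \<open>relu'\<close> sees only the bias and the network output
  is the constant \<open>c\<close>, so all rows of the gradient are multiples of the one vector V h.
  The choice of \<open>\<eta>1\<close> cancels the factors 2 / m1 of the gradient, m2 / d of V^T V
  and \<open>\<mu>\<close> of Stein's identity; what remains is the free scale
  \<open>\<eta>\<close>.\<close>

lemma first_step_preact:
  fixes \<eta> \<mu> :: real and e b :: "nat \<Rightarrow> real" and V D :: "nat \<Rightarrow> nat \<Rightarrow> real"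
    and y :: "(nat \<Rightarrow> real) \<Rightarrow> real"
  assumes "n \<ge> 1" "d \<ge> 1" "m1 \<ge> 1" "m2 \<ge> 1" "\<mu> \<noteq> 0"
  defines "\<eta>1 \<equiv> real m1 * real d * \<eta> / (2 * real m2 * \<mu>)"
  defines "c \<equiv> (1 / real m1) * (\<Sum>i<m1. e i * relu (b i))"
  defines "W \<equiv> \<lambda>i j. - \<eta>1 * grad_W d n m1 m2 y D e (\<lambda>_ _. 0) b V i j"
  shows "preact d m2 W b V x i
    = (if b i > 0 then e i * (\<eta> * dotp d (learned_dir d m2 \<mu> V (corr_vec n y c D)) x) else 0) + b i"
proof -
  let ?h = "corr_vec n y c D"
  let ?\<kappa> = "\<eta>1 * (2 * e i / m1) * relu' (b i)"
  have W: "W i j = ?\<kappa> * (\<Sum>l<d. V j l * ?h l)" for j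
  proof -
    have "(\<Sum>s<n. (c - y (D s)) * (e i / m1) * relu' (b i) * feat d V (D s) j)
        = - (e i / m1) * relu' (b i) * (\<Sum>s<n. \<Sum>l<d. (y (D s) - c) * (V j l * D s l))"
    proof (subst sum_distrib_left, intro sum.cong refl)
      fix s
      have eq: "(\<Sum>l<d. (y (D s) - c) * (V j l * D s l)) = (y (D s) - c) * feat d V (D s) j"
        by (simp add: feat_def sum_distrib_left)
      have alg: "(c - Y) * A * r * F = - A * r * ((Y - c) * F)" for Y A r F :: real
        by (simp add: algebra_simps)
      show "(c - y (D s)) * (e i / m1) * relu' (b i) * feat d V (D s) j
        = - (e i / m1) * relu' (b i) * (\<Sum>l<d. (y (D s) - c) * (V j l * D s l))"
        unfolding eq by (rule alg)
    qed
    also have "(\<Sum>s<n. \<Sum>l<d. (y (D s) - c) * (V j l * D s l)) = (\<Sum>l<d. \<Sum>s<n. (y (D s) - c) * (V j l * D s l))"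
      by (rule sum.swap)
    also have "\<dots> = n * (\<Sum>l<d. V j l * ?h l)"
      using assms(1) by (simp add: corr_vec_def sum_distrib_left mult_ac)
    finally have "(\<Sum>s<n. (c - y (D s)) * (e i / m1) * relu' (b i) * feat d V (D s) j)
        = - (e i / m1) * relu' (b i) * (n * (\<Sum>l<d. V j l * ?h l))" .
    thus ?thesis
      unfolding W_def grad_W_def net_W_zero c_def[symmetric] using assms(1) by (simp add: preact_def)
  qed
  have "(\<Sum>j<m2. W i j * feat d V x j) = ?\<kappa> * (\<Sum>j<m2. \<Sum>k<d. V j k * (\<Sum>l<d. V j l * ?h l) * x k)"
    unfolding W feat_def
  proof (subst sum_distrib_left, intro sum.cong refl)
    fix j
    have "r * A * (\<Sum>k<d. V j k * x k) = r * (\<Sum>k<d. V j k * A * x k)" for r A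
      by (simp add: sum_distrib_left mult_ac)
    thus "?\<kappa> * (\<Sum>l<d. V j l * ?h l) * (\<Sum>k<d. V j k * x k) = ?\<kappa> * (\<Sum>k<d. V j k * (\<Sum>l<d. V j l * ?h l) * x k)" .
  qed
  also have "(\<Sum>j<m2. \<Sum>k<d. V j k * (\<Sum>l<d. V j l * ?h l) * x k)
      = (\<Sum>k<d. (\<Sum>j<m2. V j k * (\<Sum>l<d. V j l * ?h l)) * x k)"
    by (subst sum.swap) (simp add: sum_distrib_right)
  also have "\<dots> = m2 * \<mu> / d * dotp d (learned_dir d m2 \<mu> V ?h) x"
    unfolding dotp_def learned_dir_def sum_distrib_left[where r = "m2 * \<mu> / d"]
    using assms by (intro sum.cong refl) simp
  finally have "(\<Sum>j<m2. W i j * feat d V x j)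
      = ?\<kappa> * (m2 * \<mu> / d * dotp d (learned_dir d m2 \<mu> V ?h) x)" .
  moreover have "?\<kappa> * (m2 * \<mu> / d * z) = (if b i > 0 then e i * (\<eta> * z) else 0)" for z
    using assms(1-5) by (simp add: \<eta>1_def relu'_def field_simps)
  ultimately show ?thesis by (simp add: preact_def)
qed

lemma first_step_relu:
  fixes \<eta> \<mu> :: real and e b :: "nat \<Rightarrow> real" and V D :: "nat \<Rightarrow> nat \<Rightarrow> real"
    and y :: "(nat \<Rightarrow> real) \<Rightarrow> real"
  assumes "n \<ge> 1" "d \<ge> 1" "m1 \<ge> 1" "m2 \<ge> 1" "\<mu> \<noteq> 0"
  defines "\<eta>1 \<equiv> real m1 * real d * \<eta> / (2 * real m2 * \<mu>)"
  defines "c \<equiv> (1 / real m1) * (\<Sum>i<m1. e i * relu (b i))"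
  defines "W \<equiv> \<lambda>i j. - \<eta>1 * grad_W d n m1 m2 y D e (\<lambda>_ _. 0) b V i j"
  shows "relu (preact d m2 W b V x i)
    = cell e b i (\<eta> * dotp d (learned_dir d m2 \<mu> V (corr_vec n y c D)) x)"
  using first_step_preact[OF assms(1-5), where e = e and b = b and y = y and D = D and V = V and \<eta> = \<eta>]
  unfolding W_def \<eta>1_def c_def by (simp add: cell_def relu_def)

lemma first_step_net:
  fixes \<eta> \<mu> :: real and a0 b :: "nat \<Rightarrow> real" and V D :: "nat \<Rightarrow> nat \<Rightarrow> real"
    and y :: "(nat \<Rightarrow> real) \<Rightarrow> real"
  assumes "n \<ge> 1" "d \<ge> 1" "m1 \<ge> 1" "m2 \<ge> 1" "\<mu> \<noteq> 0"
  defines "\<eta>1 \<equiv> real m1 * real d * \<eta> / (2 * real m2 * \<mu>)"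
  defines "c \<equiv> (1 / real m1) * (\<Sum>i<m1. a0 i * relu (b i))"
  defines "W \<equiv> \<lambda>i j. - \<eta>1 * grad_W d n m1 m2 y D a0 (\<lambda>_ _. 0) b V i j"
  shows "net d m1 m2 a W b V x
    = ridge_net m1 a0 b a (\<eta> * dotp d (learned_dir d m2 \<mu> V (corr_vec n y c D)) x)"
  unfolding net_def ridge_net_def W_def \<eta>1_def c_def first_step_relu[OF assms(1-5)] ..

lemma sum_abs_le_sqrt_card:
  assumes "(\<Sum>k<(d::nat). (w k)\<^sup>2) \<le> (1::real)"
  shows "(\<Sum>k<d. \<bar>w k\<bar>) \<le> sqrt d"
proof (rule real_le_rsqrt)
  have "(\<Sum>k<d. \<bar>w k\<bar>)\<^sup>2 \<le> d * (\<Sum>k<d. (w k)\<^sup>2)" by (rule sum_abs_le_sqrt)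
  also have "\<dots> \<le> real d * 1" using assms by (intro mult_left_mono) auto
  finally show "(\<Sum>k<d. \<bar>w k\<bar>)\<^sup>2 \<le> d" by simp
qed

text \<open>With M = (d / m) V^T V, the error is \<open>\<mu> * (u - w)\<close> = (M - I) h + (h -
  \<open>\<mu> * w\<close>). The entries of M - I are of order 1 / sqrt m, and the l1 norm of
  \<open>h\<close> is of order sqrt d, which gives sqrt (d / rho) per coordinate.\<close>

lemma learned_dir_error:
  fixes w h :: "nat \<Rightarrow> real" and \<mu> B :: real
  assumes m: "m \<ge> 1" "\<rho> \<ge> 1" "real \<rho> \<le> m" "real \<rho> \<le> n" "real d ^ 2 \<le> \<rho>" and d: "d \<ge> 1"
    and w: "(\<Sum>k<d. (w k)\<^sup>2) = 1"
    and B: "B \<ge> 1" "\<bar>\<mu>\<bar> \<le> B" "1 / \<bar>\<mu>\<bar> \<le> B" "\<mu> \<noteq> 0"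
    and h: "\<And>k. k < d \<Longrightarrow> \<bar>h k - \<mu> * w k\<bar> \<le> 2 * B\<^sup>2 / sqrt (real n)"
    and V: "\<And>k l. k < d \<Longrightarrow> l < d \<Longrightarrow>
      \<bar>real d / real m * (\<Sum>j<m. V j k * V j l) - (if k = l then 1 else 0)\<bar> \<le> B / sqrt (real m)"
    and k: "k < d"
  shows "\<bar>learned_dir d m \<mu> V h k - w k\<bar> \<le> 5 * B ^ 4 * (sqrt d / sqrt \<rho>)"
proof -
  define M where "M k l = real d / real m * (\<Sum>j<m. V j k * V j l)" for k l
  have \<rho>0: "real \<rho> > 0" using m(2) by simp
  have d1: "real d \<ge> 1" using d by simp
  have sd: "1 \<le> sqrt d" "sqrt d \<le> real d" using d1 by (auto intro: real_le_lsqrt simp: power2_eq_square)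
  have ns: "sqrt \<rho> \<le> sqrt n" "sqrt \<rho> \<le> sqrt m" using m by auto
  have ds: "real d \<le> sqrt \<rho>" using m(5) by (intro real_le_rsqrt)
  have sr: "sqrt \<rho> > 0" using \<rho>0 by simp
  have eq: "\<mu> * learned_dir d m \<mu> V h k = (\<Sum>l<d. M k l * h l)"
  proof -
    have "\<mu> * learned_dir d m \<mu> V h k = d / m * (\<Sum>j<m. \<Sum>l<d. V j k * (V j l * h l))"
      using B(4) by (simp add: learned_dir_def sum_distrib_left)
    also have "(\<Sum>j<m. \<Sum>l<d. V j k * (V j l * h l)) = (\<Sum>l<d. \<Sum>j<m. V j k * (V j l * h l))"
      by (rule sum.swap)
    also have "d / m * \<dots> = (\<Sum>l<d. M k l * h l)"
      by (simp add: M_def sum_distrib_left sum_distrib_right mult_ac)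
    finally show ?thesis .
  qed
  have "\<mu> * (learned_dir d m \<mu> V h k - w k)
      = (\<Sum>l<d. (M k l - (if k = l then 1 else 0)) * h l) + (h k - \<mu> * w k)"
  proof -
    have "(\<Sum>l<d. (M k l - (if k = l then 1 else 0)) * h l) = (\<Sum>l<d. M k l * h l) - (\<Sum>l<d. if k = l then h l else 0)"
      by (simp add: left_diff_distrib sum_subtractf if_distrib[of "\<lambda>z. z * _"] cong: if_cong)
    thus ?thesis using k eq by (simp add: algebra_simps)
  qed
  also have "\<bar>\<dots>\<bar> \<le> \<bar>\<Sum>l<d. (M k l - (if k = l then 1 else 0)) * h l\<bar> + \<bar>h k - \<mu> * w k\<bar>"
    by (rule abs_triangle_ineq)
  also have "\<bar>\<Sum>l<d. (M k l - (if k = l then 1 else 0)) * h l\<bar> \<le> (\<Sum>l<d. B / sqrt m * \<bar>h l\<bar>)"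
  proof (rule order_trans[OF sum_abs], rule sum_mono)
    fix l assume "l \<in> {..<d}"
    thus "\<bar>(M k l - (if k = l then 1 else 0)) * h l\<bar> \<le> B / sqrt m * \<bar>h l\<bar>"
      unfolding abs_mult using V[OF k, of l] by (intro mult_right_mono) (auto simp: M_def)
  qed
  also have "\<dots> = B / sqrt m * (\<Sum>l<d. \<bar>h l\<bar>)" by (simp add: sum_distrib_left)
  finally have tri: "\<bar>\<mu> * (learned_dir d m \<mu> V h k - w k)\<bar>
      \<le> B / sqrt m * (\<Sum>l<d. \<bar>h l\<bar>) + \<bar>h k - \<mu> * w k\<bar>" by simp
  have "(\<Sum>l<d. \<bar>h l\<bar>) \<le> (\<Sum>l<d. B * \<bar>w l\<bar> + 2 * B\<^sup>2 / sqrt n)"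
  proof (rule sum_mono)
    fix l assume "l \<in> {..<d}"
    hence "\<bar>h l\<bar> \<le> \<bar>\<mu> * w l\<bar> + 2 * B\<^sup>2 / sqrt n" using h[of l] by auto
    also have "\<bar>\<mu> * w l\<bar> \<le> B * \<bar>w l\<bar>" unfolding abs_mult using B by (intro mult_right_mono) auto
    finally show "\<bar>h l\<bar> \<le> B * \<bar>w l\<bar> + 2 * B\<^sup>2 / sqrt n" by simp
  qed
  also have "\<dots> = B * (\<Sum>l<d. \<bar>w l\<bar>) + d * (2 * B\<^sup>2 / sqrt n)" by (simp add: sum.distrib sum_distrib_left)
  \<comment> \<open>The first summand is Cauchy-Schwarz for the unit vector \<open>w\<close>; the
    second uses \<open>real d \<le> sqrt n\<close>, a consequence of
    \<open>real d ^ 2 \<le> \<rho>\<close> and \<open>\<rho> \<le> n\<close>.\<close>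
  also have "\<dots> \<le> B * sqrt d + 2 * B\<^sup>2 * 1"
  proof (rule add_mono)
    show "B * (\<Sum>l<d. \<bar>w l\<bar>) \<le> B * sqrt d" using sum_abs_le_sqrt_card[where w = w and d = d] w B by (intro mult_left_mono) auto
    have "real d \<le> sqrt n" "0 < sqrt n" using ds ns sr by linarith+
    hence "real d / sqrt n \<le> 1" by (subst divide_le_eq_1_pos) auto
    hence "2 * B\<^sup>2 * (real d / sqrt n) \<le> 2 * B\<^sup>2 * 1" by (intro mult_left_mono) auto
    thus "d * (2 * B\<^sup>2 / sqrt n) \<le> 2 * B\<^sup>2 * 1" by (simp add: mult_ac)
  qed
  also have "\<dots> \<le> 3 * B\<^sup>2 * sqrt d"
  proof -
    have "B * sqrt d \<le> B\<^sup>2 * sqrt d" using B(1) by (intro mult_right_mono) (auto simp: power2_eq_square)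
    moreover have "2 * B\<^sup>2 * 1 \<le> 2 * B\<^sup>2 * sqrt d" using sd by (intro mult_left_mono) auto
    ultimately show ?thesis by simp
  qed
  finally have "B / sqrt m * (\<Sum>l<d. \<bar>h l\<bar>) \<le> B / sqrt m * (3 * B\<^sup>2 * sqrt d)"
    using B(1) by (intro mult_left_mono) auto
  with tri have "\<bar>\<mu> * (learned_dir d m \<mu> V h k - w k)\<bar> \<le> B / sqrt m * (3 * B\<^sup>2 * sqrt d) + \<bar>h k - \<mu> * w k\<bar>"
    by linarith
  also have "B / sqrt m * (3 * B\<^sup>2 * sqrt d) \<le> B / sqrt \<rho> * (3 * B\<^sup>2 * sqrt d)"
    using ns B sr by (intro mult_right_mono divide_left_mono mult_pos_pos) auto
  also have "\<bar>h k - \<mu> * w k\<bar> \<le> 2 * B\<^sup>2 / sqrt n" by (rule h[OF k])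
  also have "\<dots> \<le> 2 * B\<^sup>2 / sqrt \<rho>"
    using ns B sr by (intro divide_left_mono mult_pos_pos) auto
  also have "\<dots> \<le> 2 * B ^ 3 * sqrt d / sqrt \<rho>"
  proof -
    have "2 * B\<^sup>2 * 1 \<le> 2 * (B\<^sup>2 * B) * sqrt d"
      using B sd by (intro mult_mono) auto
    thus ?thesis using sr by (intro divide_right_mono) (auto simp: power2_eq_square power3_eq_cube)
  qed
  finally have "\<bar>\<mu> * (learned_dir d m \<mu> V h k - w k)\<bar> \<le> 5 * B ^ 3 * (sqrt d / sqrt \<rho>)"
    by (simp add: power3_eq_cube power2_eq_square)
  hence "(1 / \<bar>\<mu>\<bar>) * \<bar>\<mu> * (learned_dir d m \<mu> V h k - w k)\<bar> \<le> B * (5 * B ^ 3 * (sqrt d / sqrt \<rho>))"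
    using B by (intro mult_mono) auto
  thus ?thesis using B(4) by (simp add: abs_mult power4_eq_xxxx power3_eq_cube mult_ac)
qed

text \<open>The conclusion holds for every \<open>v\<close> at once, so it may be applied to a
  vector computed from the data. The entrywise deviations cost the square of the l1 norm of
  \<open>v\<close>, that is a factor d / sqrt n, and this is at most 1 when
  \<open>real d ^ 2 \<le> n\<close>.\<close>

lemma empirical_second_moment:
  fixes v :: "nat \<Rightarrow> real" and D :: "nat \<Rightarrow> nat \<Rightarrow> real"
  assumes n: "n \<ge> 1" "real d ^ 2 \<le> n" and B: "B \<ge> 1"
    and C: "\<And>k l. k < d \<Longrightarrow> l < d \<Longrightarrow>
      \<bar>(1 / real n) * (\<Sum>s<n. D s k * D s l) - (if k = l then 1 else 0)\<bar> \<le> B / sqrt n"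
  shows "(1 / real n) * (\<Sum>s<n. (dotp d v (D s))\<^sup>2) \<le> 2 * B * (\<Sum>k<d. (v k)\<^sup>2)"
proof -
  define S where "S k l = (1 / real n) * (\<Sum>s<n. D s k * D s l)" for k l
  have n0: "real n > 0" using n by simp
  have "(dotp d v (D s))\<^sup>2 = (\<Sum>k<d. \<Sum>l<d. v k * v l * (D s k * D s l))" for s
    by (simp add: dotp_def power2_eq_square sum_product mult_ac)
  hence "(\<Sum>s<n. (dotp d v (D s))\<^sup>2) = (\<Sum>s<n. \<Sum>k<d. \<Sum>l<d. v k * v l * (D s k * D s l))" by simp
  also have "\<dots> = (\<Sum>k<d. \<Sum>l<d. \<Sum>s<n. v k * v l * (D s k * D s l))"
  proof -
    have "(\<Sum>s<n. \<Sum>k<d. \<Sum>l<d. v k * v l * (D s k * D s l)) = (\<Sum>k<d. \<Sum>s<n. \<Sum>l<d. v k * v l * (D s k * D s l))"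
      by (rule sum.swap)
    also have "\<dots> = (\<Sum>k<d. \<Sum>l<d. \<Sum>s<n. v k * v l * (D s k * D s l))"
      by (rule sum.cong[OF refl]) (rule sum.swap)
    finally show ?thesis .
  qed
  finally have "(1 / real n) * (\<Sum>s<n. (dotp d v (D s))\<^sup>2) = (\<Sum>k<d. \<Sum>l<d. v k * v l * S k l)"
    by (simp add: S_def sum_distrib_left mult_ac)
  also have "\<dots> = (\<Sum>k<d. \<Sum>l<d. v k * v l * (S k l - (if k = l then 1 else 0))) + (\<Sum>k<d. (v k)\<^sup>2)"
    by (simp add: right_diff_distrib sum_subtractf if_distrib[of "\<lambda>z. _ * z"] power2_eq_square cong: if_cong)
  also have "(\<Sum>k<d. \<Sum>l<d. v k * v l * (S k l - (if k = l then 1 else 0)))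
      \<le> (\<Sum>k<d. \<Sum>l<d. \<bar>v k\<bar> * \<bar>v l\<bar> * (B / sqrt n))"
  proof (intro sum_mono)
    fix k l assume "k \<in> {..<d}" "l \<in> {..<d}"
    hence "\<bar>v k * v l * (S k l - (if k = l then 1 else 0))\<bar> \<le> \<bar>v k\<bar> * \<bar>v l\<bar> * (B / sqrt n)"
      unfolding abs_mult using C[of k l] by (intro mult_left_mono) (auto simp: S_def)
    thus "v k * v l * (S k l - (if k = l then 1 else 0)) \<le> \<bar>v k\<bar> * \<bar>v l\<bar> * (B / sqrt n)" by linarith
  qed
  also have "\<dots> = B / sqrt n * (\<Sum>k<d. \<bar>v k\<bar>)\<^sup>2"
    by (simp add: power2_eq_square sum_product sum_distrib_left mult_ac)
  also have "\<dots> \<le> B / sqrt n * (d * (\<Sum>k<d. (v k)\<^sup>2))"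
    using B by (intro mult_left_mono sum_abs_le_sqrt) auto
  also have "\<dots> = B * (real d / sqrt n) * (\<Sum>k<d. (v k)\<^sup>2)" by simp
  also have "\<dots> \<le> B * 1 * (\<Sum>k<d. (v k)\<^sup>2)"
  proof -
    have "real d \<le> sqrt n" using n by (intro real_le_rsqrt) auto
    hence "real d / sqrt n \<le> 1" using n0 by (simp add: divide_le_eq_1)
    thus ?thesis using B by (intro mult_right_mono mult_left_mono sum_nonneg) auto
  qed
  finally have "(1 / real n) * (\<Sum>s<n. (dotp d v (D s))\<^sup>2) \<le> (B + 1) * (\<Sum>k<d. (v k)\<^sup>2)"
    by (simp add: algebra_simps)
  also have "\<dots> \<le> 2 * B * (\<Sum>k<d. (v k)\<^sup>2)" using B by (intro mult_right_mono sum_nonneg) auto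
  finally show ?thesis .
qed

section \<open>Uniform deviations of Lipschitz functions on the line\<close>

definition grid :: "real \<Rightarrow> nat \<Rightarrow> nat \<Rightarrow> real" where
  "grid R J j = - R + 2 * R * real j / real J"

lemma grid_cell:
  assumes R: "R > 0" and J: "J \<ge> 1" and x: "- R \<le> x"
  obtains k where "k \<le> J" "\<And>j. j \<le> J \<Longrightarrow> grid R J j \<le> x \<longleftrightarrow> j \<le> k"
    "grid R J k \<le> x" "x \<le> R \<Longrightarrow> x - grid R J k \<le> 2 * R / J"
proof -
  have J0: "real J > 0" using J by simp
  define q where "q = (x + R) * J / (2 * R)"
  have q0: "q \<ge> 0" using x R by (simp add: q_def)
  have le: "grid R J j \<le> x \<longleftrightarrow> real j \<le> q" for j
    using R J0 by (simp add: grid_def q_def field_simps)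
  \<comment> \<open>The minimum sends points beyond \<open>R\<close> to the last grid point; only
    for \<open>x \<le> R\<close> is the distance to the grid point bounded.\<close>
  define k where "k = min J (nat \<lfloor>q\<rfloor>)"
  have fl: "real j \<le> q \<longleftrightarrow> j \<le> nat \<lfloor>q\<rfloor>" for j
    using q0 by (simp add: le_nat_floor le_nat_iff le_floor_iff)
  have k: "grid R J k \<le> x" unfolding le fl k_def by simp
  have "x - grid R J k \<le> 2 * R / J" if "x \<le> R"
  proof -
    have "q \<le> J" using that R J0 by (simp add: q_def field_simps)
    have "q < real k + 1"
    proof (cases "nat \<lfloor>q\<rfloor> \<le> J")
      case True
      hence "k = nat \<lfloor>q\<rfloor>" by (simp add: k_def)
      thus ?thesis using q0 by linarith
    next
      case False thus ?thesis using \<open>q \<le> J\<close> by (simp add: k_def)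
    qed
    moreover have "x - grid R J k = (q - k) * (2 * R / J)"
      using R J0 by (simp add: grid_def q_def field_simps)
    ultimately show ?thesis
      using R J0 mult_right_mono[of "q - k" 1 "2 * R / J"] by simp
  qed
  moreover have "grid R J j \<le> x \<longleftrightarrow> j \<le> k" if "j \<le> J" for j
    unfolding le fl k_def using that by auto
  ultimately show thesis using that[of k] k by (auto simp: k_def)
qed

lemma grid_bounds: "R > 0 \<Longrightarrow> j \<le> J \<Longrightarrow> J \<ge> 1 \<Longrightarrow> \<bar>grid R J j\<bar> \<le> R"
proof -
  assume a: "R > 0" "j \<le> J" "J \<ge> 1"
  have "2 * R * real j / real J \<le> 2 * R * 1"
    using a by (simp add: divide_le_eq)
  moreover have "2 * R * real j / real J \<ge> 0" using a by simp
  ultimately show ?thesis by (simp add: grid_def abs_le_iff)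
qed

text \<open>The step function interpolating \<open>\<psi>\<close> on the grid is a combination of indicators of half
  lines whose coefficients have total variation at most \<open>2 R K\<close>; this is what makes the deviation
  bound uniform over all \<open>K\<close>-Lipschitz \<open>\<psi>\<close>.\<close>

lemma uniform_Lipschitz_deviation:
  fixes \<psi> :: "real \<Rightarrow> real" and z :: "nat \<Rightarrow> real" and n J :: nat and N :: "real measure"
  assumes N: "prob_space N" and sN[measurable_cong]: "sets N = sets borel"
    and R: "R > 0" and J: "J \<ge> 1" and n: "n \<ge> 1"
    and lip: "\<And>x y. \<bar>x\<bar> \<le> R \<Longrightarrow> \<bar>y\<bar> \<le> R \<Longrightarrow> \<bar>\<psi> x - \<psi> y\<bar> \<le> K * \<bar>x - y\<bar>"
    and nonneg: "\<And>x. 0 \<le> \<psi> x"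
    and z: "\<And>s. s < n \<Longrightarrow> \<bar>z s\<bar> \<le> R"
    and dev: "\<And>j. j \<le> J \<Longrightarrow>
      \<bar>(\<Sum>s<n. indicator {grid R J j..} (z s)) / real n - measure N {grid R J j..}\<bar> \<le> \<delta>"
    and int: "integrable N \<psi>" and tail: "(\<integral>x. \<psi> x * indicator {x. R < \<bar>x\<bar>} x \<partial>N) \<le> \<tau>"
  shows "integral\<^sup>L N \<psi> \<le> (\<Sum>s<n. \<psi> (z s)) / real n + 4 * K * R / J + (\<psi> (- R) + 2 * K * R) * \<delta> + \<tau>"
proof -
  interpret prob_space N by fact
  let ?t = "grid R J"
  have n0: "real n > 0" and J0: "real J > 0" using n J by auto
  have tb: "\<bar>?t j\<bar> \<le> R" if "j \<le> J" for j using grid_bounds that R J by blast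
  have K0: "K \<ge> 0"
  proof -
    have "0 \<le> K * \<bar>R - (- R)\<bar>" using lip[of R "- R"] R by (smt (verit))
    thus ?thesis using R by (simp add: zero_le_mult_iff)
  qed
  have t0: "?t 0 = - R" by (simp add: grid_def)
  \<comment> \<open>On [-R, R] the sum telescopes to the value of \<open>\<psi>\<close> at the grid
    point to the left of \<open>x\<close>; to the left of -R every indicator vanishes, and to the
    right of \<open>R\<close> the value stays at the last grid point.\<close>
  define \<phi> where "\<phi> x = \<psi> (?t 0) * indicator {?t 0..} x
    + (\<Sum>j<J. (\<psi> (?t (Suc j)) - \<psi> (?t j)) * indicator {?t (Suc j)..} x)" for x
  have \<phi>_val: "\<exists>k\<le>J. \<phi> x = \<psi> (?t k) \<and> ?t k \<le> x \<and> (x \<le> R \<longrightarrow> x - ?t k \<le> 2 * R / J)" if x: "- R \<le> x" for x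
  proof -
    obtain k where k: "k \<le> J" "\<And>j. j \<le> J \<Longrightarrow> ?t j \<le> x \<longleftrightarrow> j \<le> k"
      "?t k \<le> x" "x \<le> R \<Longrightarrow> x - ?t k \<le> 2 * R / J"
      using grid_cell[OF R J x] by blast
    have "(\<Sum>j<J. (\<psi> (?t (Suc j)) - \<psi> (?t j)) * indicator {?t (Suc j)..} x)
        = (\<Sum>j<J. if j < k then \<psi> (?t (Suc j)) - \<psi> (?t j) else 0)"
      using k(2) by (intro sum.cong refl) (auto simp: indicator_def Suc_le_eq)
    also have "\<dots> = (\<Sum>j\<in>{..<J} \<inter> {j. j < k}. \<psi> (?t (Suc j)) - \<psi> (?t j))"
      by (simp add: sum.If_cases)
    also have "{..<J} \<inter> {j. j < k} = {..<k}" using k(1) by auto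
    also have "(\<Sum>j<k. \<psi> (?t (Suc j)) - \<psi> (?t j)) = \<psi> (?t k) - \<psi> (?t 0)"
      by (rule sum_lessThan_telescope)
    finally have "\<phi> x = \<psi> (?t k)" using k(2)[of 0] by (simp add: \<phi>_def)
    thus ?thesis using k by blast
  qed
  have close: "\<bar>\<phi> x - \<psi> x\<bar> \<le> K * (2 * R / J)" if x: "\<bar>x\<bar> \<le> R" for x
  proof -
    have "- R \<le> x" "x \<le> R" using x by auto
    with \<phi>_val[of x] obtain k where k: "k \<le> J" "\<phi> x = \<psi> (?t k)" "?t k \<le> x" "x - ?t k \<le> 2 * R / J"
      by blast
    have "\<bar>\<phi> x - \<psi> x\<bar> \<le> K * \<bar>?t k - x\<bar>"
      unfolding k(2) by (rule lip[OF tb[OF k(1)] x])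
    also have "\<dots> \<le> K * (2 * R / J)" using k K0 by (intro mult_left_mono) auto
    finally show ?thesis .
  qed
  have \<phi>0: "\<phi> x \<ge> 0" for x
  proof (cases "- R \<le> x")
    case True thus ?thesis using \<phi>_val[OF True] nonneg by auto
  next
    case False
    have "?t j > x" if "j \<le> J" for j using tb[OF that] False by auto
    hence z: "(indicator {?t j..} x :: real) = 0" if "j \<le> J" for j using that by (simp add: indicator_def not_le)
    have "\<phi> x = 0" unfolding \<phi>_def using z by (simp add: sum.neutral Suc_le_eq)
    thus ?thesis by simp
  qed
  have [measurable]: "\<psi> \<in> borel_measurable N" using int by simp
  have i1: "integrable N (\<lambda>x. indicator {a..} x :: real)" for a
    by (rule integrable_const_bound[of _ 1]) auto
  have \<phi>i: "integrable N \<phi>" unfolding \<phi>_def using i1 by (intro Bochner_Integration.integrable_add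
        Bochner_Integration.integrable_sum integrable_mult_right) auto
  have tli: "integrable N (\<lambda>x. \<psi> x * indicator {x. R < \<bar>x\<bar>} x)"
    by (rule integrable_real_mult_indicator[OF _ int]) measurable
  have mE: "(\<integral>x. indicator {a..} x \<partial>N) = measure N {a..}" for a :: real
    using sets_eq_imp_space_eq[OF sN] by simp
  \<comment> \<open>Inside [-R, R] the interpolation error pays for the difference. Outside, the
    whole of \<open>\<psi>\<close> is charged to the tail term, and only the nonnegativity of
    \<open>\<phi>\<close> is used.\<close>
  have "integral\<^sup>L N \<psi> \<le> (\<integral>x. \<phi> x + K * (2 * R / J) + \<psi> x * indicator {x. R < \<bar>x\<bar>} x \<partial>N)"
  proof (rule integral_mono[OF int])
    show "integrable N (\<lambda>x. \<phi> x + K * (2 * R / J) + \<psi> x * indicator {x. R < \<bar>x\<bar>} x)"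
      using \<phi>i tli by auto
    fix x
    have K2: "K * (2 * R / J) \<ge> 0" using K0 R by simp
    show "\<psi> x \<le> \<phi> x + K * (2 * R / J) + \<psi> x * indicator {x. R < \<bar>x\<bar>} x"
    proof (cases "\<bar>x\<bar> \<le> R")
      case True thus ?thesis using close[OF True] by auto
    next
      case False thus ?thesis using \<phi>0[of x] K2 by auto
    qed
  qed
  also have "\<dots> = integral\<^sup>L N \<phi> + K * (2 * R / J) + (\<integral>x. \<psi> x * indicator {x. R < \<bar>x\<bar>} x \<partial>N)"
    using \<phi>i tli by (simp add: prob_space)
  also have "\<dots> \<le> integral\<^sup>L N \<phi> + K * (2 * R / J) + \<tau>" using tail by simp
  finally have A: "integral\<^sup>L N \<psi> \<le> integral\<^sup>L N \<phi> + K * (2 * R / J) + \<tau>" .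
  define p where "p j = measure N {?t j..}" for j
  define p' where "p' j = (\<Sum>s<n. indicator {?t j..} (z s)) / real n" for j
  have dev': "\<bar>p' j - p j\<bar> \<le> \<delta>" if "j \<le> J" for j using dev[OF that] by (simp add: p_def p'_def)
  have E1: "integral\<^sup>L N \<phi> = \<psi> (?t 0) * p 0 + (\<Sum>j<J. (\<psi> (?t (Suc j)) - \<psi> (?t j)) * p (Suc j))"
  proof -
    have "integral\<^sup>L N \<phi> = (\<integral>x. \<psi> (?t 0) * indicator {?t 0..} x \<partial>N)
        + (\<integral>x. (\<Sum>j<J. (\<psi> (?t (Suc j)) - \<psi> (?t j)) * indicator {?t (Suc j)..} x) \<partial>N)"
      unfolding \<phi>_def
      by (intro Bochner_Integration.integral_add Bochner_Integration.integrable_sum integrable_mult_right i1)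
    also have "(\<integral>x. (\<Sum>j<J. (\<psi> (?t (Suc j)) - \<psi> (?t j)) * indicator {?t (Suc j)..} x) \<partial>N)
        = (\<Sum>j<J. \<integral>x. (\<psi> (?t (Suc j)) - \<psi> (?t j)) * indicator {?t (Suc j)..} x \<partial>N)"
      by (intro Bochner_Integration.integral_sum integrable_mult_right i1)
    finally show ?thesis by (simp only: integral_mult_right_zero mE p_def)
  qed
  have E2: "(\<Sum>s<n. \<phi> (z s)) / n = \<psi> (?t 0) * p' 0 + (\<Sum>j<J. (\<psi> (?t (Suc j)) - \<psi> (?t j)) * p' (Suc j))"
  proof -
    have "(\<Sum>s<n. \<phi> (z s)) = \<psi> (?t 0) * (\<Sum>s<n. indicator {?t 0..} (z s))
       + (\<Sum>s<n. \<Sum>j<J. (\<psi> (?t (Suc j)) - \<psi> (?t j)) * indicator {?t (Suc j)..} (z s))"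
      by (simp add: \<phi>_def sum.distrib sum_distrib_left)
    also have "(\<Sum>s<n. \<Sum>j<J. (\<psi> (?t (Suc j)) - \<psi> (?t j)) * indicator {?t (Suc j)..} (z s))
       = (\<Sum>j<J. (\<psi> (?t (Suc j)) - \<psi> (?t j)) * (\<Sum>s<n. indicator {?t (Suc j)..} (z s)))"
      by (subst sum.swap) (simp add: sum_distrib_left)
    finally show ?thesis
      by (simp add: p'_def add_divide_distrib sum_divide_distrib[where A = "{..<J}"])
  qed
  \<comment> \<open>\<open>E1\<close> and \<open>E2\<close> have the same coefficients, so only the
    deviations of the half-line probabilities remain. Their total weight is the value at -R plus
    \<open>J\<close> increments of size at most \<open>K * (2 * R / J)\<close>.\<close>
  have "integral\<^sup>L N \<phi> - (\<Sum>s<n. \<phi> (z s)) / n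
      = \<psi> (?t 0) * (p 0 - p' 0) + (\<Sum>j<J. (\<psi> (?t (Suc j)) - \<psi> (?t j)) * (p (Suc j) - p' (Suc j)))"
    unfolding E1 E2 by (simp add: right_diff_distrib sum_subtractf)
  also have "\<dots> \<le> \<psi> (?t 0) * \<delta> + (\<Sum>j<J. K * (2 * R / J) * \<delta>)"
  proof (intro add_mono sum_mono)
    show "\<psi> (?t 0) * (p 0 - p' 0) \<le> \<psi> (?t 0) * \<delta>"
      using dev'[of 0] nonneg by (intro mult_left_mono) auto
    fix j assume j: "j \<in> {..<J}"
    have "\<bar>(\<psi> (?t (Suc j)) - \<psi> (?t j)) * (p (Suc j) - p' (Suc j))\<bar> \<le> (K * (2 * R / J)) * \<delta>"
      unfolding abs_mult
    proof (intro mult_mono)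
      have "\<bar>\<psi> (?t (Suc j)) - \<psi> (?t j)\<bar> \<le> K * \<bar>?t (Suc j) - ?t j\<bar>"
        using j by (intro lip tb) auto
      also have "?t (Suc j) - ?t j = 2 * R / J" by (simp add: grid_def add_divide_distrib ring_distribs)
      finally show "\<bar>\<psi> (?t (Suc j)) - \<psi> (?t j)\<bar> \<le> K * (2 * R / J)" using R by simp
      show "\<bar>p (Suc j) - p' (Suc j)\<bar> \<le> \<delta>" using dev'[of "Suc j"] j by auto
    qed (use K0 R in auto)
    thus "(\<psi> (?t (Suc j)) - \<psi> (?t j)) * (p (Suc j) - p' (Suc j)) \<le> K * (2 * R / J) * \<delta>" by linarith
  qed
  also have "\<dots> = (\<psi> (- R) + 2 * K * R) * \<delta>" using J0 by (simp add: t0 algebra_simps)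
  finally have Bd: "integral\<^sup>L N \<phi> \<le> (\<Sum>s<n. \<phi> (z s)) / n + (\<psi> (- R) + 2 * K * R) * \<delta>" by simp
  have "(\<Sum>s<n. \<phi> (z s)) \<le> (\<Sum>s<n. \<psi> (z s) + K * (2 * R / J))"
  proof (rule sum_mono)
    fix s assume "s \<in> {..<n}"
    hence "\<bar>\<phi> (z s) - \<psi> (z s)\<bar> \<le> K * (2 * R / J)" by (intro close z) simp
    thus "\<phi> (z s) \<le> \<psi> (z s) + K * (2 * R / J)" by linarith
  qed
  hence "(\<Sum>s<n. \<phi> (z s)) / n \<le> (\<Sum>s<n. \<psi> (z s) + K * (2 * R / J)) / n"
    using n0 by (intro divide_right_mono) auto
  also have "\<dots> = (\<Sum>s<n. \<psi> (z s)) / n + K * (2 * R / J)"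
    using n0 by (simp add: sum.distrib add_divide_distrib)
  finally show ?thesis using A Bd by simp
qed

section \<open>Training on a typical sample\<close>

text \<open>All sample-dependent input of the training argument, as inequalities with one common
  constant \<open>B\<close>. The number \<open>e\<close> is the target rate, \<open>\<alpha>\<close>
  a bounded vector of output weights that approximates \<open>g\<close> on the grid, and the lower
  bounds on \<open>J\<close> make the grid spacing comparable to the statistical errors 1 / sqrt n
  and 1 / sqrt m1.\<close>

locale typical_sample =
  fixes d n m1 m2 J \<rho> :: nat and B R \<mu> e :: real and g :: "real \<Rightarrow> real" and w :: "nat \<Rightarrow> real"
    and D1 D2 V :: "nat \<Rightarrow> nat \<Rightarrow> real" and a0 b \<alpha> :: "nat \<Rightarrow> real"
  assumes pos: "d \<ge> 1" "n \<ge> 1" "m1 \<ge> 1" "m2 \<ge> 1" "J \<ge> 1"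
    and rho: "\<rho> \<ge> 1" "\<rho> \<le> n" "\<rho> \<le> m1" "\<rho> \<le> m2" "real d ^ 2 \<le> \<rho>"
    and e_def: "e = real d ^ 2 / \<rho> + 1 / sqrt n"
    and BR: "1 \<le> R" "R \<le> B"
    and mu: "\<mu> \<noteq> 0" "\<bar>\<mu>\<bar> \<le> B" "1 / \<bar>\<mu>\<bar> \<le> B"
    and J: "sqrt n \<le> J" "sqrt m1 \<le> J"
    and g_bound: "\<And>x. \<bar>x\<bar> \<le> R \<Longrightarrow> \<bar>g x\<bar> \<le> B"
    and g_lip: "\<And>x y. \<bar>x\<bar> \<le> R \<Longrightarrow> \<bar>y\<bar> \<le> R \<Longrightarrow> \<bar>g x - g y\<bar> \<le> B * \<bar>x - y\<bar>"
    and w: "(\<Sum>k<d. (w k)\<^sup>2) = 1"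
    and a0: "\<And>i. i < m1 \<Longrightarrow> \<bar>a0 i\<bar> = 1"
    and b: "\<And>i. i < m1 \<Longrightarrow> \<bar>b i\<bar> \<le> B"
    and \<alpha>: "\<And>i. i < m1 \<Longrightarrow> \<bar>\<alpha> i\<bar> \<le> B"
    and D1_corr: "\<And>k. k < d \<Longrightarrow> \<bar>(\<Sum>s<n. g (dotp d w (D1 s)) * D1 s k) / real n - \<mu> * w k\<bar> \<le> B / sqrt n"
    and D1_mean: "\<And>k. k < d \<Longrightarrow> \<bar>(\<Sum>s<n. D1 s k) / real n\<bar> \<le> B / sqrt n"
    and D2_cov: "\<And>k l. k < d \<Longrightarrow> l < d \<Longrightarrow>
      \<bar>(\<Sum>s<n. D2 s k * D2 s l) / real n - (if k = l then 1 else 0)\<bar> \<le> B / sqrt n"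
    and D2_bound: "\<And>s k. s < n \<Longrightarrow> k < d \<Longrightarrow> \<bar>D2 s k\<bar> \<le> B"
    and D2_proj: "\<And>s. s < n \<Longrightarrow> \<bar>dotp d w (D2 s)\<bar> \<le> R"
    and D2_cdf: "\<And>j. j \<le> J \<Longrightarrow> \<bar>(\<Sum>s<n. indicator {grid R J j..} (dotp d w (D2 s))) / real n
      - measure std_normal {grid R J j..}\<bar> \<le> B / sqrt n"
    and approx_grid: "\<And>j. j \<le> J \<Longrightarrow> \<bar>ridge_net m1 a0 b \<alpha> (grid R J j / R) - g (grid R J j)\<bar> \<le> B / sqrt m1"
    and V_cov: "\<And>k l. k < d \<Longrightarrow> l < d \<Longrightarrow>
      \<bar>real d / real m2 * (\<Sum>j<m2. V j k * V j l) - (if k = l then 1 else 0)\<bar> \<le> B / sqrt m2"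
begin

text \<open>The division by \<open>R\<close> is the scale left free in the first step size;
  projections of size at most \<open>R\<close> thereby land in [-1, 1].\<close>

abbreviation "F a z \<equiv> ridge_net m1 a0 b a (z / R)"
abbreviation "y x \<equiv> g (dotp d w x)"

definition c0 :: real where "c0 = (1 / real m1) * (\<Sum>i<m1. a0 i * relu (b i))"
definition u :: "nat \<Rightarrow> real" where "u = learned_dir d m2 \<mu> V (corr_vec n y c0 D1)"
definition v :: "nat \<Rightarrow> real" where "v k = u k - w k"
definition risk :: "(nat \<Rightarrow> real) \<Rightarrow> real" where
  "risk a = (1 / real n) * (\<Sum>s<n. (F a (dotp d u (D2 s)) - y (D2 s))\<^sup>2)"

lemma B1: "1 \<le> B" using BR by simp

lemma B_pow: "i \<le> j \<Longrightarrow> B ^ i \<le> B ^ j" by (rule power_increasing[OF _ B1])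

lemma B_pow1: "1 \<le> B ^ i" using B1 by simp

lemma real_pos: "real n > 0" "real m1 > 0" "real m2 > 0" "real d \<ge> 1" "real \<rho> > 0" "real J > 0"
  using pos rho(1) by auto

lemma \<tau>_bounds: "0 \<le> real d ^ 2 / \<rho>" "real d ^ 2 / \<rho> \<le> 1" "1 / \<rho> \<le> real d ^ 2 / \<rho>"
  using rho real_pos by (auto simp: divide_right_mono)

lemma e_bounds: "real d ^ 2 / \<rho> \<le> e" "1 / sqrt n \<le> e" "0 < e" "e \<le> 2"
proof -
  have "1 / sqrt n \<le> 1" "0 < 1 / sqrt n" using real_pos pos by auto
  thus "real d ^ 2 / \<rho> \<le> e" "1 / sqrt n \<le> e" "0 < e" "e \<le> 2"
    using \<tau>_bounds unfolding e_def by linarith+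
qed

lemma c0_bound: "\<bar>c0\<bar> \<le> B"
proof -
  have "\<bar>\<Sum>i<m1. a0 i * relu (b i)\<bar> \<le> (\<Sum>i<m1. B)"
  proof (rule order_trans[OF sum_abs], rule sum_mono)
    fix i assume "i \<in> {..<m1}"
    thus "\<bar>a0 i * relu (b i)\<bar> \<le> B" using a0[of i] b[of i] B1 by (auto simp: abs_mult relu_def max_def)
  qed
  thus ?thesis using real_pos by (simp add: c0_def abs_divide field_simps)
qed

lemma corr_vec_error:
  assumes k: "k < d" shows "\<bar>corr_vec n y c0 D1 k - \<mu> * w k\<bar> \<le> 2 * B\<^sup>2 / sqrt n"
proof -
  have eq: "corr_vec n y c0 D1 k - \<mu> * w k
      = ((\<Sum>s<n. y (D1 s) * D1 s k) / n - \<mu> * w k) - c0 * ((\<Sum>s<n. D1 s k) / n)"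
    by (simp add: corr_vec_def left_diff_distrib sum_subtractf sum_distrib_left diff_divide_distrib)
  have "\<bar>corr_vec n y c0 D1 k - \<mu> * w k\<bar>
      \<le> \<bar>(\<Sum>s<n. y (D1 s) * D1 s k) / n - \<mu> * w k\<bar> + \<bar>c0\<bar> * \<bar>(\<Sum>s<n. D1 s k) / n\<bar>"
    unfolding eq abs_mult[symmetric] by (rule abs_triangle_ineq4)
  also have "\<dots> \<le> B / sqrt n + B * (B / sqrt n)"
    using D1_corr[OF k] D1_mean[OF k] c0_bound B1 by (intro add_mono mult_mono) auto
  also have "\<dots> \<le> B\<^sup>2 / sqrt n + B\<^sup>2 / sqrt n"
    using B_pow[of 1 2] by (intro add_mono divide_right_mono) (auto simp: power2_eq_square)
  finally show ?thesis by simp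
qed

lemma v_bound: "k < d \<Longrightarrow> \<bar>v k\<bar> \<le> 5 * B ^ 4 * (sqrt d / sqrt \<rho>)"
  unfolding v_def u_def
  by (rule learned_dir_error[where n = n]) (use pos rho w B1 mu corr_vec_error V_cov in auto)

text \<open>Source of the term d^2 / rho of the rate: there are \<open>d\<close> coordinates, each
  with squared error of order d / rho.\<close>

lemma v_norm: "(\<Sum>k<d. (v k)\<^sup>2) \<le> 25 * B ^ 8 * e"
proof -
  have "(\<Sum>k<d. (v k)\<^sup>2) \<le> (\<Sum>k<d. (5 * B ^ 4 * (sqrt d / sqrt \<rho>))\<^sup>2)"
  proof (rule sum_mono)
    fix k assume "k \<in> {..<d}"
    thus "(v k)\<^sup>2 \<le> (5 * B ^ 4 * (sqrt d / sqrt \<rho>))\<^sup>2"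
      using power_mono[OF v_bound[of k], of 2] by simp
  qed
  also have "\<dots> = 25 * B ^ 8 * (real d ^ 2 / \<rho>)"
  proof -
    have "(5 * B ^ 4 * (sqrt d / sqrt \<rho>))\<^sup>2 = 25 * B ^ 8 * (real d / \<rho>)"
      using real_pos by (simp add: power_mult_distrib power_divide power_mult[symmetric])
    hence "(\<Sum>k<d. (5 * B ^ 4 * (sqrt d / sqrt \<rho>))\<^sup>2) = d * (25 * B ^ 8 * (real d / \<rho>))" by simp
    thus ?thesis by (simp add: power2_eq_square)
  qed
  also have "\<dots> \<le> 25 * B ^ 8 * e"
    using e_bounds B1 by (intro mult_left_mono) auto
  finally show ?thesis .
qed

lemma w_component: "k < d \<Longrightarrow> \<bar>w k\<bar> \<le> 1"
proof -
  assume "k < d"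
  hence "(w k)\<^sup>2 \<le> (\<Sum>k<d. (w k)\<^sup>2)" by (intro member_le_sum) auto
  thus ?thesis using w by (simp add: abs_square_le_1)
qed

lemma u_component: "k < d \<Longrightarrow> \<bar>u k\<bar> \<le> 6 * B ^ 4"
proof -
  assume k: "k < d"
  have "real d \<le> \<rho>" using rho(5) real_pos self_le_power[of "real d" 2] by simp
  hence "sqrt d / sqrt \<rho> \<le> 1" using real_pos by simp
  hence "5 * B ^ 4 * (sqrt d / sqrt \<rho>) \<le> 5 * B ^ 4 * 1" using B1 by (intro mult_left_mono) auto
  thus ?thesis using v_bound[OF k] w_component[OF k] B_pow1[of 4] by (auto simp: v_def)
qed

lemma dotp_v: "dotp d u x - dotp d w x = dotp d v x"
  by (simp add: dotp_def v_def left_diff_distrib sum_subtractf)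

lemma empirical_v: "(1 / real n) * (\<Sum>s<n. (dotp d v (D2 s))\<^sup>2) \<le> 50 * B ^ 9 * e"
proof -
  have "(1 / real n) * (\<Sum>s<n. (dotp d v (D2 s))\<^sup>2) \<le> 2 * B * (\<Sum>k<d. (v k)\<^sup>2)"
    by (rule empirical_second_moment) (use pos rho B1 D2_cov in auto)
  also have "\<dots> \<le> 2 * B * (25 * B ^ 8 * e)" using v_norm B1 by (intro mult_left_mono) auto
  also have "\<dots> = 50 * B ^ 9 * e" by (simp add: eval_nat_numeral)
  finally show ?thesis .
qed

lemma F_lip:
  assumes A: "(\<Sum>i<m1. \<bar>a i\<bar>) / real m1 \<le> A"
  shows "\<bar>F a x - F a z\<bar> \<le> A * \<bar>x - z\<bar>"
proof -
  have A0: "A \<ge> 0" using A by (rule order_trans[rotated]) (auto intro!: divide_nonneg_nonneg sum_nonneg)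
  have "\<bar>F a x - F a z\<bar> \<le> A * \<bar>x / R - z / R\<bar>"
    by (rule ridge_net_Lipschitz) (use a0 A in auto)
  also have "\<bar>x / R - z / R\<bar> = \<bar>x - z\<bar> / R" using BR by (simp add: diff_divide_distrib[symmetric])
  also have "A * \<dots> \<le> A * (\<bar>x - z\<bar> / 1)" using BR A0 by (intro mult_left_mono divide_left_mono) auto
  finally show ?thesis by simp
qed

lemma F_bound:
  assumes A: "(\<Sum>i<m1. \<bar>a i\<bar>) / real m1 \<le> A"
  shows "\<bar>F a z\<bar> \<le> A * (\<bar>z\<bar> + B)"
proof -
  have A0: "A \<ge> 0" using A by (rule order_trans[rotated]) (auto intro!: divide_nonneg_nonneg sum_nonneg)
  have "\<bar>F a z\<bar> \<le> A * (\<bar>z / R\<bar> + B)" by (rule ridge_net_bound) (use a0 b B1 A in auto)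
  also have "\<bar>z / R\<bar> \<le> \<bar>z\<bar> / 1" unfolding abs_divide using BR by (intro divide_left_mono) auto
  finally show ?thesis using A0 by (simp add: mult_left_mono)
qed

lemma \<alpha>_mean: "(\<Sum>i<m1. \<bar>\<alpha> i\<bar>) / real m1 \<le> B"
proof -
  have "(\<Sum>i<m1. \<bar>\<alpha> i\<bar>) \<le> (\<Sum>i<m1. B)" by (rule sum_mono) (use \<alpha> in auto)
  thus ?thesis using real_pos by (simp add: field_simps)
qed

text \<open>The approximation is assumed on the grid only, which keeps the number of random events
  finite. Both sides are \<open>B\<close>-Lipschitz on [-R, R], and \<open>sqrt m1 \<le> J\<close>
  keeps the discretization error of order 1 / sqrt m1.\<close>

lemma approx:
  assumes z: "\<bar>z\<bar> \<le> R" shows "\<bar>F \<alpha> z - g z\<bar> \<le> 5 * B\<^sup>2 / sqrt m1"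
proof -
  have R0: "R > 0" and zz: "- R \<le> z" "z \<le> R" using BR z by auto
  obtain k where k0: "k \<le> J" "\<And>j. j \<le> J \<Longrightarrow> grid R J j \<le> z \<longleftrightarrow> j \<le> k"
      "grid R J k \<le> z" "z \<le> R \<Longrightarrow> z - grid R J k \<le> 2 * R / J"
    using grid_cell[OF R0 pos(5) zz(1)] by blast
  note k = k0(1,3) k0(4)[OF zz(2)]
  let ?t = "grid R J k"
  have t: "\<bar>?t\<bar> \<le> R" by (rule grid_bounds[OF R0 k(1) pos(5)])
  have "\<bar>F \<alpha> z - F \<alpha> ?t\<bar> \<le> B * \<bar>z - ?t\<bar>" by (rule F_lip[OF \<alpha>_mean])
  moreover have "\<bar>g z - g ?t\<bar> \<le> B * \<bar>z - ?t\<bar>" by (rule g_lip[OF z t])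
  moreover have "B * \<bar>z - ?t\<bar> \<le> 2 * B\<^sup>2 / sqrt m1"
  proof -
    have "\<bar>z - ?t\<bar> \<le> 2 * R / J" using k by auto
    also have "\<dots> \<le> 2 * B / sqrt m1" using BR J real_pos by (intro frac_le) auto
    finally have "B * \<bar>z - ?t\<bar> \<le> B * (2 * B / sqrt m1)" using B1 by (intro mult_left_mono) auto
    thus ?thesis by (simp add: power2_eq_square mult_ac)
  qed
  moreover have "\<bar>F \<alpha> ?t - g ?t\<bar> \<le> B\<^sup>2 / sqrt m1"
    using approx_grid[OF k(1)] by (rule order_trans) (use B_pow[of 1 2] in \<open>auto intro: divide_right_mono\<close>)
  ultimately show ?thesis by (simp add: add_divide_distrib)
qed

lemma sq_sum_le: "(x + z)\<^sup>2 \<le> 2 * x\<^sup>2 + 2 * (z::real)\<^sup>2"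
  using sum_squares_bound[of x z] by (simp add: power2_sum)

text \<open>The competitor pays its squared approximation error along \<open>w\<close>, of order 1 /
  m1 and hence at most of order 1 / rho, and the squared Lipschitz cost of being evaluated along
  \<open>u\<close>, averaged by \<open>empirical_v\<close>.\<close>

lemma risk_\<alpha>: "risk \<alpha> \<le> 150 * B ^ 11 * e"
proof -
  have one: "(F \<alpha> (dotp d u (D2 s)) - y (D2 s))\<^sup>2 \<le> 50 * B ^ 4 * e + 2 * B\<^sup>2 * (dotp d v (D2 s))\<^sup>2" if s: "s < n" for s
  proof -
    let ?x = "D2 s"
    have "(F \<alpha> (dotp d u ?x) - y ?x)\<^sup>2 = ((F \<alpha> (dotp d w ?x) - y ?x) + (F \<alpha> (dotp d u ?x) - F \<alpha> (dotp d w ?x)))\<^sup>2" by simp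
    also have "\<dots> \<le> 2 * (F \<alpha> (dotp d w ?x) - y ?x)\<^sup>2 + 2 * (F \<alpha> (dotp d u ?x) - F \<alpha> (dotp d w ?x))\<^sup>2"
      by (rule sq_sum_le)
    also have "(F \<alpha> (dotp d w ?x) - y ?x)\<^sup>2 \<le> (5 * B\<^sup>2 / sqrt m1)\<^sup>2"
      using power_mono[OF approx[OF D2_proj[OF s]], of 2] by simp
    also have "\<dots> = 25 * B ^ 4 * (1 / m1)" using real_pos by (simp add: power_divide power_mult_distrib power_mult[symmetric])
    also have "\<dots> \<le> 25 * B ^ 4 * e"
    proof -
      have "1 / real m1 \<le> 1 / \<rho>" using rho real_pos by (intro divide_left_mono) auto
      also have "\<dots> \<le> e" using \<tau>_bounds e_bounds by linarith
      finally show ?thesis using B1 by (intro mult_left_mono) auto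
    qed
    also have "(F \<alpha> (dotp d u ?x) - F \<alpha> (dotp d w ?x))\<^sup>2 \<le> (B * \<bar>dotp d v ?x\<bar>)\<^sup>2"
      using power_mono[OF F_lip[OF \<alpha>_mean, of "dotp d u ?x" "dotp d w ?x"], of 2] by (simp add: dotp_v)
    finally show ?thesis by (simp add: power_mult_distrib)
  qed
  have "risk \<alpha> \<le> (1 / real n) * (\<Sum>s<n. 50 * B ^ 4 * e + 2 * B\<^sup>2 * (dotp d v (D2 s))\<^sup>2)"
    unfolding risk_def by (intro mult_left_mono sum_mono) (use one in auto)
  also have "\<dots> = 50 * B ^ 4 * e + 2 * B\<^sup>2 * ((1 / real n) * (\<Sum>s<n. (dotp d v (D2 s))\<^sup>2))"
    using real_pos by (simp add: sum.distrib sum_distrib_left[symmetric] field_simps)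
  also have "\<dots> \<le> 50 * B ^ 4 * e + 2 * B\<^sup>2 * (50 * B ^ 9 * e)"
    using empirical_v B1 by (intro add_mono mult_left_mono) auto
  also have "\<dots> = (50 * B ^ 4 + 100 * B ^ 11) * e"
    by (simp add: algebra_simps power_add[symmetric])
  also have "\<dots> \<le> (150 * B ^ 11) * e"
    using B_pow[of 4 11] e_bounds by (intro mult_right_mono) auto
  finally show ?thesis .
qed

abbreviation "\<psi> a z \<equiv> (F a z - g z)\<^sup>2"

text \<open>Exchanging \<open>u\<close> for \<open>w\<close> inside the empirical loss leaves a
  function of a projection fixed in advance, which is the form that
  \<open>uniform_Lipschitz_deviation\<close> accepts.\<close>

lemma empirical_\<psi>:
  assumes A: "(\<Sum>i<m1. \<bar>a i\<bar>) / real m1 \<le> A"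
  shows "(\<Sum>s<n. \<psi> a (dotp d w (D2 s))) / n \<le> 2 * risk a + 100 * A\<^sup>2 * B ^ 9 * e"
proof -
  have one: "\<psi> a (dotp d w x) \<le> 2 * (F a (dotp d u x) - y x)\<^sup>2 + 2 * A\<^sup>2 * (dotp d v x)\<^sup>2" for x
  proof -
    have "\<psi> a (dotp d w x) = ((F a (dotp d u x) - y x) + (F a (dotp d w x) - F a (dotp d u x)))\<^sup>2" by simp
    also have "\<dots> \<le> 2 * (F a (dotp d u x) - y x)\<^sup>2 + 2 * (F a (dotp d w x) - F a (dotp d u x))\<^sup>2"
      by (rule sq_sum_le)
    also have "(F a (dotp d w x) - F a (dotp d u x))\<^sup>2 \<le> (A * \<bar>dotp d v x\<bar>)\<^sup>2"
      using power_mono[OF F_lip[OF A, of "dotp d w x" "dotp d u x"], of 2]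
      by (simp add: dotp_v[symmetric] abs_minus_commute)
    finally show ?thesis by (simp add: power_mult_distrib)
  qed
  have "(\<Sum>s<n. \<psi> a (dotp d w (D2 s))) / n
      \<le> (\<Sum>s<n. 2 * (F a (dotp d u (D2 s)) - y (D2 s))\<^sup>2 + 2 * A\<^sup>2 * (dotp d v (D2 s))\<^sup>2) / n"
    by (intro divide_right_mono sum_mono one) simp
  also have "\<dots> = 2 * risk a + 2 * A\<^sup>2 * ((1 / real n) * (\<Sum>s<n. (dotp d v (D2 s))\<^sup>2))"
    unfolding risk_def by (simp add: sum.distrib sum_distrib_left[symmetric] add_divide_distrib)
  also have "\<dots> \<le> 2 * risk a + 2 * A\<^sup>2 * (50 * B ^ 9 * e)"
    using empirical_v by (intro add_mono mult_left_mono) auto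
  finally show ?thesis by simp
qed

lemma pointwise_error:
  assumes A: "(\<Sum>i<m1. \<bar>a i\<bar>) / real m1 \<le> A"
  shows "(F a (dotp d u x) - y x)\<^sup>2 \<le> 2 * A\<^sup>2 * (dotp d v x)\<^sup>2 + 2 * \<psi> a (dotp d w x)"
proof -
  have "(F a (dotp d u x) - y x)\<^sup>2 = ((F a (dotp d u x) - F a (dotp d w x)) + (F a (dotp d w x) - y x))\<^sup>2" by simp
  also have "\<dots> \<le> 2 * (F a (dotp d u x) - F a (dotp d w x))\<^sup>2 + 2 * \<psi> a (dotp d w x)"
    by (rule sq_sum_le)
  also have "(F a (dotp d u x) - F a (dotp d w x))\<^sup>2 \<le> (A * \<bar>dotp d v x\<bar>)\<^sup>2"
    using power_mono[OF F_lip[OF A, of "dotp d u x" "dotp d w x"], of 2] by (simp add: dotp_v)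
  finally show ?thesis by (simp add: power_mult_distrib)
qed

text \<open>The trained weights depend on the sample, so the estimate has to hold for all
  \<open>a\<close> with mean absolute weight at most \<open>A\<close>. On [-R, R] the function
  \<open>\<psi> a\<close> has a Lipschitz constant in terms of \<open>A\<close> and \<open>B\<close>
  only; beyond \<open>R\<close> it is dominated by a multiple of
  \<open>1 + z\<^sup>2 + (g z)\<^sup>2\<close>, whose tail is at most 1 / n by assumption.\<close>

lemma population_\<psi>:
  assumes A: "(\<Sum>i<m1. \<bar>a i\<bar>) / real m1 \<le> A" "1 \<le> A"
    and g[measurable]: "g \<in> borel_measurable borel" and g2: "integrable std_normal (\<lambda>z. (g z)\<^sup>2)"
    and z2: "integrable std_normal (\<lambda>z. z\<^sup>2)" and N: "prob_space std_normal"
    and tail: "(\<integral>z. (1 + z\<^sup>2 + (g z)\<^sup>2) * indicator {z. R < \<bar>z\<bar>} z \<partial>std_normal) \<le> 1 / n"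
  shows "integrable std_normal (\<psi> a)"
    and "integral\<^sup>L std_normal (\<psi> a) \<le> 2 * risk a + 185 * A\<^sup>2 * B ^ 9 * e"
proof -
  interpret N: prob_space std_normal by fact
  have sN[measurable_cong]: "sets std_normal = sets borel" by (simp add: std_normal_def)
  have AB: "1 \<le> A * B" using A(2) B1 by (metis mult_mono' mult_1 zero_le_one)
  have cell[measurable]: "cell a0 b i \<in> borel_measurable borel" for i
    unfolding cell_def relu_def by measurable
  have F[measurable]: "(\<lambda>z. F a z) \<in> borel_measurable borel"
    unfolding ridge_net_def by measurable
  have dom: "\<psi> a z \<le> 4 * A\<^sup>2 * B\<^sup>2 * (1 + z\<^sup>2 + (g z)\<^sup>2)" for z
  proof -
    have "\<psi> a z \<le> 2 * (F a z)\<^sup>2 + 2 * (- g z)\<^sup>2" using sq_sum_le[of "F a z" "- g z"] by simp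
    also have "(F a z)\<^sup>2 \<le> (A * (\<bar>z\<bar> + B))\<^sup>2" using power_mono[OF F_bound[OF A(1), of z], of 2] by simp
    also have "\<dots> \<le> A\<^sup>2 * (2 * z\<^sup>2 + 2 * B\<^sup>2)"
      unfolding power_mult_distrib using sq_sum_le[of "\<bar>z\<bar>" B] by (intro mult_left_mono) auto
    also have "\<dots> \<le> A\<^sup>2 * (2 * (B\<^sup>2 * z\<^sup>2) + 2 * B\<^sup>2)"
      using B_pow1[of 2] mult_right_mono[of 1 "B\<^sup>2" "z\<^sup>2"] by (intro mult_left_mono add_mono) auto
    also have "(- g z)\<^sup>2 \<le> (2 * A\<^sup>2 * B\<^sup>2) * (g z)\<^sup>2"
    proof -
      have "1 \<le> (A * B)\<^sup>2" using AB by simp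
      hence "1 \<le> 2 * A\<^sup>2 * B\<^sup>2" by (simp add: power_mult_distrib)
      thus ?thesis using mult_right_mono[of 1 "2 * A\<^sup>2 * B\<^sup>2" "(g z)\<^sup>2"] by simp
    qed
    finally show ?thesis by (simp add: algebra_simps)
  qed
  have domi: "integrable std_normal (\<lambda>z. 4 * A\<^sup>2 * B\<^sup>2 * (1 + z\<^sup>2 + (g z)\<^sup>2))"
    using g2 z2 by (intro integrable_mult_right Bochner_Integration.integrable_add) auto
  show int: "integrable std_normal (\<psi> a)"
    by (rule Bochner_Integration.integrable_bound[OF domi]) (use dom in \<open>auto intro!: AE_I2 intro: order_trans[OF _ abs_ge_self]\<close>)
  have diff_bd: "\<bar>F a z - g z\<bar> \<le> 3 * (A * B)" if "\<bar>z\<bar> \<le> R" for z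
  proof -
    have "\<bar>F a z\<bar> \<le> A * (\<bar>z\<bar> + B)" by (rule F_bound[OF A(1)])
    also have "\<dots> \<le> A * (B + B)" using that BR A by (intro mult_left_mono) auto
    finally have "\<bar>F a z\<bar> \<le> 2 * (A * B)" by simp
    moreover have "\<bar>g z\<bar> \<le> A * B" using g_bound[OF that] B1 mult_right_mono[OF A(2), of B] by linarith
    ultimately show ?thesis by linarith
  qed
  have sqrt1: "sqrt n \<le> n" using pos by (intro real_le_lsqrt) (auto simp: power2_eq_square)
  have sqrt0: "sqrt n > 0" using real_pos by simp
  have "integral\<^sup>L std_normal (\<psi> a) \<le> (\<Sum>s<n. \<psi> a (dotp d w (D2 s))) / real n
      + 4 * (12 * (A * B)\<^sup>2) * R / J + (\<psi> a (- R) + 2 * (12 * (A * B)\<^sup>2) * R) * (B / sqrt n)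
      + 4 * (A * B)\<^sup>2 * (1 / n)"
  proof (rule uniform_Lipschitz_deviation[OF N sN])
    show "0 < R" using BR by simp
    show "1 \<le> J" "1 \<le> n" using pos by auto
    \<comment> \<open>A difference of squares: \<open>F a - g\<close> changes by at most
      \<open>2 * (A * B) * \<bar>x - z\<bar>\<close>, and the sum of its two values is at most
      \<open>6 * (A * B)\<close>.\<close>
    show "\<bar>\<psi> a x - \<psi> a z\<bar> \<le> 12 * (A * B)\<^sup>2 * \<bar>x - z\<bar>" if x: "\<bar>x\<bar> \<le> R" and z: "\<bar>z\<bar> \<le> R" for x z
    proof -
      let ?p = "F a x - g x" and ?q = "F a z - g z"
      have "\<bar>?p - ?q\<bar> \<le> \<bar>F a x - F a z\<bar> + \<bar>g x - g z\<bar>" by linarith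
      also have "\<dots> \<le> A * \<bar>x - z\<bar> + B * \<bar>x - z\<bar>" by (intro add_mono F_lip[OF A(1)] g_lip[OF x z])
      also have "\<dots> \<le> (A * B) * \<bar>x - z\<bar> + (A * B) * \<bar>x - z\<bar>"
        using A(2) B1 mult_left_mono[of 1 B A] mult_right_mono[of 1 A B] by (intro add_mono mult_right_mono) auto
      finally have 1: "\<bar>?p - ?q\<bar> \<le> 2 * (A * B) * \<bar>x - z\<bar>" by simp
      have 2: "\<bar>?p + ?q\<bar> \<le> 6 * (A * B)" using diff_bd[OF x] diff_bd[OF z] by linarith
      have "\<psi> a x - \<psi> a z = (?p - ?q) * (?p + ?q)" by (simp add: power2_eq_square algebra_simps)
      hence "\<bar>\<psi> a x - \<psi> a z\<bar> = \<bar>?p - ?q\<bar> * \<bar>?p + ?q\<bar>" by (simp only: abs_mult)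
      also have "\<dots> \<le> (2 * (A * B) * \<bar>x - z\<bar>) * (6 * (A * B))"
        using 1 2 AB by (intro mult_mono) auto
      finally show ?thesis by (simp add: power2_eq_square mult_ac)
    qed
    show "0 \<le> \<psi> a x" for x by simp
    show "\<bar>dotp d w (D2 s)\<bar> \<le> R" if "s < n" for s by (rule D2_proj[OF that])
    show "\<bar>(\<Sum>s<n. indicator {grid R J j..} (dotp d w (D2 s))) / real n - measure std_normal {grid R J j..}\<bar>
        \<le> B / sqrt n" if "j \<le> J" for j by (rule D2_cdf[OF that])
    show "integrable std_normal (\<psi> a)" by (rule int)
    have "(\<integral>x. \<psi> a x * indicator {x. R < \<bar>x\<bar>} x \<partial>std_normal)
        \<le> (\<integral>x. 4 * A\<^sup>2 * B\<^sup>2 * ((1 + x\<^sup>2 + (g x)\<^sup>2) * indicator {x. R < \<bar>x\<bar>} x) \<partial>std_normal)"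
    proof (rule integral_mono)
      show "integrable std_normal (\<lambda>x. \<psi> a x * indicator {x. R < \<bar>x\<bar>} x)"
        by (rule integrable_real_mult_indicator[OF _ int]) measurable
      have "integrable std_normal (\<lambda>x. (4 * A\<^sup>2 * B\<^sup>2 * (1 + x\<^sup>2 + (g x)\<^sup>2)) * indicator {x. R < \<bar>x\<bar>} x)"
        by (rule integrable_real_mult_indicator[OF _ domi]) measurable
      thus "integrable std_normal (\<lambda>x. 4 * A\<^sup>2 * B\<^sup>2 * ((1 + x\<^sup>2 + (g x)\<^sup>2) * indicator {x. R < \<bar>x\<bar>} x))"
        by (simp add: mult.assoc)
      fix x show "\<psi> a x * indicator {x. R < \<bar>x\<bar>} x \<le> 4 * A\<^sup>2 * B\<^sup>2 * ((1 + x\<^sup>2 + (g x)\<^sup>2) * indicator {x. R < \<bar>x\<bar>} x)"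
        using dom[of x] by (simp add: indicator_def)
    qed
    also have "\<dots> = 4 * A\<^sup>2 * B\<^sup>2 * (\<integral>x. (1 + x\<^sup>2 + (g x)\<^sup>2) * indicator {x. R < \<bar>x\<bar>} x \<partial>std_normal)"
      by simp
    also have "\<dots> \<le> 4 * A\<^sup>2 * B\<^sup>2 * (1 / n)" using tail by (intro mult_left_mono) auto
    finally show "(\<integral>x. \<psi> a x * indicator {x. R < \<bar>x\<bar>} x \<partial>std_normal) \<le> 4 * (A * B)\<^sup>2 * (1 / n)"
      by (simp add: power_mult_distrib)
  qed
  \<comment> \<open>The summands add up to 185: 100 from exchanging \<open>u\<close> for
    \<open>w\<close>, 48 = 4 * 12 from the grid spacing, 33 = 9 + 24 from the value at -R and the
    total variation, and 4 from the tail.\<close>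
  also have "\<dots> \<le> (2 * risk a + 100 * A\<^sup>2 * B ^ 9 * e) + 48 * A\<^sup>2 * B ^ 9 * e + 33 * A\<^sup>2 * B ^ 9 * e + 4 * A\<^sup>2 * B ^ 9 * e"
  proof (intro add_mono)
    show "(\<Sum>s<n. \<psi> a (dotp d w (D2 s))) / real n \<le> 2 * risk a + 100 * A\<^sup>2 * B ^ 9 * e"
      by (rule empirical_\<psi>[OF A(1)])
    have e0: "1 / sqrt n \<le> e" "0 \<le> 1 / sqrt n" using e_bounds by auto
    have Bp: "B\<^sup>2 * B \<le> B ^ 9" "B\<^sup>2 \<le> B ^ 9" "B\<^sup>2 * B\<^sup>2 \<le> B ^ 9"
      using B_pow[of 3 9] B_pow[of 2 9] B_pow[of 4 9] by (simp_all add: eval_nat_numeral)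
    have "R / J \<le> B * (1 / sqrt n)" using BR J sqrt0 real_pos by (simp add: frac_le)
    hence "48 * (A * B)\<^sup>2 * (R / J) \<le> 48 * (A * B)\<^sup>2 * (B * (1 / sqrt n))" by (intro mult_left_mono) auto
    also have "\<dots> = 48 * A\<^sup>2 * (B\<^sup>2 * B) * (1 / sqrt n)" by (simp add: power_mult_distrib)
    also have "\<dots> \<le> 48 * A\<^sup>2 * B ^ 9 * e"
      using Bp e0 B1 by (intro mult_mono) auto
    finally show "4 * (12 * (A * B)\<^sup>2) * R / J \<le> 48 * A\<^sup>2 * B ^ 9 * e" by simp
    have "\<bar>- R\<bar> \<le> R" using BR by simp
    hence "\<psi> a (- R) \<le> (3 * (A * B))\<^sup>2"
      using power_mono[OF diff_bd[of "- R"], of 2] by simp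
    moreover have "(A * B)\<^sup>2 * R \<le> (A * B)\<^sup>2 * B" using BR by (intro mult_left_mono) auto
    moreover have "(A * B)\<^sup>2 * 1 \<le> (A * B)\<^sup>2 * B" using B1 by (intro mult_left_mono) auto
    ultimately have "\<psi> a (- R) + 2 * (12 * (A * B)\<^sup>2) * R \<le> 33 * ((A * B)\<^sup>2 * B)"
      by (simp add: power_mult_distrib)
    hence "(\<psi> a (- R) + 2 * (12 * (A * B)\<^sup>2) * R) * (B / sqrt n) \<le> 33 * ((A * B)\<^sup>2 * B) * (B / sqrt n)"
      using B1 by (intro mult_right_mono) auto
    also have "\<dots> = 33 * A\<^sup>2 * (B\<^sup>2 * B\<^sup>2) * (1 / sqrt n)" by (simp add: power_mult_distrib power2_eq_square)
    also have "\<dots> \<le> 33 * A\<^sup>2 * B ^ 9 * e"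
      using Bp e0 B1 by (intro mult_mono) auto
    finally show "(\<psi> a (- R) + 2 * (12 * (A * B)\<^sup>2) * R) * (B / sqrt n) \<le> 33 * A\<^sup>2 * B ^ 9 * e" .
    have "1 / real n \<le> 1 / sqrt n" using sqrt0 sqrt1 by (intro divide_left_mono) auto
    hence "1 / real n \<le> e" using e0 by linarith
    hence "4 * A\<^sup>2 * B\<^sup>2 * (1 / n) \<le> 4 * A\<^sup>2 * B ^ 9 * e"
      using Bp B1 by (intro mult_mono) auto
    thus "4 * (A * B)\<^sup>2 * (1 / n) \<le> 4 * A\<^sup>2 * B ^ 9 * e" by (simp add: power_mult_distrib)
  qed
  finally show "integral\<^sup>L std_normal (\<psi> a) \<le> 2 * risk a + 185 * A\<^sup>2 * B ^ 9 * e" by (simp add: mult_ac)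
qed

text \<open>\<open>\<eta>2\<close> is the inverse of a bound for the smoothness constant, and
  \<open>T\<close> pushes the optimization error below \<open>B\<^sup>2 / n\<close>. With
  \<open>lam = e / m1\<close> the penalty of the competitor is at most of order
  \<open>B\<^sup>2 * e\<close>, while a final objective of order \<open>e\<close> bounds the mean
  square of the trained weights independently of \<open>e\<close>.\<close>

lemma training:
  assumes eta1: "\<eta>1 = real m1 * real d * (1 / R) / (2 * real m2 * \<mu>)"
    and eta2: "\<eta>2 = 1 / (100 * B ^ 10 * real d ^ 2)" and lam: "lam = e / m1"
    and T: "real (T - 1) \<ge> 2 * real m1 * real n / \<eta>2"
  obtains a W where "layerwise_train d n m1 m2 \<eta>1 \<eta>2 lam T y (D1, D2, a0, b, V) = (a, W, b, V)"
    "\<And>x. net d m1 m2 a W b V x = F a (dotp d u x)"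
    "risk a \<le> 152 * B ^ 11 * e" "(\<Sum>i<m1. \<bar>a i\<bar>) / real m1 \<le> 18 * B ^ 6"
proof -
  define W where "W i j = - \<eta>1 * grad_W d n m1 m2 y D1 a0 (\<lambda>_ _. 0) b V i j" for i j
  define p where "p s i = cell a0 b i (dotp d u (D2 s) / R)" for s i
  define G where "G a i = (2 / real n) * (\<Sum>s<n. ((1 / real m1) * (\<Sum>i<m1. a i * p s i) - y (D2 s))
      * (1 / real m1) * p s i) + lam * a i" for a i
  define step where "step a i = a i - \<eta>2 * G a i" for a i
  define aT where "aT = (step ^^ (T - 1)) a0"
  have W_eq: "W = (\<lambda>i j. - (real m1 * real d * (1 / R) / (2 * real m2 * \<mu>)) * grad_W d n m1 m2 y D1 a0 (\<lambda>_ _. 0) b V i j)"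
    by (simp add: W_def eta1 fun_eq_iff)
  have net: "net d m1 m2 a W b V x = F a (dotp d u x)" for a x
    unfolding W_eq using first_step_net[OF pos(2,1,3,4) mu(1), where \<eta> = "1 / R" and y = y and D = D1 and V = V and ?a0.0 = a0 and b = b and a = a and x = x]
    by (simp add: u_def c0_def)
  have relu: "relu (preact d m2 W b V x i) = cell a0 b i (dotp d u x / R)" for x i
    unfolding W_eq using first_step_relu[OF pos(2,1,3,4) mu(1), where \<eta> = "1 / R" and y = y and D = D1 and V = V and e = a0 and b = b and x = x and i = i]
    by (simp add: u_def c0_def)
  have G: "grad_a d n m1 m2 y D2 a W b V i + lam * a i = G a i" for a i
    unfolding grad_a_def net relu G_def p_def ridge_net_def by simp
  have lw: "layerwise_train d n m1 m2 \<eta>1 \<eta>2 lam T y (D1, D2, a0, b, V) = (aT, W, b, V)"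
    unfolding layerwise_train_def Let_def prod.case W_def[symmetric] G
    by (simp add: aT_def step_def[abs_def] W_def[abs_def])
  have T1: "T - 1 \<ge> 1" and eta_pos: "\<eta>2 > 0"
  proof -
    show e0: "\<eta>2 > 0" using B1 real_pos by (simp add: eta2)
    have "0 < 2 * real m1 * real n / \<eta>2" using e0 real_pos by simp
    hence "0 < real (T - 1)" using T by linarith
    thus "T - 1 \<ge> 1" by simp
  qed
  have lam0: "0 \<le> lam" "lam \<le> 2" using e_bounds real_pos pos unfolding lam
    by (auto simp: divide_le_eq)
  \<comment> \<open>A feature is at most \<open>6 * B ^ 5 * d\<close> from the \<open>d\<close>
    coordinates of \<open>u\<close>, plus a bias of at most \<open>B\<close>. The 100 in
    \<open>\<eta>2\<close> is 2 * 49 from \<open>2 * P\<^sup>2\<close>, plus 2 for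
    \<open>lam\<close>.\<close>
  define P where "P = 7 * B ^ 5 * real d"
  have P: "\<bar>p s i\<bar> \<le> P" if s: "s < n" and i: "i < m1" for s i
  proof -
    have "\<bar>dotp d u (D2 s)\<bar> \<le> (\<Sum>k<d. 6 * B ^ 4 * B)"
      unfolding dotp_def
    proof (rule order_trans[OF sum_abs], rule sum_mono)
      fix k assume "k \<in> {..<d}"
      thus "\<bar>u k * D2 s k\<bar> \<le> 6 * B ^ 4 * B"
        unfolding abs_mult using u_component[of k] D2_bound[OF s, of k] B1 by (intro mult_mono) auto
    qed
    also have "\<dots> = 6 * B ^ 5 * d" by (simp add: eval_nat_numeral)
    finally have 1: "\<bar>dotp d u (D2 s)\<bar> \<le> 6 * B ^ 5 * d" .
    have "\<bar>dotp d u (D2 s) / R\<bar> \<le> \<bar>dotp d u (D2 s)\<bar> / 1"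
      unfolding abs_divide using BR by (intro divide_left_mono) auto
    moreover have "\<bar>p s i\<bar> \<le> \<bar>dotp d u (D2 s) / R\<bar> + B"
      unfolding p_def by (rule cell_bound) (use a0 b i in auto)
    moreover have "B \<le> B ^ 5 * d" using B_pow[of 1 5] real_pos B1 mult_mono[of B "B ^ 5" 1 "real d"] by simp
    ultimately show ?thesis using 1 unfolding P_def by linarith
  qed
  have smooth: "\<eta>2 * (2 * P\<^sup>2 + lam) \<le> 1"
  proof -
    have "1 \<le> B ^ 10 * real d ^ 2" using mult_mono[of 1 "B ^ 10" 1 "real d ^ 2"] B_pow1[of 10] real_pos by simp
    hence "2 * P\<^sup>2 + lam \<le> 100 * B ^ 10 * real d ^ 2"
      using lam0 by (simp add: P_def power_mult_distrib power_mult[symmetric] mult_ac)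
    thus ?thesis using B1 real_pos by (simp add: eta2 divide_le_eq_1)
  qed
  have risk: "risk a = (1 / real n) * (\<Sum>s<n. ((1 / real m1) * (\<Sum>i<m1. a i * p s i) - y (D2 s))\<^sup>2)" for a
    unfolding risk_def p_def ridge_net_def ..
  have gd: "risk aT + lam / 2 * (\<Sum>i<m1. (aT i)\<^sup>2)
      \<le> risk \<alpha> + lam / 2 * (\<Sum>i<m1. (\<alpha> i)\<^sup>2) + (\<Sum>i<m1. (a0 i - \<alpha> i)\<^sup>2) / (2 * \<eta>2 * real (T - 1))"
    unfolding risk aT_def step_def[abs_def] G_def
    by (rule gradient_descent_ridge) (use pos lam0 P eta_pos smooth T1 in auto)
  have t1: "lam / 2 * (\<Sum>i<m1. (\<alpha> i)\<^sup>2) \<le> B\<^sup>2 * e"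
  proof -
    have "(\<Sum>i<m1. (\<alpha> i)\<^sup>2) \<le> (\<Sum>i<m1. B\<^sup>2)"
    proof (rule sum_mono)
      fix i assume "i \<in> {..<m1}"
      thus "(\<alpha> i)\<^sup>2 \<le> B\<^sup>2" using power_mono[OF \<alpha>[of i], of 2] by simp
    qed
    hence "lam / 2 * (\<Sum>i<m1. (\<alpha> i)\<^sup>2) \<le> lam / 2 * (m1 * B\<^sup>2)" using lam0 by (intro mult_left_mono) auto
    also have "\<dots> = B\<^sup>2 * e / 2" using real_pos by (simp add: lam)
    also have "\<dots> \<le> B\<^sup>2 * e" using e_bounds by simp
    finally show ?thesis .
  qed
  have t2: "(\<Sum>i<m1. (a0 i - \<alpha> i)\<^sup>2) / (2 * \<eta>2 * real (T - 1)) \<le> B\<^sup>2 * e"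
  proof -
    have "(\<Sum>i<m1. (a0 i - \<alpha> i)\<^sup>2) \<le> (\<Sum>i<m1. 4 * B\<^sup>2)"
    proof (rule sum_mono)
      fix i assume "i \<in> {..<m1}"
      hence "\<bar>a0 i - \<alpha> i\<bar> \<le> 2 * B" using a0[of i] \<alpha>[of i] B1 by auto
      thus "(a0 i - \<alpha> i)\<^sup>2 \<le> 4 * B\<^sup>2" using power_mono[of "\<bar>a0 i - \<alpha> i\<bar>" "2 * B" 2] by (simp add: power_mult_distrib)
    qed
    moreover have "4 * real m1 * real n \<le> 2 * \<eta>2 * real (T - 1)"
      using T eta_pos by (simp add: pos_divide_le_eq mult_ac)
    ultimately have "(\<Sum>i<m1. (a0 i - \<alpha> i)\<^sup>2) / (2 * \<eta>2 * real (T - 1)) \<le> (m1 * (4 * B\<^sup>2)) / (4 * real m1 * real n)"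
      using real_pos B1 by (intro frac_le) auto
    also have "\<dots> = B\<^sup>2 * (1 / n)" using real_pos by simp
    also have "\<dots> \<le> B\<^sup>2 * (1 / sqrt n)"
      using real_pos pos by (intro mult_left_mono divide_left_mono real_le_lsqrt) (auto simp: power2_eq_square)
    also have "\<dots> \<le> B\<^sup>2 * e" using e_bounds by (intro mult_left_mono) auto
    finally show ?thesis .
  qed
  have "B\<^sup>2 * e \<le> B ^ 11 * e" using B_pow[of 2 11] e_bounds by (intro mult_right_mono) auto
  moreover have "X \<le> r + p + q \<Longrightarrow> p \<le> s \<Longrightarrow> q \<le> s \<Longrightarrow> r \<le> 150 * t * e \<Longrightarrow> s \<le> t * e \<Longrightarrow> X \<le> 152 * t * e"
    for X r p q s t :: real by simp
  ultimately have J: "risk aT + lam / 2 * (\<Sum>i<m1. (aT i)\<^sup>2) \<le> 152 * B ^ 11 * e"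
    using gd t1 t2 risk_\<alpha> by blast
  have r0: "0 \<le> risk aT" unfolding risk_def by (intro mult_nonneg_nonneg sum_nonneg) auto
  have l0: "0 \<le> lam / 2 * (\<Sum>i<m1. (aT i)\<^sup>2)" using lam0 by (intro mult_nonneg_nonneg sum_nonneg) auto
  \<comment> \<open>The nonnegative empirical risk is dropped from the objective, and the common
    factor \<open>e > 0\<close> cancels. The mean square is then at most
    \<open>304 * B ^ 11\<close>, and 304 is below 18 squared.\<close>
  have mean: "(\<Sum>i<m1. \<bar>aT i\<bar>) / m1 \<le> 18 * B ^ 6"
  proof (rule power2_le_imp_le)
    have "lam / 2 * (\<Sum>i<m1. (aT i)\<^sup>2) \<le> 152 * B ^ 11 * e" using J r0 by linarith
    hence "2 * (lam / 2 * (\<Sum>i<m1. (aT i)\<^sup>2)) \<le> 2 * (152 * B ^ 11 * e)" by (intro mult_left_mono) auto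
    also have "2 * (lam / 2 * (\<Sum>i<m1. (aT i)\<^sup>2)) = e * ((\<Sum>i<m1. (aT i)\<^sup>2) / m1)" by (simp add: lam)
    also have "2 * (152 * B ^ 11 * e) = e * (304 * B ^ 11)" by simp
    finally have "e * ((\<Sum>i<m1. (aT i)\<^sup>2) / m1) \<le> e * (304 * B ^ 11)" .
    hence s: "(\<Sum>i<m1. (aT i)\<^sup>2) / m1 \<le> 304 * B ^ 11" by (rule mult_left_le_imp_le) (rule e_bounds(3))
    have "((\<Sum>i<m1. \<bar>aT i\<bar>) / m1)\<^sup>2 \<le> (m1 * (\<Sum>i<m1. (aT i)\<^sup>2)) / (real m1)\<^sup>2"
      unfolding power_divide by (intro divide_right_mono sum_abs_le_sqrt) auto
    also have "\<dots> = (\<Sum>i<m1. (aT i)\<^sup>2) / m1" using real_pos by (simp add: power2_eq_square)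
    also have "\<dots> \<le> 304 * B ^ 11" by (rule s)
    also have "\<dots> \<le> (18 * B ^ 6)\<^sup>2"
      using B_pow[of 11 12] B_pow1[of 12] by (simp add: power_mult_distrib power_mult[symmetric])
    finally show "((\<Sum>i<m1. \<bar>aT i\<bar>) / m1)\<^sup>2 \<le> (18 * B ^ 6)\<^sup>2" .
  qed (use B1 in auto)
  have "risk aT \<le> 152 * B ^ 11 * e" using J l0 by linarith
  with lw net mean show thesis by (intro that[of aT W])
qed

end

section \<open>Gaussian vectors and the uniform distribution on the sphere\<close>

lemma std_normal_sets[simp, measurable_cong]: "sets std_normal = sets borel"
  by (simp add: std_normal_def)

lemma std_normal_space[simp]: "space std_normal = UNIV"
  by (simp add: std_normal_def)

lemma prob_space_std_normal: "prob_space std_normal"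
  unfolding std_normal_def by (rule prob_space_normal_density) simp

interpretation std_normal: prob_space std_normal
  by (rule prob_space_std_normal)

lemma integrable_std_normal_iff:
  fixes f :: "real \<Rightarrow> real"
  assumes "f \<in> borel_measurable borel"
  shows "integrable std_normal f \<longleftrightarrow> integrable lborel (\<lambda>x. std_normal_density x * f x)"
  unfolding std_normal_def using assms by (subst integrable_density) auto

lemma integral_std_normal:
  fixes f :: "real \<Rightarrow> real"
  assumes "f \<in> borel_measurable borel"
  shows "integral\<^sup>L std_normal f = (\<integral>x. std_normal_density x * f x \<partial>lborel)"
  unfolding std_normal_def using assms by (subst integral_density) auto

text \<open>One term of the exponential series at \<open>1 + \<bar>x\<bar>\<close> bounds the power,
  and the square of \<open>\<bar>x\<bar> - 4\<close> being nonnegative gives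
  \<open>\<bar>x\<bar> \<le> 2 + x\<^sup>2 / 8\<close>.\<close>

lemma poly_le_exp_square: "(1 + \<bar>x\<bar>) ^ k \<le> fact k * exp 3 * exp (x\<^sup>2 / (8::real))"
proof -
  have "(1 + \<bar>x\<bar>) ^ k / fact k \<le> exp (1 + \<bar>x\<bar>)"
  proof -
    have s: "(\<lambda>n. (1 + \<bar>x\<bar>) ^ n / fact n) sums exp (1 + \<bar>x\<bar>)"
      using exp_converges[of "1 + \<bar>x\<bar>"] by (simp add: divide_inverse mult.commute)
    have "(\<Sum>n\<in>{k}. (1 + \<bar>x\<bar>) ^ n / fact n) \<le> (\<Sum>n. (1 + \<bar>x\<bar>) ^ n / fact n)"
      using s by (intro sum_le_suminf) (auto simp: sums_iff)
    thus ?thesis using s by (simp add: sums_iff)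
  qed
  hence "(1 + \<bar>x\<bar>) ^ k \<le> fact k * exp (1 + \<bar>x\<bar>)"
    by (simp add: field_simps)
  also have "\<bar>x\<bar> \<le> 2 + x\<^sup>2 / 8"
    using zero_le_power2[of "\<bar>x\<bar> - 4"] by (simp add: power2_diff)
  hence "exp (1 + \<bar>x\<bar>) \<le> exp (3 + x\<^sup>2 / 8)" by simp
  finally show ?thesis by (simp add: exp_add mult_ac)
qed

text \<open>The extra factor \<open>exp (z\<^sup>2 / 4)\<close> absorbs Gaussian tails: \<open>1{|z| > R} \<le> exp (z\<^sup>2 / 4 - R\<^sup>2 / 4)\<close>.\<close>

lemma integrable_poly_exp_std_normal: "integrable std_normal (\<lambda>z. (1 + \<bar>z\<bar>) ^ k * exp (z\<^sup>2 / 4))"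
proof -
  have "integrable lborel (\<lambda>x. std_normal_density x * ((1 + \<bar>x\<bar>) ^ k * exp (x\<^sup>2 / 4)))"
  proof (rule Bochner_Integration.integrable_bound)
    \<comment> \<open>The exponents -1/2 + 1/8 + 1/4 add up to -1/8, the exponent of a normal
      density with standard deviation 2.\<close>
    show "integrable lborel (\<lambda>x. 2 * fact k * exp 3 * normal_density 0 2 x)"
      by (intro integrable_mult_right integrable_normal_density) simp
    show "AE x in lborel. norm (std_normal_density x * ((1 + \<bar>x\<bar>) ^ k * exp (x\<^sup>2 / 4)))
        \<le> norm (2 * fact k * exp 3 * normal_density 0 2 x)"
    proof (rule AE_I2)
      fix x :: real
      have "std_normal_density x * ((1 + \<bar>x\<bar>) ^ k * exp (x\<^sup>2 / 4))
          \<le> std_normal_density x * (fact k * exp 3 * exp (x\<^sup>2 / 8) * exp (x\<^sup>2 / 4))"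
        by (intro mult_left_mono mult_right_mono poly_le_exp_square) auto
      also have "\<dots> = 2 * fact k * exp 3 * normal_density 0 2 x"
      proof -
        have "exp (- x\<^sup>2 / 2) * exp (x\<^sup>2 / 8) * exp (x\<^sup>2 / 4) = exp (- x\<^sup>2 / 8)"
          unfolding exp_add[symmetric] by simp
        moreover have "std_normal_density x * (fact k * exp 3 * exp (x\<^sup>2 / 8) * exp (x\<^sup>2 / 4))
            = fact k * exp 3 / sqrt (2 * pi) * (exp (- x\<^sup>2 / 2) * exp (x\<^sup>2 / 8) * exp (x\<^sup>2 / 4))"
          by (simp add: std_normal_density_def)
        moreover have "sqrt (2 * pi * 2\<^sup>2) = 2 * sqrt (2 * pi)"
          using real_sqrt_mult[of "2 * pi" "2\<^sup>2"] real_sqrt_abs[of 2] by (simp only: abs_numeral mult.commute)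
        ultimately show ?thesis by (simp add: normal_density_def)
      qed
      finally show "norm (std_normal_density x * ((1 + \<bar>x\<bar>) ^ k * exp (x\<^sup>2 / 4)))
        \<le> norm (2 * fact k * exp 3 * normal_density 0 2 x)" by (simp add: abs_mult)
    qed
  qed measurable
  thus ?thesis by (subst integrable_std_normal_iff) auto
qed

definition gauss_moment :: "nat \<Rightarrow> real" where
  "gauss_moment k = (\<integral>z. (1 + \<bar>z\<bar>) ^ k * exp (z\<^sup>2 / 4) \<partial>std_normal)"

lemma gauss_moment_nonneg: "0 \<le> gauss_moment k"
  unfolding gauss_moment_def by (intro Bochner_Integration.integral_nonneg) auto

lemma integrable_std_normal_poly:
  assumes [measurable]: "f \<in> borel_measurable borel" and b: "\<And>z. \<bar>f z\<bar> \<le> C * (1 + \<bar>z\<bar>) ^ k"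
  shows "integrable std_normal f"
proof (rule Bochner_Integration.integrable_bound[OF integrable_mult_right[OF integrable_poly_exp_std_normal[of k], of C]])
  show "AE z in std_normal. norm (f z) \<le> norm (C * ((1 + \<bar>z\<bar>) ^ k * exp (z\<^sup>2 / 4)))"
  proof (rule AE_I2)
    fix z
    have C: "C \<ge> 0" using b[of 0] by simp
    have "\<bar>f z\<bar> \<le> C * (1 + \<bar>z\<bar>) ^ k * 1" using b[of z] by simp
    also have "\<dots> \<le> C * (1 + \<bar>z\<bar>) ^ k * exp (z\<^sup>2 / 4)" using C by (intro mult_left_mono) auto
    finally show "norm (f z) \<le> norm (C * ((1 + \<bar>z\<bar>) ^ k * exp (z\<^sup>2 / 4)))"
      using C by (simp add: abs_mult mult_ac)
  qed
qed simp

lemma integral_std_normal_poly_le: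
  assumes [measurable]: "f \<in> borel_measurable borel" and b: "\<And>z. \<bar>f z\<bar> \<le> C * (1 + \<bar>z\<bar>) ^ k"
  shows "integral\<^sup>L std_normal f \<le> C * gauss_moment k"
proof -
  have C: "C \<ge> 0" using b[of 0] by simp
  have "integral\<^sup>L std_normal f \<le> (\<integral>z. C * ((1 + \<bar>z\<bar>) ^ k * exp (z\<^sup>2 / 4)) \<partial>std_normal)"
  proof (rule integral_mono[OF integrable_std_normal_poly[OF assms] integrable_mult_right[OF integrable_poly_exp_std_normal]])
    fix z
    have "f z \<le> C * (1 + \<bar>z\<bar>) ^ k * 1" using b[of z] by simp
    also have "\<dots> \<le> C * (1 + \<bar>z\<bar>) ^ k * exp (z\<^sup>2 / 4)" using C by (intro mult_left_mono) auto
    finally show "f z \<le> C * ((1 + \<bar>z\<bar>) ^ k * exp (z\<^sup>2 / 4))" by (simp add: mult_ac)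
  qed
  thus ?thesis by (simp add: gauss_moment_def)
qed

lemma gauss_tail_integral:
  assumes [measurable]: "f \<in> borel_measurable borel" and b: "\<And>z. \<bar>f z\<bar> \<le> C * (1 + \<bar>z\<bar>) ^ k"
    and R: "R \<ge> 0"
  shows "(\<integral>z. f z * indicator {z. R < \<bar>z\<bar>} z \<partial>std_normal) \<le> C * gauss_moment k * exp (- R\<^sup>2 / 4)"
proof -
  have C: "C \<ge> 0" using b[of 0] by simp
  have "(\<integral>z. f z * indicator {z. R < \<bar>z\<bar>} z \<partial>std_normal)
      \<le> (\<integral>z. C * exp (- R\<^sup>2 / 4) * ((1 + \<bar>z\<bar>) ^ k * exp (z\<^sup>2 / 4)) \<partial>std_normal)"
  proof (rule integral_mono[OF _ integrable_mult_right[OF integrable_poly_exp_std_normal]])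
    show "integrable std_normal (\<lambda>z. f z * indicator {z. R < \<bar>z\<bar>} z)"
      by (rule integrable_real_mult_indicator[OF _ integrable_std_normal_poly[OF assms(1,2)]]) measurable
    fix z :: real
    show "f z * indicator {z. R < \<bar>z\<bar>} z \<le> C * exp (- R\<^sup>2 / 4) * ((1 + \<bar>z\<bar>) ^ k * exp (z\<^sup>2 / 4))"
    proof (cases "R < \<bar>z\<bar>")
      case True
      hence "R\<^sup>2 \<le> z\<^sup>2" using R power_mono[of R "\<bar>z\<bar>" 2] by simp
      hence "1 \<le> exp (- R\<^sup>2 / 4) * exp (z\<^sup>2 / 4)" unfolding exp_add[symmetric] by simp
      hence "C * (1 + \<bar>z\<bar>) ^ k * 1 \<le> C * (1 + \<bar>z\<bar>) ^ k * (exp (- R\<^sup>2 / 4) * exp (z\<^sup>2 / 4))"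
        using C by (intro mult_left_mono) auto
      thus ?thesis using True b[of z] by (simp add: mult_ac)
    next
      case False thus ?thesis using C by simp
    qed
  qed
  also have "\<dots> = C * exp (- R\<^sup>2 / 4) * gauss_moment k"
    unfolding gauss_moment_def by (rule integral_mult_right_zero)
  finally show ?thesis by (simp add: mult_ac)
qed

lemma gauss_tail_prob:
  assumes R: "R \<ge> 0"
  shows "measure std_normal {z. R < \<bar>z\<bar>} \<le> gauss_moment 0 * exp (- R\<^sup>2 / 4)"
  using gauss_tail_integral[of "\<lambda>_. 1" 1 0 R] R by simp

lemma integral_std_normal_square: "(\<integral>z. z\<^sup>2 \<partial>std_normal) = 1"
  using integral_std_normal_moment_even[of 1] by (subst integral_std_normal) (auto simp: fact_numeral)

lemma integral_std_normal_id: "(\<integral>z. z \<partial>std_normal) = 0"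
  using integral_std_normal_moment_odd[of 0] by (subst integral_std_normal) auto

text \<open>Integration by parts: the product of the density with \<open>G\<close> has derivative
  density times \<open>G' x - G x * x\<close> and vanishes at both ends. Continuity of
  \<open>G'\<close> makes the integrand continuous, as the fundamental theorem on the whole line
  asks.\<close>

lemma Stein_std_normal:
  fixes G G' :: "real \<Rightarrow> real"
  assumes D: "\<And>x. (G has_real_derivative G' x) (at x)" and c: "\<And>x. isCont G' x"
    and b: "\<And>z. \<bar>G z\<bar> \<le> C * (1 + \<bar>z\<bar>) ^ k" and b': "\<And>z. \<bar>G' z\<bar> \<le> C' * (1 + \<bar>z\<bar>) ^ k'"
  shows "(\<integral>z. G z * z \<partial>std_normal) = integral\<^sup>L std_normal G'"
proof -
  let ?\<phi> = std_normal_density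
  have cG: "continuous_on UNIV G" using D by (meson DERIV_continuous_on has_field_derivative_at_within)
  have [measurable]: "G \<in> borel_measurable borel" using cG by (rule borel_measurable_continuous_onI)
  have [measurable]: "G' \<in> borel_measurable borel"
    using c by (intro borel_measurable_continuous_onI continuous_at_imp_continuous_on) auto
  have C0: "C \<ge> 0" using b[of 0] by simp
  have bz: "\<bar>G z * z\<bar> \<le> C * (1 + \<bar>z\<bar>) ^ (Suc k)" for z
    using mult_mono[OF b[of z], of "\<bar>z\<bar>" "1 + \<bar>z\<bar>"] C0 by (simp add: abs_mult mult_ac)
  have i1: "integrable std_normal (\<lambda>z. G z * z)" by (rule integrable_std_normal_poly[OF _ bz]) measurable
  have i2: "integrable std_normal G'" by (rule integrable_std_normal_poly[OF _ b']) measurable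
  have D\<phi>: "(?\<phi> has_real_derivative (- x * ?\<phi> x)) (at x)" for x
    unfolding std_normal_density_def by (auto intro!: derivative_eq_intros simp: field_simps)
  let ?f = "\<lambda>x. ?\<phi> x * (G' x - G x * x)"
  have int: "integrable lborel ?f"
    using Bochner_Integration.integrable_diff[OF i2 i1] by (subst (asm) integrable_std_normal_iff) auto
  \<comment> \<open>The exponent -1/2 of the density plus 1/8 from the polynomial bound is below
    -1/4.\<close>
  have bd: "\<bar>?\<phi> x * G x\<bar> \<le> C * fact k * exp 3 * exp (- x\<^sup>2 / 4)" for x
  proof -
    have s: "1 / sqrt (2 * pi) \<le> 1" using pi_ge_two by (simp add: divide_le_eq)
    have "\<bar>?\<phi> x * G x\<bar> \<le> ?\<phi> x * (C * (fact k * exp 3 * exp (x\<^sup>2 / 8)))"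
      unfolding abs_mult using b[of x] mult_left_mono[OF poly_le_exp_square[of x k] C0]
      by (intro mult_mono) auto
    also have "\<dots> = 1 / sqrt (2 * pi) * (C * fact k * exp 3 * (exp (- x\<^sup>2 / 2) * exp (x\<^sup>2 / 8)))"
      by (simp add: std_normal_density_def)
    also have "\<dots> \<le> 1 * (C * fact k * exp 3 * exp (- x\<^sup>2 / 4))"
      unfolding exp_add[symmetric] using C0 s by (intro mult_mono mult_left_mono) auto
    finally show ?thesis by simp
  qed
  have exp_lim: "((\<lambda>x::real. C * fact k * exp 3 * exp (- x\<^sup>2 / 4)) \<longlongrightarrow> C * fact k * exp 3 * 0) F"
    if "filterlim (\<lambda>x::real. x\<^sup>2) at_top F" for F
  proof (intro tendsto_mult tendsto_const)
    have "filterlim (\<lambda>x::real. x\<^sup>2 * (1 / 4)) at_top F"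
      by (rule filterlim_at_top_mult_tendsto_pos[OF tendsto_const _ that]) simp
    hence "filterlim (\<lambda>x::real. - (x\<^sup>2 / 4)) at_bot F" by (simp add: filterlim_uminus_at_top)
    from filterlim_compose[OF exp_at_bot this] show "((\<lambda>x. exp (- x\<^sup>2 / 4)) \<longlongrightarrow> 0) F" by simp
  qed
  have lim: "((\<lambda>x. ?\<phi> x * G x) \<longlongrightarrow> 0) F" if "filterlim (\<lambda>x::real. x\<^sup>2) at_top F" for F
    by (rule Lim_null_comparison[OF _ exp_lim[OF that, unfolded mult_zero_right]]) (use bd in auto)
  have top: "filterlim (\<lambda>x::real. x\<^sup>2) at_top at_top"
    by (rule filterlim_pow_at_top) (auto simp: filterlim_ident)
  have bot: "filterlim (\<lambda>x::real. x\<^sup>2) at_top at_bot"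
    using filterlim_pow_at_bot_even[of 2 "\<lambda>x::real. x" at_bot] by (simp add: filterlim_ident)
  have "(LBINT x=-\<infinity>..\<infinity>. ?f x) = 0 - 0"
  proof (rule interval_integral_FTC_integrable[where F = "\<lambda>x. ?\<phi> x * G x"])
    fix x :: real
    have "((\<lambda>x. ?\<phi> x * G x) has_real_derivative ((- x * ?\<phi> x) * G x + G' x * ?\<phi> x)) (at x)"
      by (rule DERIV_mult[OF D\<phi> D])
    moreover have "(- x * ?\<phi> x) * G x + G' x * ?\<phi> x = ?f x" by (simp add: algebra_simps)
    ultimately show "((\<lambda>x. ?\<phi> x * G x) has_vector_derivative ?f x) (at x)"
      by (simp add: has_real_derivative_iff_has_vector_derivative)
    show "isCont ?f x"
      using DERIV_isCont[OF D\<phi>] DERIV_isCont[OF D] c by (intro continuous_intros) auto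
  next
    show "set_integrable lborel (einterval (- \<infinity>) \<infinity>) ?f"
      using int by (simp add: set_integrable_def einterval_eq)
    show "(((\<lambda>x. ?\<phi> x * G x) \<circ> real_of_ereal) \<longlongrightarrow> 0) (at_right (- \<infinity>))"
      using lim[OF bot] by (simp add: ereal_tendsto_simps)
    show "(((\<lambda>x. ?\<phi> x * G x) \<circ> real_of_ereal) \<longlongrightarrow> 0) (at_left \<infinity>)"
      using lim[OF top] by (simp add: ereal_tendsto_simps)
  qed simp
  hence "integral\<^sup>L lborel ?f = 0"
    by (simp add: interval_lebesgue_integral_def set_lebesgue_integral_def einterval_eq)
  hence "(\<integral>x. G' x - G x * x \<partial>std_normal) = 0" by (subst integral_std_normal) auto
  thus ?thesis using i1 i2 by simp
qed

section \<open>Gaussian vectors and their projections\<close>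

lemma gauss_vec_sets[measurable_cong]: "sets (gauss_vec d) = sets (PiM {..<d} (\<lambda>_. borel))"
  unfolding gauss_vec_def by (intro sets_PiM_cong) auto

lemma prob_space_gauss_vec: "prob_space (gauss_vec d)"
  unfolding gauss_vec_def by (rule prob_space_PiM) (rule prob_space_std_normal)

interpretation gauss_vec: prob_space "gauss_vec d" for d
  by (rule prob_space_gauss_vec)

lemma measurable_coordinate:
  "k < d \<Longrightarrow> (\<lambda>x. x k) \<in> borel_measurable (PiM {..<d} (\<lambda>_. borel :: real measure))"
  by (rule measurable_component_singleton) simp

lemma measurable_dotp[measurable]: "dotp d w \<in> borel_measurable (PiM {..<d} (\<lambda>_. borel))"
  unfolding dotp_def by measurable

lemma distributed_coordinate:
  assumes "k < d" shows "distributed (gauss_vec d) lborel (\<lambda>x. x k) std_normal_density"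
proof -
  have "distr (gauss_vec d) lborel (\<lambda>x. x k) = distr (gauss_vec d) std_normal (\<lambda>x. x k)"
    by (rule distr_cong) auto
  also have "\<dots> = std_normal"
    unfolding gauss_vec_def using assms by (intro distr_PiM_component) (auto simp: prob_space_std_normal)
  finally show ?thesis using assms by (auto simp: distributed_def std_normal_def)
qed

lemma distr_dotp:
  assumes w: "(\<Sum>k<d. (w k)\<^sup>2) = 1"
  shows "distr (gauss_vec d) borel (dotp d w) = std_normal"
proof -
  \<comment> \<open>The law of a sum of independent normals asks for positive deviations, so
    coordinates of weight zero are left out; the rest is nonempty because \<open>w\<close> is a unit
    vector.\<close>
  let ?I = "{k. k < d \<and> w k \<noteq> 0}"
  have wI: "(\<Sum>k\<in>?I. (w k)\<^sup>2) = (\<Sum>k<d. (w k)\<^sup>2)"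
    by (rule sum.mono_neutral_left) auto
  have ne: "?I \<noteq> {}" using w wI by fastforce
  hence d0: "{..<d} \<noteq> {}" by auto
  have "gauss_vec.indep_vars d (\<lambda>_. std_normal) (\<lambda>k x. x k) {..<d}"
    unfolding gauss_vec_def by (rule indep_vars_PiM_coordinates[OF d0]) (rule prob_space_std_normal)
  moreover have "(\<lambda>y. w k * y) \<in> borel_measurable std_normal" for k by measurable
  ultimately have "gauss_vec.indep_vars d (\<lambda>_. borel) (\<lambda>k x. w k * x k) {..<d}"
    by (rule gauss_vec.indep_vars_compose2[where Y = "\<lambda>k y. w k * y"])
  hence ind: "gauss_vec.indep_vars d (\<lambda>_. borel) (\<lambda>k x. w k * x k) ?I"
    by (rule gauss_vec.indep_vars_subset) auto
  have "distributed (gauss_vec d) lborel (\<lambda>x. \<Sum>k\<in>?I. w k * x k)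
      (normal_density (\<Sum>k\<in>?I. 0) (sqrt (\<Sum>k\<in>?I. \<bar>w k\<bar>\<^sup>2)))"
  proof (rule gauss_vec.sum_indep_normal[OF _ ne ind])
    fix k assume k: "k \<in> ?I"
    thus "0 < \<bar>w k\<bar>" by simp
    show "distributed (gauss_vec d) lborel (\<lambda>x. w k * x k) (normal_density 0 \<bar>w k\<bar>)"
      using gauss_vec.normal_density_affine[OF distributed_coordinate, of k d "w k" 0] k by simp
  qed simp
  also have "(\<lambda>x. \<Sum>k\<in>?I. w k * x k) = dotp d w"
    unfolding dotp_def fun_eq_iff by (intro allI sum.mono_neutral_left) auto
  finally have "distributed (gauss_vec d) lborel (dotp d w) std_normal_density"
    using w wI by simp
  hence "distr (gauss_vec d) lborel (dotp d w) = std_normal"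
    by (simp add: distributed_def std_normal_def)
  moreover have "distr (gauss_vec d) lborel (dotp d w) = distr (gauss_vec d) borel (dotp d w)"
    by (rule distr_cong) auto
  ultimately show ?thesis by simp
qed

lemma
  fixes f :: "real \<Rightarrow> real"
  assumes w: "(\<Sum>k<d. (w k)\<^sup>2) = 1" and [measurable]: "f \<in> borel_measurable borel"
  shows integral_dotp: "(\<integral>x. f (dotp d w x) \<partial>gauss_vec d) = integral\<^sup>L std_normal f"
    and integrable_dotp: "integrable (gauss_vec d) (\<lambda>x. f (dotp d w x)) \<longleftrightarrow> integrable std_normal f"
  unfolding distr_dotp[OF w, symmetric]
  by (simp_all add: integral_distr integrable_distr_eq)

lemma nn_integral_dotp:
  assumes w: "(\<Sum>k<d. (w k)\<^sup>2) = 1" and [measurable]: "f \<in> borel_measurable borel"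
  shows "(\<integral>\<^sup>+x. f (dotp d w x) \<partial>gauss_vec d) = (\<integral>\<^sup>+z. f z \<partial>std_normal)"
  unfolding distr_dotp[OF w, symmetric] by (simp add: nn_integral_distr)

lemma measure_dotp:
  assumes w: "(\<Sum>k<d. (w k)\<^sup>2) = 1" and [measurable]: "Measurable.pred borel P"
  shows "measure (gauss_vec d) {x \<in> space (gauss_vec d). P (dotp d w x)} = measure std_normal {z. P z}"
proof -
  have "measure std_normal {z. P z} = measure (gauss_vec d) (dotp d w -` {z. P z} \<inter> space (gauss_vec d))"
    unfolding distr_dotp[OF w, symmetric] by (rule measure_distr) auto
  thus ?thesis by (simp add: vimage_def Int_def conj_commute)
qed

text \<open>Presents a coordinate as a projection on a unit vector, so that every statement about
  \<open>dotp\<close> also covers coordinates.\<close>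

definition basis :: "nat \<Rightarrow> nat \<Rightarrow> real" where
  "basis k l = (if l = k then 1 else 0)"

lemma basis: "k < d \<Longrightarrow> (\<Sum>l<d. (basis k l)\<^sup>2) = 1" "k < d \<Longrightarrow> dotp d (basis k) x = x k"
  by (simp_all add: basis_def dotp_def if_distrib[of "\<lambda>z. z\<^sup>2"] if_distrib[of "\<lambda>z. z * _"] cong: if_cong)

lemma poly_shift_bound:
  assumes "\<bar>a\<bar> \<le> 1" and C: "C \<ge> 0"
  shows "C * (1 + \<bar>c + a * y\<bar>) ^ k \<le> (C * (1 + \<bar>c\<bar>) ^ k) * (1 + \<bar>y\<bar> :: real) ^ k"
proof -
  have "\<bar>a * y\<bar> \<le> 1 * \<bar>y\<bar>" unfolding abs_mult using assms by (intro mult_right_mono) auto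
  hence "1 + \<bar>c + a * y\<bar> \<le> 1 + \<bar>c\<bar> + \<bar>y\<bar>" by linarith
  also have "\<dots> \<le> (1 + \<bar>c\<bar>) * (1 + \<bar>y\<bar>)" by (simp add: algebra_simps)
  finally have "(1 + \<bar>c + a * y\<bar>) ^ k \<le> ((1 + \<bar>c\<bar>) * (1 + \<bar>y\<bar>)) ^ k" by (intro power_mono) auto
  thus ?thesis using C by (simp add: power_mult_distrib mult_left_mono mult.assoc)
qed

lemma square_le_one_plus_abs: "\<bar>z\<^sup>2\<bar> \<le> 1 * (1 + \<bar>z :: real\<bar>) ^ 2"
  using power_mono[of "\<bar>z\<bar>" "1 + \<bar>z\<bar>" 2] by simp

lemma integrable_std_normal_square: "integrable std_normal (\<lambda>z. z\<^sup>2)"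
  by (rule integrable_std_normal_poly[OF _ square_le_one_plus_abs]) simp

lemma unit_component_le:
  assumes "(\<Sum>k<(d::nat). (w k)\<^sup>2) = (1::real)" "k < d" shows "\<bar>w k\<bar> \<le> 1"
proof -
  have "(w k)\<^sup>2 \<le> (\<Sum>k<d. (w k)\<^sup>2)" using assms(2) by (intro member_le_sum) auto
  thus ?thesis using assms(1) by (simp add: abs_square_le_1)
qed

text \<open>Fubini isolates coordinate \<open>k\<close>. With the others frozen, the projection is
  \<open>s + w k * y\<close>, and the identity on the line applied to this function of
  \<open>y\<close> yields the factor \<open>w k\<close>.\<close>

lemma Stein_gauss_vec:
  fixes G G' :: "real \<Rightarrow> real"
  assumes D: "\<And>x. (G has_real_derivative G' x) (at x)" and c: "\<And>x. isCont G' x"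
    and b: "\<And>z. \<bar>G z\<bar> \<le> C * (1 + \<bar>z\<bar>) ^ m" and b': "\<And>z. \<bar>G' z\<bar> \<le> C' * (1 + \<bar>z\<bar>) ^ m'"
    and w: "(\<Sum>k<d. (w k)\<^sup>2) = 1" and k: "k < d"
  shows "(\<integral>x. G (dotp d w x) * x k \<partial>gauss_vec d) = w k * integral\<^sup>L std_normal G'"
proof -
  have cG: "continuous_on UNIV G" using D by (meson DERIV_continuous_on has_field_derivative_at_within)
  have [measurable]: "G \<in> borel_measurable borel" using cG by (rule borel_measurable_continuous_onI)
  have [measurable]: "G' \<in> borel_measurable borel"
    using c by (intro borel_measurable_continuous_onI continuous_at_imp_continuous_on) auto
  have C0: "C \<ge> 0" "C' \<ge> 0" using b[of 0] b'[of 0] by simp_all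
  have wk: "\<bar>w k\<bar> \<le> 1" by (rule unit_component_le[OF w k])
  have G2: "integrable std_normal (\<lambda>z. (G z)\<^sup>2)"
  proof (rule integrable_std_normal_poly[where C = "C\<^sup>2" and k = "m * 2"])
    fix z show "\<bar>(G z)\<^sup>2\<bar> \<le> C\<^sup>2 * (1 + \<bar>z\<bar>) ^ (m * 2)"
      using power_mono[OF b[of z], of 2] by (simp add: power_mult_distrib power_mult)
  qed measurable
  note x2 = integrable_std_normal_square
  have xk2: "integrable (gauss_vec d) (\<lambda>x. (x k)\<^sup>2)"
    using integrable_dotp[OF basis(1)[OF k], of "\<lambda>z. z\<^sup>2"] x2 by (simp add: basis(2)[OF k])
  have Gw2: "integrable (gauss_vec d) (\<lambda>x. (G (dotp d w x))\<^sup>2)"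
    using integrable_dotp[OF w, of "\<lambda>z. (G z)\<^sup>2"] G2 by simp
  have int: "integrable (gauss_vec d) (\<lambda>x. G (dotp d w x) * x k)"
  proof (rule Bochner_Integration.integrable_bound[OF Bochner_Integration.integrable_add[OF Gw2 xk2]])
    show "AE x in gauss_vec d. norm (G (dotp d w x) * x k) \<le> norm ((G (dotp d w x))\<^sup>2 + (x k)\<^sup>2)"
    proof (rule AE_I2)
      fix x
      have "2 * \<bar>G (dotp d w x)\<bar> * \<bar>x k\<bar> \<le> (G (dotp d w x))\<^sup>2 + (x k)\<^sup>2"
        using sum_squares_bound[of "\<bar>G (dotp d w x)\<bar>" "\<bar>x k\<bar>"] by simp
      hence "\<bar>G (dotp d w x) * x k\<bar> * 2 \<le> (G (dotp d w x))\<^sup>2 + (x k)\<^sup>2"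
        by (simp only: abs_mult mult_ac)
      moreover have "0 \<le> \<bar>G (dotp d w x) * x k\<bar>" by (rule abs_ge_zero)
      moreover have "(G (dotp d w x))\<^sup>2 + (x k)\<^sup>2 \<le> \<bar>(G (dotp d w x))\<^sup>2 + (x k)\<^sup>2\<bar>" by (rule abs_ge_self)
      ultimately show "norm (G (dotp d w x) * x k) \<le> norm ((G (dotp d w x))\<^sup>2 + (x k)\<^sup>2)"
        unfolding real_norm_def by linarith
    qed
    have [measurable]: "(\<lambda>x. x k) \<in> borel_measurable (gauss_vec d)"
      unfolding measurable_cong_sets[OF gauss_vec_sets refl] by (rule measurable_coordinate[OF k])
    show "(\<lambda>x. G (dotp d w x) * x k) \<in> borel_measurable (gauss_vec d)" by measurable
  qed
  have int': "integrable (gauss_vec d) (\<lambda>x. w k * G' (dotp d w x))"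
  proof (rule integrable_mult_right)
    show "integrable (gauss_vec d) (\<lambda>x. G' (dotp d w x))"
    proof -
      have "integrable std_normal G'" by (rule integrable_std_normal_poly[OF _ b']) simp
      thus ?thesis by (simp add: integrable_dotp[OF w])
    qed
  qed
  let ?I = "{..<d} - {k}"
  have ins: "insert k ?I = {..<d}" using k by auto
  interpret product_sigma_finite "\<lambda>_::nat. std_normal" ..
  have split: "(\<integral>x. F x \<partial>gauss_vec d) = (\<integral>x. (\<integral>y. F (x(k := y)) \<partial>std_normal) \<partial>PiM ?I (\<lambda>_. std_normal))"
    if "integrable (gauss_vec d) F" for F :: "_ \<Rightarrow> real"
    by (rule product_integral_insert[where I = ?I and i = k and f = F, unfolded ins, folded gauss_vec_def])
       (use that in auto)
  have dp: "dotp d w (x(k := y)) = (\<Sum>j\<in>?I. w j * x j) + w k * y" for x y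
  proof -
    have "dotp d w (x(k := y)) = (\<Sum>j\<in>insert k ?I. w j * (x(k := y)) j)" unfolding ins dotp_def ..
    also have "\<dots> = w k * y + (\<Sum>j\<in>?I. w j * (x(k := y)) j)" by (subst sum.insert) auto
    also have "(\<Sum>j\<in>?I. w j * (x(k := y)) j) = (\<Sum>j\<in>?I. w j * x j)" by (intro sum.cong) auto
    finally show ?thesis by (simp only: add.commute)
  qed
  have inner: "(\<integral>y. G (s + w k * y) * y \<partial>std_normal) = (\<integral>y. w k * G' (s + w k * y) \<partial>std_normal)" for s
  proof (rule Stein_std_normal)
    fix x
    show "((\<lambda>y. G (s + w k * y)) has_real_derivative w k * G' (s + w k * x)) (at x)"
      by (rule DERIV_cong[OF DERIV_chain2[OF D]]) (auto intro!: derivative_eq_intros)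
    show "isCont (\<lambda>y. w k * G' (s + w k * y)) x"
      by (intro continuous_intros isCont_o2[OF _ c]) 
    show "\<bar>G (s + w k * x)\<bar> \<le> (C * (1 + \<bar>s\<bar>) ^ m) * (1 + \<bar>x\<bar>) ^ m"
      using b poly_shift_bound[OF wk C0(1)] by (rule order_trans)
    have "\<bar>w k * G' (s + w k * x)\<bar> \<le> 1 * (C' * (1 + \<bar>s + w k * x\<bar>) ^ m')"
      unfolding abs_mult using wk b' by (intro mult_mono) auto
    also have "\<dots> \<le> (C' * (1 + \<bar>s\<bar>) ^ m') * (1 + \<bar>x\<bar>) ^ m'" using poly_shift_bound[OF wk C0(2)] by simp
    finally show "\<bar>w k * G' (s + w k * x)\<bar> \<le> (C' * (1 + \<bar>s\<bar>) ^ m') * (1 + \<bar>x\<bar>) ^ m'" .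
  qed
  have "(\<integral>x. G (dotp d w x) * x k \<partial>gauss_vec d) = (\<integral>x. w k * G' (dotp d w x) \<partial>gauss_vec d)"
    unfolding split[OF int] split[OF int'] dp by (simp only: fun_upd_same inner)
  also have "\<dots> = w k * (\<integral>x. G' (dotp d w x) \<partial>gauss_vec d)" by simp
  also have "(\<integral>x. G' (dotp d w x) \<partial>gauss_vec d) = integral\<^sup>L std_normal G'" by (rule integral_dotp[OF w]) simp
  finally show "(\<integral>x. G (dotp d w x) * x k \<partial>gauss_vec d) = w k * integral\<^sup>L std_normal G'" .
qed

lemma gauss_vec_mean: "k < d \<Longrightarrow> (\<integral>x. x k \<partial>gauss_vec d) = 0"
  using integral_dotp[OF basis(1), of k d "\<lambda>z. z"] by (simp add: basis(2) integral_std_normal_id)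

text \<open>Stein's identity for the identity function in direction \<open>basis l\<close>.\<close>

lemma gauss_vec_cov:
  assumes "k < d" "l < d" shows "(\<integral>x. x k * x l \<partial>gauss_vec d) = (if k = l then 1 else 0)"
proof -
  have "(\<integral>x. (\<lambda>z. z) (dotp d (basis l) x) * x k \<partial>gauss_vec d) = basis l k * (\<integral>z. 1 \<partial>std_normal)"
    by (rule Stein_gauss_vec[where C = 1 and m = 1 and C' = 1 and m' = 0])
       (use assms basis(1) in \<open>auto intro!: derivative_eq_intros\<close>)
  thus ?thesis using assms std_normal.prob_space by (auto simp: basis(2) basis_def mult.commute)
qed

text \<open>Rescaling to a unit vector reduces this to the second moment on the line; the zero
  vector cannot be rescaled and is treated apart. The nonnegative integral fits the form in which
  the population risk is stated.\<close>

lemma nn_integral_dotp_square: "(\<integral>\<^sup>+x. ennreal ((dotp d v x)\<^sup>2) \<partial>gauss_vec d) = ennreal (\<Sum>k<d. (v k)\<^sup>2)"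
proof (cases "(\<Sum>k<d. (v k)\<^sup>2) = 0")
  case True
  hence "v k = 0" if "k < d" for k using that by (simp add: sum_nonneg_eq_0_iff)
  hence "dotp d v x = 0" for x by (simp add: dotp_def)
  thus ?thesis using True by simp
next
  case False
  define r where "r = sqrt (\<Sum>k<d. (v k)\<^sup>2)"
  have s0: "0 \<le> (\<Sum>k<d. (v k)\<^sup>2)" by (intro sum_nonneg) auto
  have r2: "r\<^sup>2 = (\<Sum>k<d. (v k)\<^sup>2)" using s0 by (simp add: r_def)
  have r: "r \<noteq> 0" using False r2 by auto
  have u: "(\<Sum>k<d. (v k / r)\<^sup>2) = 1"
  proof -
    have "(\<Sum>k<d. (v k / r)\<^sup>2) = r\<^sup>2 / r\<^sup>2" by (simp add: power_divide sum_divide_distrib[symmetric] r2)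
    thus ?thesis using r by simp
  qed
  have "dotp d v x = r * dotp d (\<lambda>k. v k / r) x" for x
    using r by (simp add: dotp_def sum_distrib_left)
  hence "(\<integral>\<^sup>+x. ennreal ((dotp d v x)\<^sup>2) \<partial>gauss_vec d)
      = (\<integral>\<^sup>+x. ennreal (r\<^sup>2 * (dotp d (\<lambda>k. v k / r) x)\<^sup>2) \<partial>gauss_vec d)"
    by (simp add: power_mult_distrib)
  also have "\<dots> = (\<integral>\<^sup>+z. ennreal (r\<^sup>2 * z\<^sup>2) \<partial>std_normal)"
    using nn_integral_dotp[OF u, of "\<lambda>z. ennreal (r\<^sup>2 * z\<^sup>2)"] by simp
  also have "\<dots> = ennreal (\<integral>z. r\<^sup>2 * z\<^sup>2 \<partial>std_normal)"
  proof (rule nn_integral_eq_integral)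
    show "integrable std_normal (\<lambda>z. r\<^sup>2 * z\<^sup>2)"
      by (intro integrable_mult_right integrable_std_normal_square)
  qed simp
  also have "(\<integral>z. r\<^sup>2 * z\<^sup>2 \<partial>std_normal) = r\<^sup>2" by (simp add: integral_std_normal_square)
  finally show ?thesis by (simp add: r2)
qed

section \<open>The uniform distribution on the sphere\<close>

lemma measurable_gauss_coordinate: "k < d \<Longrightarrow> (\<lambda>x. x k) \<in> borel_measurable (gauss_vec d)"
  unfolding measurable_cong_sets[OF gauss_vec_sets refl] by (rule measurable_coordinate)

lemma measurable_vnorm[measurable]: "vnorm d \<in> borel_measurable (PiM {..<d} (\<lambda>_. borel))"
  unfolding vnorm_def by measurable

definition normalized :: "nat \<Rightarrow> (nat \<Rightarrow> real) \<Rightarrow> nat \<Rightarrow> real" where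
  "normalized d x = (\<lambda>k\<in>{..<d}. x k / vnorm d x)"

lemma sphere_unif_normalized: "sphere_unif d = distr (gauss_vec d) (PiM {..<d} (\<lambda>_. borel)) (normalized d)"
  by (simp add: sphere_unif_def normalized_def[abs_def])

lemma measurable_normalized[measurable]:
  "normalized d \<in> measurable (gauss_vec d) (PiM {..<d} (\<lambda>_. borel))"
  unfolding normalized_def
proof (rule measurable_restrict)
  fix k assume "k \<in> {..<d}"
  hence [measurable]: "(\<lambda>x. x k) \<in> borel_measurable (gauss_vec d)" by (auto intro: measurable_gauss_coordinate)
  show "(\<lambda>x. x k / vnorm d x) \<in> borel_measurable (gauss_vec d)" by measurable
qed

lemma prob_space_sphere_unif: "prob_space (sphere_unif d)"
  unfolding sphere_unif_normalized by (rule gauss_vec.prob_space_distr) simp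

lemma sphere_unif_sets[simp, measurable_cong]: "sets (sphere_unif d) = sets (PiM {..<d} (\<lambda>_. borel))"
  by (simp add: sphere_unif_def)

lemma vnorm_square: "(vnorm d x)\<^sup>2 = (\<Sum>k<d. (x k)\<^sup>2)"
  by (simp add: vnorm_def sum_nonneg)

lemma vnorm_nonneg: "0 \<le> vnorm d x"
  by (simp add: vnorm_def sum_nonneg)

lemma component_le_vnorm: "k < d \<Longrightarrow> \<bar>x k\<bar> \<le> vnorm d x"
  unfolding vnorm_def using member_le_sum[of k "{..<d}" "\<lambda>k. (x k)\<^sup>2"] by (intro real_le_rsqrt) simp

lemma normalized_le_one: "k < d \<Longrightarrow> \<bar>normalized d x k\<bar> \<le> 1"
  using component_le_vnorm[of k d x] vnorm_nonneg[of d x]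
  by (cases "vnorm d x = 0") (auto simp: normalized_def abs_divide divide_le_eq_1)

lemma integral_std_normal_odd:
  fixes f :: "real \<Rightarrow> real"
  assumes [measurable]: "f \<in> borel_measurable borel" and odd: "\<And>x. f (- x) = - f x"
  shows "integral\<^sup>L std_normal f = 0"
proof -
  have "(\<integral>x. std_normal_density x * f x \<partial>lborel) = (\<integral>x. std_normal_density (- x) * f (- x) \<partial>lborel)"
    using lborel_integral_real_affine[of "-1" "\<lambda>x. std_normal_density x * f x" 0] by simp
  also have "\<dots> = - (\<integral>x. std_normal_density x * f x \<partial>lborel)"
    by (simp add: odd std_normal_density_def)
  finally show ?thesis by (subst integral_std_normal) auto
qed

lemma AE_vnorm_nonzero:
  assumes "d \<ge> 1" shows "AE x in gauss_vec d. vnorm d x \<noteq> 0"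
proof -
  have "AE z in std_normal. z \<noteq> 0"
    unfolding std_normal_def by (subst AE_density) (auto intro!: AE_I2 eventually_mono[OF AE_lborel_singleton[of 0]])
  hence "AE x in gauss_vec d. x 0 \<noteq> 0"
    unfolding gauss_vec_def using assms by (intro AE_PiM_component[where M = "\<lambda>_. std_normal"]) (auto simp: prob_space_std_normal)
  thus ?thesis
  proof (rule eventually_mono)
    fix x :: "nat \<Rightarrow> real" assume "x 0 \<noteq> 0"
    thus "vnorm d x \<noteq> 0" using component_le_vnorm[of 0 d x] assms by auto
  qed
qed

text \<open>Off the diagonal, the integrand is odd in coordinate \<open>k\<close> when the others
  are frozen. On the diagonal, swapping two coordinates preserves the Gaussian law, so all
  \<open>d\<close> second moments agree; they add up to 1 because the norm is almost surely
  nonzero.\<close>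

lemma normalized_cov:
  assumes d: "d \<ge> 1" and k: "k < d" and l: "l < d"
  shows "(\<integral>x. normalized d x k * normalized d x l \<partial>gauss_vec d) = (if k = l then 1 / d else 0)"
proof -
  have [measurable]: "(\<lambda>x. normalized d x j) \<in> borel_measurable (gauss_vec d)" if "j < d" for j
    by (rule measurable_compose[OF measurable_normalized measurable_coordinate[OF that]])
  have meas: "(\<lambda>x. normalized d x i * normalized d x j) \<in> borel_measurable (gauss_vec d)" if "i < d" "j < d" for i j
    using that by measurable
  have int: "integrable (gauss_vec d) (\<lambda>x. normalized d x i * normalized d x j)" if ij: "i < d" "j < d" for i j
  proof (rule gauss_vec.integrable_const_bound[OF _ meas[OF ij]])
    have "\<bar>normalized d x i * normalized d x j\<bar> \<le> 1 * 1" for x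
      unfolding abs_mult by (intro mult_mono normalized_le_one ij) auto
    thus "AE x in gauss_vec d. norm (normalized d x i * normalized d x j) \<le> 1" by simp
  qed
  show ?thesis
  proof (cases "k = l")
    case False
    let ?I = "{..<d} - {k}"
    have ins: "insert k ?I = {..<d}" using k by auto
    interpret product_sigma_finite "\<lambda>_::nat. std_normal" ..
    have split: "(\<integral>x. normalized d x k * normalized d x l \<partial>gauss_vec d)
        = (\<integral>x. (\<integral>y. normalized d (x(k := y)) k * normalized d (x(k := y)) l \<partial>std_normal) \<partial>PiM ?I (\<lambda>_. std_normal))"
      by (rule product_integral_insert[where I = ?I and i = k, unfolded ins, folded gauss_vec_def])
         (use int[OF k l] in auto)
    have "(\<integral>y. normalized d (x(k := y)) k * normalized d (x(k := y)) l \<partial>std_normal) = 0" for x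
    proof -
      define S where "S = (\<Sum>j\<in>?I. (x j)\<^sup>2)"
      have vn: "vnorm d (x(k := y)) = sqrt (y\<^sup>2 + S)" for y
      proof -
        have "(\<Sum>j<d. ((x(k := y)) j)\<^sup>2) = (\<Sum>j\<in>insert k ?I. ((x(k := y)) j)\<^sup>2)" by (simp only: ins)
        also have "\<dots> = y\<^sup>2 + (\<Sum>j\<in>?I. ((x(k := y)) j)\<^sup>2)" by (subst sum.insert) auto
        also have "(\<Sum>j\<in>?I. ((x(k := y)) j)\<^sup>2) = S" unfolding S_def by (intro sum.cong) auto
        finally show ?thesis by (simp add: vnorm_def)
      qed
      have "normalized d (x(k := y)) k * normalized d (x(k := y)) l
          = (y / sqrt (y\<^sup>2 + S)) * (x l / sqrt (y\<^sup>2 + S))" for y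
        using k l False by (simp add: normalized_def vn)
      hence "(\<integral>y. normalized d (x(k := y)) k * normalized d (x(k := y)) l \<partial>std_normal)
          = (\<integral>y. (y / sqrt (y\<^sup>2 + S)) * (x l / sqrt (y\<^sup>2 + S)) \<partial>std_normal)" by simp
      also have "\<dots> = 0" by (rule integral_std_normal_odd) auto
      finally show ?thesis .
    qed
    thus ?thesis using False split by simp
  next
    case True
    define c where "c j = (\<integral>x. normalized d x j * normalized d x j \<partial>gauss_vec d)" for j
    have c_eq: "c j = c k" if j: "j < d" for j
    proof -
      let ?f = "Transposition.transpose j k"
      let ?t = "\<lambda>\<omega>. \<lambda>i\<in>{..<d}. \<omega> (?f i) :: real"
      have f: "?f \<in> {..<d} \<rightarrow> {..<d}" using j k by (auto simp: Transposition.transpose_def)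
      have distr: "distr (gauss_vec d) (gauss_vec d) ?t = gauss_vec d"
        unfolding gauss_vec_def
        by (rule distr_PiM_reindex[where f = ?f and M = "\<lambda>_. std_normal"]) (auto simp: prob_space_std_normal f intro!: inj_on_inverseI[where g = ?f])
      have t[measurable]: "?t \<in> measurable (gauss_vec d) (gauss_vec d)"
        unfolding measurable_cong_sets[OF refl gauss_vec_sets]
      proof (rule measurable_restrict)
        fix i assume "i \<in> {..<d}"
        hence "?f i < d" using f by auto
        thus "(\<lambda>\<omega>. \<omega> (?f i)) \<in> borel_measurable (gauss_vec d)" by (rule measurable_gauss_coordinate)
      qed
      have norm: "normalized d (?t x) j = normalized d x k" for x
      proof -
        have "(\<Sum>i<d. (x (?f i))\<^sup>2) = (\<Sum>i<d. (x i)\<^sup>2)"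
          by (rule sum.reindex_bij_betw[where g = "\<lambda>i. (x i)\<^sup>2"])
             (use f j k in \<open>auto intro!: bij_betwI[where g = ?f]\<close>)
        hence "vnorm d (?t x) = vnorm d x" by (simp add: vnorm_def)
        thus ?thesis using j k by (simp add: normalized_def)
      qed
      have "c j = (\<integral>x. normalized d x j * normalized d x j \<partial>distr (gauss_vec d) (gauss_vec d) ?t)"
        unfolding distr c_def ..
      also have "\<dots> = (\<integral>x. normalized d (?t x) j * normalized d (?t x) j \<partial>gauss_vec d)"
        by (rule integral_distr[OF t meas[OF j j]])
      also have "\<dots> = c k" unfolding norm c_def ..
      finally show ?thesis .
    qed
    have "(\<Sum>j<d. c j) = (\<integral>x. (\<Sum>j<d. normalized d x j * normalized d x j) \<partial>gauss_vec d)"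
      unfolding c_def by (rule Bochner_Integration.integral_sum[symmetric]) (use int in auto)
    also have "\<dots> = (\<integral>x. 1 \<partial>gauss_vec d)"
    proof (rule integral_cong_AE)
      show "AE x in gauss_vec d. (\<Sum>j<d. normalized d x j * normalized d x j) = 1"
      proof (rule eventually_mono[OF AE_vnorm_nonzero[OF d]])
        fix x assume v: "vnorm d x \<noteq> 0"
        have "(\<Sum>j<d. normalized d x j * normalized d x j) = (\<Sum>j<d. (x j)\<^sup>2 / (vnorm d x)\<^sup>2)"
          by (intro sum.cong) (auto simp: normalized_def power2_eq_square)
        also have "\<dots> = (vnorm d x)\<^sup>2 / (vnorm d x)\<^sup>2"
          by (simp add: sum_divide_distrib[symmetric] vnorm_square)
        finally show "(\<Sum>j<d. normalized d x j * normalized d x j) = 1" using v by simp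
      qed
    qed (use meas in auto)
    also have "\<dots> = 1" by (simp add: gauss_vec.prob_space)
    finally have "d * c k = 1" using c_eq by simp
    thus ?thesis using True d by (simp add: c_def field_simps)
  qed
qed

definition trunc_moment :: real where
  "trunc_moment = (\<integral>z. min (z\<^sup>2) 1 \<partial>std_normal)"

lemma trunc_moment: "0 < trunc_moment" "trunc_moment \<le> 1"
proof -
  have i: "integrable std_normal (\<lambda>z. min (z\<^sup>2) 1)"
    by (rule std_normal.integrable_const_bound[of _ 1]) auto
  have "AE z in std_normal. z \<noteq> 0"
    unfolding std_normal_def by (subst AE_density) (auto intro!: AE_I2 eventually_mono[OF AE_lborel_singleton[of 0]])
  have "\<not> (AE z in std_normal. min (z\<^sup>2) 1 = 0)"
  proof
    assume "AE z in std_normal. min (z\<^sup>2) 1 = 0"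
    with \<open>AE z in std_normal. z \<noteq> 0\<close> have "AE z in std_normal. False"
      by eventually_elim (auto simp: min_def split: if_splits)
    thus False by (simp add: std_normal.AE_False)
  qed
  hence "trunc_moment \<noteq> 0"
    unfolding trunc_moment_def by (subst integral_nonneg_eq_0_iff_AE[OF i]) auto
  moreover have "0 \<le> trunc_moment" unfolding trunc_moment_def by (intro Bochner_Integration.integral_nonneg) auto
  ultimately show "0 < trunc_moment" by simp
  have "trunc_moment \<le> (\<integral>z. 1 \<partial>std_normal)" unfolding trunc_moment_def by (rule integral_mono[OF i]) auto
  thus "trunc_moment \<le> 1" using std_normal.prob_space by simp
qed

text \<open>For \<open>d\<close> below the threshold the trivial bound \<open>|v k| \<le> 1\<close> suffices; above it
  \<open>\<parallel>x\<parallel>\<^sup>2\<close> is at least a constant multiple of \<open>d\<close>, by Hoeffding for the bounded \<open>min (x k)\<^sup>2 1\<close>.\<close>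

lemma normalized_tail:
  assumes d: "d \<ge> 1" and R: "R \<ge> 1"
  shows "measure (gauss_vec d) {x \<in> space (gauss_vec d). \<not> (\<forall>k<d. \<bar>normalized d x k\<bar> \<le> 2 * R / (trunc_moment * sqrt d))}
    \<le> (2 + d * gauss_moment 0) * exp (- R\<^sup>2 / 4)"
proof -
  let ?m = trunc_moment and ?P = "gauss_vec d"
  have m: "0 < ?m" "?m \<le> 1" by (rule trunc_moment)+
  have d0: "real d > 0" using d by simp
  show ?thesis
  \<comment> \<open>The threshold is placed so that, above it, the Hoeffding bound with exponent
    \<open>d * ?m\<^sup>2 / 8\<close> is at most \<open>exp (- R\<^sup>2 / 4)\<close>; below it, the
    asserted bound on a coordinate is at least 1.\<close>
  proof (cases "real d * ?m\<^sup>2 \<le> 2 * R\<^sup>2")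
    case True
    have "\<bar>normalized d x k\<bar> \<le> 2 * R / (?m * sqrt d)" if "k < d" for x k
    proof -
      have "(?m * sqrt d)\<^sup>2 = real d * ?m\<^sup>2" by (simp add: power_mult_distrib)
      also have "\<dots> \<le> 2 * R\<^sup>2" by (rule True)
      also have "\<dots> \<le> (2 * R)\<^sup>2" by (simp add: power_mult_distrib)
      finally have sq: "(?m * sqrt d)\<^sup>2 \<le> (2 * R)\<^sup>2" .
      have "0 \<le> 2 * R" using R by simp
      with sq have "?m * sqrt d \<le> 2 * R" by (rule power2_le_imp_le)
      hence "1 \<le> 2 * R / (?m * sqrt d)" using m d0 by (simp add: le_divide_eq)
      thus ?thesis using normalized_le_one[OF that, of x] by linarith
    qed
    hence "{x \<in> space ?P. \<not> (\<forall>k<d. \<bar>normalized d x k\<bar> \<le> 2 * R / (?m * sqrt d))} = {}" by blast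
    hence "measure ?P {x \<in> space ?P. \<not> (\<forall>k<d. \<bar>normalized d x k\<bar> \<le> 2 * R / (?m * sqrt d))} = 0"
      by (simp only: measure_empty)
    also have "0 \<le> (2 + d * gauss_moment 0) * exp (- R\<^sup>2 / 4)"
      by (intro mult_nonneg_nonneg add_nonneg_nonneg gauss_moment_nonneg) auto
    finally show ?thesis .
  next
    case False
    let ?A = "{x \<in> space ?P. 1 * (?m * sqrt d / 2) / sqrt d
      \<le> \<bar>(\<Sum>k<d. min ((x k)\<^sup>2) 1) / d - (\<Sum>k<d. \<integral>z. min (z\<^sup>2) 1 \<partial>std_normal) / d\<bar>}"
    let ?C = "\<lambda>k. {x \<in> space ?P. R < \<bar>x k\<bar>}"
    have tm: "(\<lambda>z. min (z\<^sup>2) 1 :: real) \<in> borel_measurable std_normal" by measurable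
    have tm': "Measurable.pred std_normal (\<lambda>z. R < \<bar>z\<bar>)" by measurable
    have co[measurable]: "(\<lambda>x. x k) \<in> borel_measurable ?P" if "k < d" for k
      by (rule measurable_gauss_coordinate[OF that])
    have sub: "{x \<in> space ?P. \<not> (\<forall>k<d. \<bar>normalized d x k\<bar> \<le> 2 * R / (?m * sqrt d))} \<subseteq> ?A \<union> (\<Union>k<d. ?C k)"
    proof
      fix x assume x: "x \<in> {x \<in> space ?P. \<not> (\<forall>k<d. \<bar>normalized d x k\<bar> \<le> 2 * R / (?m * sqrt d))}"
      show "x \<in> ?A \<union> (\<Union>k<d. ?C k)"
      proof (rule ccontr)
        assume n: "x \<notin> ?A \<union> (\<Union>k<d. ?C k)"
        hence c: "\<bar>x k\<bar> \<le> R" if "k < d" for k using x that by (auto simp: not_less)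
        have "\<bar>(\<Sum>k<d. min ((x k)\<^sup>2) 1) / d - ?m\<bar> < ?m / 2"
          using n x d0 by (simp add: trunc_moment_def[symmetric])
        hence "?m / 2 \<le> (\<Sum>k<d. min ((x k)\<^sup>2) 1) / d" by linarith
        hence "?m / 2 * d \<le> (\<Sum>k<d. min ((x k)\<^sup>2) 1)" using d0 by (simp add: field_simps)
        also have "\<dots> \<le> (vnorm d x)\<^sup>2" unfolding vnorm_square by (rule sum_mono) auto
        finally have v2: "?m / 2 * d \<le> (vnorm d x)\<^sup>2" .
        have "(?m * sqrt d / 2)\<^sup>2 = ?m * ?m * d / 4" using d0 by (simp add: power_mult_distrib power_divide power2_eq_square)
        also have "\<dots> \<le> ?m * 1 * d / 4" using m d0 by (intro divide_right_mono mult_right_mono mult_left_mono) auto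
        also have "\<dots> \<le> ?m / 2 * d" using m d0 by simp
        also note v2
        finally have v: "?m * sqrt d / 2 \<le> vnorm d x" using vnorm_nonneg by (rule power2_le_imp_le)
        have "\<bar>normalized d x k\<bar> \<le> 2 * R / (?m * sqrt d)" if k: "k < d" for k
        proof -
          have "\<bar>normalized d x k\<bar> = \<bar>x k\<bar> / vnorm d x"
            using k vnorm_nonneg[of d x] by (simp add: normalized_def abs_divide)
          also have "\<dots> \<le> R / (?m * sqrt d / 2)"
            using c[OF k] v m d0 R by (intro frac_le) auto
          finally show ?thesis by (simp add: mult.commute)
        qed
        thus False using x by blast
      qed
    qed
    have "measure ?P {x \<in> space ?P. \<not> (\<forall>k<d. \<bar>normalized d x k\<bar> \<le> 2 * R / (?m * sqrt d))}
        \<le> measure ?P (?A \<union> (\<Union>k<d. ?C k))"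
      by (rule gauss_vec.finite_measure_mono[OF sub]) measurable
    also have "\<dots> \<le> measure ?P ?A + measure ?P (\<Union>k<d. ?C k)"
      by (rule measure_Un_le) measurable
    also have "measure ?P ?A \<le> 2 * exp (- (?m * sqrt d / 2)\<^sup>2 / 2)"
    proof -
      have "\<bar>min (z\<^sup>2) 1\<bar> \<le> 1" for z :: real by (simp add: min_def)
      with tm show ?thesis
        unfolding gauss_vec_def by (intro Hoeffding_PiM) (use d m in \<open>auto simp: prob_space_std_normal\<close>)
    qed
    also have "\<dots> \<le> 2 * exp (- R\<^sup>2 / 4)"
      using False d0 by (simp add: power_mult_distrib power_divide mult_ac)
    also have "measure ?P (\<Union>k<d. ?C k) \<le> (\<Sum>k<d. measure ?P (?C k))"
      by (rule measure_UNION_le) auto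
    also have "\<dots> = (\<Sum>k<d. measure std_normal {z \<in> space std_normal. R < \<bar>z\<bar>})"
      unfolding gauss_vec_def
      by (intro sum.cong refl measure_PiM_component[where M = "\<lambda>_. std_normal"]) (use tm' in \<open>auto simp: prob_space_std_normal\<close>)
    also have "\<dots> \<le> (\<Sum>k<d. gauss_moment 0 * exp (- R\<^sup>2 / 4))"
      by (rule sum_mono) (use gauss_tail_prob[of R] R in auto)
    finally show ?thesis by (simp add: algebra_simps)
  qed
qed

section \<open>Random feature representation\<close>

lemma integrable_lborel_bounded_support:
  fixes f :: "real \<Rightarrow> real"
  assumes [measurable]: "f \<in> borel_measurable borel" and b: "\<And>x. \<bar>f x\<bar> \<le> M * indicator {a..c} x"
  shows "integrable lborel f"
proof (rule Bochner_Integration.integrable_bound)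
  show "integrable lborel (\<lambda>x. M * indicator {a..c} x :: real)"
    by (intro integrable_mult_right integrable_real_indicator) (auto simp: emeasure_lborel_Icc_eq)
  show "AE x in lborel. norm (f x) \<le> norm (M * indicator {a..c} x)"
    unfolding real_norm_def by (rule AE_I2) (rule order_trans[OF b abs_ge_self])
qed simp

text \<open>The second derivative of the target is measurable and locally bounded but possibly
  discontinuous. The gauge integral provides the fundamental theorem for such derivatives, and
  boundedness turns it into a Lebesgue integral.\<close>

lemma integral_lborel_FTC:
  fixes F f :: "real \<Rightarrow> real"
  assumes ac: "a \<le> c" and D: "\<And>x. a \<le> x \<Longrightarrow> x \<le> c \<Longrightarrow> (F has_real_derivative f x) (at x)"
    and [measurable]: "f \<in> borel_measurable borel" and b: "\<And>x. a \<le> x \<Longrightarrow> x \<le> c \<Longrightarrow> \<bar>f x\<bar> \<le> M"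
  shows "(\<integral>x. f x * indicator {a..c} x \<partial>lborel) = F c - F a"
proof -
  have "(f has_integral (F c - F a)) {a..c}"
    by (rule fundamental_theorem_of_calculus[OF ac])
       (simp add: has_real_derivative_iff_has_vector_derivative[symmetric] has_field_derivative_at_within D)
  hence "((\<lambda>x. if x \<in> {a..c} then f x else 0) has_integral (F c - F a)) UNIV"
    by (simp only: has_integral_restrict_UNIV)
  also have "(\<lambda>x. if x \<in> {a..c} then f x else 0) = (\<lambda>x. f x * indicator {a..c} x)"
    by (auto simp: fun_eq_iff)
  finally have 1: "((\<lambda>x. f x * indicator {a..c} x) has_integral (F c - F a)) UNIV" .
  have "integrable lborel (\<lambda>x. f x * indicator {a..c} x)"
    by (rule integrable_lborel_bounded_support[of _ M a c]) (use b in \<open>auto simp: indicator_def\<close>)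
  from has_integral_unique[OF has_integral_integral_lborel[OF this] 1] show ?thesis .
qed

lemma relu_measurable[measurable]: "relu \<in> borel_measurable borel"
  unfolding relu_def by measurable

text \<open>Taylor's formula with integral remainder: on [max s 0, 1], where the unit is active,
  \<open>h' x * (x - s) - h x\<close> is a primitive of \<open>h'' x * (x - s)\<close>.\<close>

lemma relu_Taylor:
  fixes h h' h'' :: "real \<Rightarrow> real"
  assumes D: "\<And>x. (h has_real_derivative h' x) (at x)" "\<And>x. (h' has_real_derivative h'' x) (at x)"
    and [measurable]: "h'' \<in> borel_measurable borel" and b: "\<And>x. \<bar>x\<bar> \<le> 1 \<Longrightarrow> \<bar>h'' x\<bar> \<le> M" and s: "\<bar>s\<bar> \<le> 1"
  shows "(\<integral>x. (h'' x * relu (x - s)) * indicator {0<..1} x \<partial>lborel)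
    = h' 1 * (1 - s) - h 1 - (h' (max s 0) * (max s 0 - s) - h (max s 0))"
proof -
  let ?lo = "max s 0"
  have M0: "M \<ge> 0" using b[of 0] by simp
  have "(\<integral>x. (h'' x * relu (x - s)) * indicator {0<..1} x \<partial>lborel)
      = (\<integral>x. (h'' x * (x - s)) * indicator {?lo..1} x \<partial>lborel)"
  proof (rule integral_cong_AE)
    have "AE x in lborel. x \<noteq> (0::real)" by (rule AE_lborel_singleton)
    thus "AE x in lborel. h'' x * relu (x - s) * indicator {0<..1} x = h'' x * (x - s) * indicator {?lo..1} x"
      by eventually_elim (auto simp: indicator_def relu_def max_def split: if_splits)
  qed measurable
  also have "\<dots> = (h' 1 * (1 - s) - h 1) - (h' ?lo * (?lo - s) - h ?lo)"
  proof (rule integral_lborel_FTC[where F = "\<lambda>x. h' x * (x - s) - h x"])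
    show "?lo \<le> 1" using s by auto
    fix x assume x: "?lo \<le> x" "x \<le> 1"
    show "((\<lambda>x. h' x * (x - s) - h x) has_real_derivative h'' x * (x - s)) (at x)"
      by (auto intro!: derivative_eq_intros D)
    have "\<bar>h'' x * (x - s)\<bar> \<le> M * 2"
      unfolding abs_mult using x s M0 by (intro mult_mono b) auto
    thus "\<bar>h'' x * (x - s)\<bar> \<le> M * 2" .
  qed measurable
  finally show ?thesis by simp
qed

text \<open>Units with bias above 1 are active for all \<open>s\<close> in [-1, 1], so their average
  is affine in \<open>s\<close>.\<close>

lemma relu_affine:
  assumes s: "\<bar>s\<bar> \<le> 1"
  shows "(\<integral>x. relu (x - s) * indicator {1<..2} x \<partial>lborel) = 3 / 2 - s"
proof -
  have "(\<integral>x. relu (x - s) * indicator {1<..2} x \<partial>lborel) = (\<integral>x. (x - s) * indicator {1..2} x \<partial>lborel)"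
  proof (rule integral_cong_AE)
    have "AE x in lborel. x \<noteq> (1::real)" by (rule AE_lborel_singleton)
    thus "AE x in lborel. relu (x - s) * indicator {1<..2} x = (x - s) * indicator {1..2} x"
      by eventually_elim (use s in \<open>auto simp: indicator_def relu_def\<close>)
  qed measurable
  also have "\<dots> = (2 - s)\<^sup>2 / 2 - (1 - s)\<^sup>2 / 2"
  proof (rule integral_lborel_FTC[where F = "\<lambda>x. (x - s)\<^sup>2 / 2"])
    fix x :: real
    show "((\<lambda>x. (x - s)\<^sup>2 / 2) has_real_derivative x - s) (at x)"
      by (auto intro!: derivative_eq_intros)
    assume "1 \<le> x" "x \<le> 2" thus "\<bar>x - s\<bar> \<le> 3" using s by auto
  qed auto
  also have "\<dots> = 3 / 2 - s"
    by (simp add: power2_diff diff_divide_distrib add_divide_distrib)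
  finally show ?thesis .
qed

text \<open>The representation \<open>h s = \<integral> k\<^sub>+ b relu (b + s) + \<integral> k\<^sub>- b relu (b - s)\<close> on \<open>[-1, 1]\<close>: the kinks with
  \<open>0 < b \<le> 1\<close> produce \<open>h''\<close>, while the units with \<open>1 < b \<le> 2\<close> are affine on \<open>[-1, 1]\<close> and correct the
  affine remainder.\<close>

definition aff0 :: "(real \<Rightarrow> real) \<Rightarrow> (real \<Rightarrow> real) \<Rightarrow> real" where
  "aff0 h h' = h 1 + h (-1) - h 0 - h' 1 + h' (-1)"

definition aff1 :: "(real \<Rightarrow> real) \<Rightarrow> real" where
  "aff1 h' = h' 1 + h' (-1) - h' 0"

text \<open>The unit \<open>relu (\<sigma> * s + b)\<close> has its kink at
  \<open>s = - \<sigma> * b\<close>, hence the argument of \<open>h''\<close>. The divisors 3 and 2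
  come from \<open>relu_affine\<close>: adding
  \<open>(p / 3 + \<sigma> * q / 2) * (3 / 2 + \<sigma> * s)\<close> over both signs gives
  \<open>p + q * s\<close>.\<close>

definition kink :: "real \<Rightarrow> (real \<Rightarrow> real) \<Rightarrow> (real \<Rightarrow> real) \<Rightarrow> (real \<Rightarrow> real) \<Rightarrow> real \<Rightarrow> real" where
  "kink \<sigma> h h' h'' b = h'' (- \<sigma> * b) * indicator {0<..1} b
     + (aff0 h h' / 3 + \<sigma> * aff1 h' / 2) * indicator {1<..2} b"

lemma kink_bound:
  assumes "\<And>x. \<bar>x\<bar> \<le> 1 \<Longrightarrow> \<bar>h x\<bar> \<le> M" "\<And>x. \<bar>x\<bar> \<le> 1 \<Longrightarrow> \<bar>h' x\<bar> \<le> M" "\<And>x. \<bar>x\<bar> \<le> 1 \<Longrightarrow> \<bar>h'' x\<bar> \<le> M"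
    and "\<bar>\<sigma>\<bar> = 1"
  shows "\<bar>kink \<sigma> h h' h'' b\<bar> \<le> 5 * M * indicator {0<..2} b"
proof -
  have M: "0 \<le> M" using assms(1)[of 0] by simp
  have "\<bar>aff0 h h'\<bar> \<le> 5 * M"
    using assms(1)[of 1] assms(1)[of "-1"] assms(1)[of 0] assms(2)[of 1] assms(2)[of "-1"]
    by (simp add: aff0_def abs_le_iff)
  moreover have "\<bar>\<sigma> * aff1 h'\<bar> \<le> 3 * M"
    using assms(2)[of 1] assms(2)[of "-1"] assms(2)[of 0] assms(4) by (simp add: aff1_def abs_mult abs_le_iff)
  ultimately have a: "\<bar>aff0 h h' / 3 + \<sigma> * aff1 h' / 2\<bar> \<le> 5 * M" using M by (simp add: abs_le_iff) 
  have "\<bar>h'' (- \<sigma> * b)\<bar> \<le> 5 * M" if "0 < b" "b \<le> 1"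
    using assms(3)[of "- \<sigma> * b"] assms(4) that M by (simp add: abs_mult)
  thus ?thesis using a by (auto simp: kink_def indicator_def)
qed

lemma kink_measurable[measurable]:
  assumes [measurable]: "h'' \<in> borel_measurable borel"
  shows "kink \<sigma> h h' h'' \<in> borel_measurable borel"
  unfolding kink_def by measurable

lemma relu_representation:
  fixes h h' h'' :: "real \<Rightarrow> real"
  assumes D: "\<And>x. (h has_real_derivative h' x) (at x)" "\<And>x. (h' has_real_derivative h'' x) (at x)"
    and m[measurable]: "h'' \<in> borel_measurable borel" and b: "\<And>x. \<bar>x\<bar> \<le> 1 \<Longrightarrow> \<bar>h'' x\<bar> \<le> M" and s: "\<bar>s\<bar> \<le> 1"
  shows "(\<integral>x. kink 1 h h' h'' x * relu (s + x) \<partial>lborel) + (\<integral>x. kink (-1) h h' h'' x * relu (- s + x) \<partial>lborel) = h s"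
proof -
  have M0: "M \<ge> 0" using b[of 0] by simp
  have ie: "(\<integral>x. kink \<sigma> h h' h'' x * relu (\<sigma> * s + x) \<partial>lborel)
      = (\<integral>x. (h'' (- \<sigma> * x) * relu (x - (- \<sigma> * s))) * indicator {0<..1} x \<partial>lborel)
        + (aff0 h h' / 3 + \<sigma> * aff1 h' / 2) * (3 / 2 + \<sigma> * s)" if \<sigma>: "\<bar>\<sigma>\<bar> = 1" for \<sigma>
  proof -
    have \<sigma>s: "\<bar>- \<sigma> * s\<bar> \<le> 1" using s \<sigma> by (simp add: abs_mult)
    have "(\<integral>x. kink \<sigma> h h' h'' x * relu (\<sigma> * s + x) \<partial>lborel)
      = (\<integral>x. (h'' (- \<sigma> * x) * relu (x - (- \<sigma> * s))) * indicator {0<..1} x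
          + (aff0 h h' / 3 + \<sigma> * aff1 h' / 2) * (relu (x - (- \<sigma> * s)) * indicator {1<..2} x) \<partial>lborel)"
      by (intro Bochner_Integration.integral_cong refl) (simp add: kink_def algebra_simps)
    also have "\<dots> = (\<integral>x. (h'' (- \<sigma> * x) * relu (x - (- \<sigma> * s))) * indicator {0<..1} x \<partial>lborel)
          + (\<integral>x. (aff0 h h' / 3 + \<sigma> * aff1 h' / 2) * (relu (x - (- \<sigma> * s)) * indicator {1<..2} x) \<partial>lborel)"
    proof (rule Bochner_Integration.integral_add)
      show "integrable lborel (\<lambda>x. (h'' (- \<sigma> * x) * relu (x - (- \<sigma> * s))) * indicator {0<..1} x)"
      proof (rule integrable_lborel_bounded_support[of _ "M * 2" 0 1])
        fix x
        show "\<bar>h'' (- \<sigma> * x) * relu (x - - \<sigma> * s) * indicator {0<..1} x\<bar> \<le> M * 2 * indicator {0..1} x"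
        proof (cases "0 < x \<and> x \<le> 1")
          case True
          have "\<bar>h'' (- \<sigma> * x)\<bar> \<le> M" using True \<sigma> by (intro b) (simp add: abs_mult)
          moreover have "\<bar>relu (x - - \<sigma> * s)\<bar> \<le> 2" using True \<sigma>s by (auto simp: relu_def)
          ultimately have "\<bar>h'' (- \<sigma> * x)\<bar> * \<bar>relu (x - - \<sigma> * s)\<bar> \<le> M * 2" using M0 by (intro mult_mono) auto
          thus ?thesis using True by (simp add: abs_mult)
        qed (use M0 in auto)
      qed measurable
      show "integrable lborel (\<lambda>x. (aff0 h h' / 3 + \<sigma> * aff1 h' / 2) * (relu (x - - \<sigma> * s) * indicator {1<..2} x))"
      proof (intro integrable_mult_right integrable_lborel_bounded_support[of _ 3 1 2])
        fix x show "\<bar>relu (x - - \<sigma> * s) * indicator {1<..2} x\<bar> \<le> 3 * indicator {1..2} x"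
          using \<sigma>s by (auto simp: relu_def indicator_def)
      qed measurable
    qed
    also have "(\<integral>x. (aff0 h h' / 3 + \<sigma> * aff1 h' / 2) * (relu (x - (- \<sigma> * s)) * indicator {1<..2} x) \<partial>lborel)
        = (aff0 h h' / 3 + \<sigma> * aff1 h' / 2) * (3 / 2 + \<sigma> * s)"
      using relu_affine[OF \<sigma>s] by simp
    finally show ?thesis .
  qed
  have plus: "(\<integral>x. (h'' (- x) * relu (x - (- s))) * indicator {0<..1} x \<partial>lborel)
      = (- h' (- 1)) * (1 - (- s)) - h (- 1) - ((- h' (- max (- s) 0)) * (max (- s) 0 - (- s)) - h (- max (- s) 0))"
  proof (rule relu_Taylor[where h = "\<lambda>x. h (- x)" and h' = "\<lambda>x. - h' (- x)" and M = M])
    fix x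
    show "((\<lambda>x. h (- x)) has_real_derivative - h' (- x)) (at x)"
      by (rule DERIV_cong[OF DERIV_chain2[OF D(1)]]) (auto intro!: derivative_eq_intros)
    show "((\<lambda>x. - h' (- x)) has_real_derivative h'' (- x)) (at x)"
      by (rule DERIV_cong[OF DERIV_minus[OF DERIV_chain2[OF D(2)]]]) (auto intro!: derivative_eq_intros)
  qed (use b s in auto)
  have minus: "(\<integral>x. (h'' x * relu (x - s)) * indicator {0<..1} x \<partial>lborel)
    = h' 1 * (1 - s) - h 1 - (h' (max s 0) * (max s 0 - s) - h (max s 0))"
    by (rule relu_Taylor[OF D m b s])
  have "(\<integral>x. kink 1 h h' h'' x * relu (s + x) \<partial>lborel) + (\<integral>x. kink (-1) h h' h'' x * relu (- s + x) \<partial>lborel)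
     = ((\<integral>x. (h'' (- x) * relu (x - (- s))) * indicator {0<..1} x \<partial>lborel)
        + (aff0 h h' / 3 + aff1 h' / 2) * (3 / 2 + s))
     + ((\<integral>x. (h'' x * relu (x - s)) * indicator {0<..1} x \<partial>lborel)
        + (aff0 h h' / 3 - aff1 h' / 2) * (3 / 2 - s))"
    using ie[of 1] ie[of "-1"] by simp
  also have "\<dots> = h s"
    \<comment> \<open>Only one of the two integrals has its lower limit at the kink, depending on
      the sign of \<open>s\<close>, and reproduces \<open>h s\<close>; the other is affine in
      \<open>s\<close>. What is left over is cancelled by
      \<open>aff0 h h' + aff1 h' * s\<close>.\<close>
    unfolding plus minus by (cases "s \<ge> 0") (auto simp: max_def aff0_def aff1_def field_simps)
  finally show ?thesis .
qed

text \<open>An importance weight: dividing by the Gaussian density turns the Lebesgue integral over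
  biases into an expectation, and the factor 2 compensates the probability 1 / 2 of each
  sign.\<close>

definition unit_coef :: "real \<Rightarrow> (real \<Rightarrow> real) \<Rightarrow> (real \<Rightarrow> real) \<Rightarrow> (real \<Rightarrow> real) \<Rightarrow> real \<Rightarrow> real" where
  "unit_coef \<sigma> h h' h'' b = 2 * kink \<sigma> h h' h'' b / std_normal_density b"

lemma unit_coef_measurable[measurable]:
  assumes [measurable]: "h'' \<in> borel_measurable borel"
  shows "unit_coef \<sigma> h h' h'' \<in> borel_measurable borel"
  unfolding unit_coef_def by measurable

text \<open>Ensures that the competitor puts no weight on the units that the first step leaves
  dead.\<close>

lemma unit_coef_nonpos: "b \<le> 0 \<Longrightarrow> unit_coef \<sigma> h h' h'' b = 0"
  by (simp add: unit_coef_def kink_def)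

text \<open>The compact support (0, 2] is what keeps the division by the density harmless: there the
  density is at least its value at 2.\<close>

lemma unit_coef_bound:
  assumes "\<And>x. \<bar>x\<bar> \<le> 1 \<Longrightarrow> \<bar>h x\<bar> \<le> M" "\<And>x. \<bar>x\<bar> \<le> 1 \<Longrightarrow> \<bar>h' x\<bar> \<le> M" "\<And>x. \<bar>x\<bar> \<le> 1 \<Longrightarrow> \<bar>h'' x\<bar> \<le> M"
    and "\<bar>\<sigma>\<bar> = 1"
  shows "\<bar>unit_coef \<sigma> h h' h'' b\<bar> \<le> 10 * M / std_normal_density 2 * indicator {0<..2} b"
proof (cases "0 < b \<and> b \<le> 2")
  case True
  have M: "0 \<le> M" using assms(1)[of 0] by simp
  have "b\<^sup>2 \<le> 2\<^sup>2" using True by (intro power_mono) auto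
  hence "exp (- 2\<^sup>2 / 2) \<le> exp (- b\<^sup>2 / (2::real))" by simp
  hence le: "std_normal_density 2 \<le> std_normal_density b"
    unfolding std_normal_density_def by (intro mult_left_mono) auto
  have "\<bar>unit_coef \<sigma> h h' h'' b\<bar> = 2 * \<bar>kink \<sigma> h h' h'' b\<bar> / std_normal_density b"
    by (simp add: unit_coef_def abs_divide abs_mult)
  also have "\<dots> \<le> 2 * (5 * M) / std_normal_density 2"
    using kink_bound[OF assms, where b = b] True le M by (intro frac_le) (auto intro: normal_density_pos)
  finally show ?thesis using True by simp
next
  case False
  thus ?thesis using kink_bound[OF assms, where b = b] by (auto simp: unit_coef_def)
qed

lemma unit_coef_representation:
  fixes h h' h'' :: "real \<Rightarrow> real"
  assumes D: "\<And>x. (h has_real_derivative h' x) (at x)" "\<And>x. (h' has_real_derivative h'' x) (at x)"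
    and m[measurable]: "h'' \<in> borel_measurable borel" and b: "\<And>x. \<bar>x\<bar> \<le> 1 \<Longrightarrow> \<bar>h'' x\<bar> \<le> M" and s: "\<bar>s\<bar> \<le> 1"
  shows "((\<integral>x. unit_coef 1 h h' h'' x * relu (s + x) \<partial>std_normal)
    + (\<integral>x. unit_coef (-1) h h' h'' x * relu (- s + x) \<partial>std_normal)) / 2 = h s"
proof -
  have key: "(\<integral>x. unit_coef \<sigma> h h' h'' x * relu (t + x) \<partial>std_normal) = 2 * (\<integral>x. kink \<sigma> h h' h'' x * relu (t + x) \<partial>lborel)" for \<sigma> t
  proof -
    have "std_normal_density x \<noteq> 0" for x using normal_density_pos[of 1 0 x] by simp
    hence eq: "std_normal_density x * (unit_coef \<sigma> h h' h'' x * relu (t + x)) = 2 * (kink \<sigma> h h' h'' x * relu (t + x))" for x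
      by (simp add: unit_coef_def)
    have "(\<integral>x. unit_coef \<sigma> h h' h'' x * relu (t + x) \<partial>std_normal)
        = (\<integral>x. std_normal_density x * (unit_coef \<sigma> h h' h'' x * relu (t + x)) \<partial>lborel)"
      by (rule integral_std_normal) measurable
    thus ?thesis unfolding eq by (simp only: integral_mult_right_zero)
  qed
  show ?thesis unfolding key using relu_representation[OF D m b s] by simp
qed

section \<open>High-probability events\<close>

text \<open>Measurability is part of the notion, so that conjunctions, finite intersections and
  sections remain events.\<close>

definition whp :: "'a measure \<Rightarrow> real \<Rightarrow> ('a \<Rightarrow> bool) \<Rightarrow> bool" where
  "whp M q P \<longleftrightarrow> Measurable.pred M P \<and> measure M {x \<in> space M. \<not> P x} \<le> q"

lemma whpI: "Measurable.pred M P \<Longrightarrow> measure M {x \<in> space M. \<not> P x} \<le> q \<Longrightarrow> whp M q P"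
  by (simp add: whp_def)

lemma whp_pred: "whp M q P \<Longrightarrow> Measurable.pred M P"
  by (simp add: whp_def)

lemma whp_measure: "whp M q P \<Longrightarrow> measure M {x \<in> space M. \<not> P x} \<le> q"
  by (simp add: whp_def)

lemma whp_mono: "whp M q P \<Longrightarrow> q \<le> q' \<Longrightarrow> whp M q' P"
  by (auto simp: whp_def)

lemma whp_weaken:
  assumes "prob_space M" "whp M q P" "Measurable.pred M Q" "\<And>x. x \<in> space M \<Longrightarrow> P x \<Longrightarrow> Q x"
  shows "whp M q Q"
proof (rule whpI[OF assms(3)])
  interpret prob_space M by fact
  note [measurable] = whp_pred[OF assms(2)]
  have "measure M {x \<in> space M. \<not> Q x} \<le> measure M {x \<in> space M. \<not> P x}"
    by (rule finite_measure_mono) (use assms(4) in auto)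
  thus "measure M {x \<in> space M. \<not> Q x} \<le> q" using whp_measure[OF assms(2)] by linarith
qed

lemma whp_conj:
  assumes "prob_space M" "whp M q P" "whp M q' P'"
  shows "whp M (q + q') (\<lambda>x. P x \<and> P' x)"
proof (rule whpI)
  interpret prob_space M by fact
  note [measurable] = whp_pred[OF assms(2)] whp_pred[OF assms(3)]
  show "Measurable.pred M (\<lambda>x. P x \<and> P' x)" by measurable
  have "{x \<in> space M. \<not> (P x \<and> P' x)} = {x \<in> space M. \<not> P x} \<union> {x \<in> space M. \<not> P' x}" by auto
  hence "measure M {x \<in> space M. \<not> (P x \<and> P' x)} \<le> measure M {x \<in> space M. \<not> P x} + measure M {x \<in> space M. \<not> P' x}"
    by (simp add: measure_Un_le)
  thus "measure M {x \<in> space M. \<not> (P x \<and> P' x)} \<le> q + q'"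
    using whp_measure[OF assms(2)] whp_measure[OF assms(3)] by linarith
qed

lemma whp_Ball:
  fixes q :: real
  assumes "finite I" and P: "\<And>i. i \<in> I \<Longrightarrow> whp M q (P i)"
  shows "whp M (card I * q) (\<lambda>x. \<forall>i\<in>I. P i x)"
proof (rule whpI)
  have m: "\<And>i. i \<in> I \<Longrightarrow> Measurable.pred M (P i)" by (rule whp_pred[OF P])
  show "Measurable.pred M (\<lambda>x. \<forall>i\<in>I. P i x)"
    using assms(1) m by (intro pred_intros_finite) auto
  have s: "{x \<in> space M. \<not> P i x} \<in> sets M" if "i \<in> I" for i
    using m[OF that] by measurable
  have "{x \<in> space M. \<not> (\<forall>i\<in>I. P i x)} = (\<Union>i\<in>I. {x \<in> space M. \<not> P i x})" by auto
  hence "measure M {x \<in> space M. \<not> (\<forall>i\<in>I. P i x)} \<le> (\<Sum>i\<in>I. measure M {x \<in> space M. \<not> P i x})"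
    using measure_UNION_le[OF assms(1), of "\<lambda>i. {x \<in> space M. \<not> P i x}" M] s by simp
  also have "\<dots> \<le> (\<Sum>i\<in>I. q)" by (rule sum_mono) (rule whp_measure[OF P])
  finally show "measure M {x \<in> space M. \<not> (\<forall>i\<in>I. P i x)} \<le> card I * q" by simp
qed

lemma whp_fst:
  assumes "prob_space M" "prob_space N" "whp M q P"
  shows "whp (M \<Otimes>\<^sub>M N) q (\<lambda>z. P (fst z))"
proof (rule whpI)
  interpret M: prob_space M by fact
  interpret N: prob_space N by fact
  note [measurable] = whp_pred[OF assms(3)]
  show "Measurable.pred (M \<Otimes>\<^sub>M N) (\<lambda>z. P (fst z))" by measurable
  have "{z \<in> space (M \<Otimes>\<^sub>M N). \<not> P (fst z)} = {x \<in> space M. \<not> P x} \<times> space N"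
    by (auto simp: space_pair_measure)
  hence "emeasure (M \<Otimes>\<^sub>M N) {z \<in> space (M \<Otimes>\<^sub>M N). \<not> P (fst z)} = emeasure M {x \<in> space M. \<not> P x}"
    by (simp add: N.emeasure_pair_measure_Times N.emeasure_space_1)
  thus "measure (M \<Otimes>\<^sub>M N) {z \<in> space (M \<Otimes>\<^sub>M N). \<not> P (fst z)} \<le> q"
    using whp_measure[OF assms(3)] by (simp add: measure_def)
qed

text \<open>A conditional bound that is uniform in the first component integrates to the same bound,
  by Fubini.\<close>

lemma whp_pair:
  assumes "prob_space M" "prob_space N" and m[measurable]: "Measurable.pred (M \<Otimes>\<^sub>M N) P"
    and q: "\<And>x. x \<in> space M \<Longrightarrow> whp N q (\<lambda>y. P (x, y))"
  shows "whp (M \<Otimes>\<^sub>M N) q P"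
proof (rule whpI[OF m])
  interpret M: prob_space M by fact
  interpret N: prob_space N by fact
  interpret P: pair_prob_space M N ..
  have q0: "0 \<le> q" using M.not_empty q whp_measure measure_nonneg by (metis ex_in_conv order_trans)
  let ?X = "{z \<in> space (M \<Otimes>\<^sub>M N). \<not> P z}"
  have "emeasure (M \<Otimes>\<^sub>M N) ?X = (\<integral>\<^sup>+x. emeasure N (Pair x -` ?X) \<partial>M)"
    by (rule N.emeasure_pair_measure_alt) measurable
  also have "\<dots> \<le> (\<integral>\<^sup>+x. ennreal q \<partial>M)"
  proof (rule nn_integral_mono)
    fix x assume x: "x \<in> space M"
    have "Pair x -` ?X = {y \<in> space N. \<not> P (x, y)}" using x by (auto simp: space_pair_measure)
    thus "emeasure N (Pair x -` ?X) \<le> ennreal q"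
      using whp_measure[OF q[OF x]] by (simp add: N.emeasure_eq_measure ennreal_leI)
  qed
  also have "\<dots> = ennreal q" by (simp add: M.emeasure_space_1)
  finally show "measure (M \<Otimes>\<^sub>M N) ?X \<le> q"
    using q0 by (simp add: P.emeasure_eq_measure)
qed

lemma whp_PiM_component:
  assumes "\<And>i. i \<in> I \<Longrightarrow> prob_space (M i)" "i \<in> I" "whp (M i) q P"
  shows "whp (PiM I M) q (\<lambda>x. P (x i))"
proof (rule whpI)
  note [measurable] = whp_pred[OF assms(3)]
  have [measurable]: "(\<lambda>x. x i) \<in> measurable (PiM I M) (M i)" using assms(2) by (rule measurable_component_singleton)
  show "Measurable.pred (PiM I M) (\<lambda>x. P (x i))" by measurable
  have "measure (PiM I M) {\<omega> \<in> space (PiM I M). \<not> P (\<omega> i)} = measure (M i) {x \<in> space (M i). \<not> P x}"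
    by (rule measure_PiM_component[where P = "\<lambda>x. \<not> P x"]) (use assms in auto)
  thus "measure (PiM I M) {x \<in> space (PiM I M). \<not> P (x i)} \<le> q"
    using whp_measure[OF assms(3)] by simp
qed

section \<open>Concentration for datasets and for the rows of the first layer\<close>

lemma exp_square_half_le: "exp (- R\<^sup>2 / 2) \<le> exp (- (R::real)\<^sup>2 / 4)"
  by simp

text \<open>The exponent is weakened from 1/2 to 1/4 to match the Gaussian tail bounds, so that all
  failure probabilities share the factor \<open>exp (- R\<^sup>2 / 4)\<close>.\<close>

lemma whp_Hoeffding:
  fixes f :: "nat \<Rightarrow> 'a \<Rightarrow> real" and n :: nat
  assumes M: "\<And>i. i < n \<Longrightarrow> prob_space (M i)"
    and f: "\<And>i. i < n \<Longrightarrow> f i \<in> borel_measurable (M i)"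
    and bd: "\<And>i x. i < n \<Longrightarrow> x \<in> space (M i) \<Longrightarrow> \<bar>f i x\<bar> \<le> b"
    and "b > 0" "n \<ge> 1" "R \<ge> 0"
  shows "whp (PiM {..<n} M) (2 * exp (- R\<^sup>2 / 4))
    (\<lambda>D. \<bar>(\<Sum>i<n. f i (D i)) / n - (\<Sum>i<n. integral\<^sup>L (M i) (f i)) / n\<bar> \<le> b * R / sqrt n)"
proof (rule whpI)
  let ?P = "PiM {..<n} M"
  interpret prob_space ?P by (rule prob_space_PiM) (use M in auto)
  have [measurable]: "(\<lambda>D. f i (D i)) \<in> borel_measurable ?P" if "i < n" for i
  proof -
    have "(\<lambda>D. D i) \<in> measurable ?P (M i)" using that by (intro measurable_component_singleton) simp
    thus ?thesis by (rule measurable_compose[OF _ f[OF that]])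
  qed
  have [measurable]: "(\<lambda>D. (\<Sum>i<n. f i (D i)) / n) \<in> borel_measurable ?P"
    by (intro borel_measurable_divide borel_measurable_sum) auto
  show "Measurable.pred ?P (\<lambda>D. \<bar>(\<Sum>i<n. f i (D i)) / n - (\<Sum>i<n. integral\<^sup>L (M i) (f i)) / n\<bar> \<le> b * R / sqrt n)"
    by measurable
  have "measure ?P {D \<in> space ?P. \<not> \<bar>(\<Sum>i<n. f i (D i)) / n - (\<Sum>i<n. integral\<^sup>L (M i) (f i)) / n\<bar> \<le> b * R / sqrt n}
      \<le> measure ?P {D \<in> space ?P. b * R / sqrt n \<le> \<bar>(\<Sum>i<n. f i (D i)) / n - (\<Sum>i<n. integral\<^sup>L (M i) (f i)) / n\<bar>}"
    by (rule finite_measure_mono) auto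
  also have "\<dots> \<le> 2 * exp (- R\<^sup>2 / 2)" by (rule Hoeffding_PiM) (use assms in auto)
  also have "\<dots> \<le> 2 * exp (- R\<^sup>2 / 4)" using exp_square_half_le by simp
  finally show "measure ?P {D \<in> space ?P. \<not> \<bar>(\<Sum>i<n. f i (D i)) / n - (\<Sum>i<n. integral\<^sup>L (M i) (f i)) / n\<bar> \<le> b * R / sqrt n}
      \<le> 2 * exp (- R\<^sup>2 / 4)" .
qed

text \<open>Event form of \<open>truncated_mean_concentration\<close>, in which the bias condition
  is squared to avoid the root of the failure probability.\<close>

lemma whp_mean:
  fixes f :: "'a \<Rightarrow> real" and n :: nat and b c R K Mo :: real
  assumes M: "prob_space M" and f[measurable]: "f \<in> borel_measurable M"
    and bd: "\<And>x. x \<in> space M \<Longrightarrow> G x \<Longrightarrow> \<bar>f x\<bar> \<le> b" and G: "whp M (c * exp (- R\<^sup>2 / 4)) G" and c: "c \<ge> 1"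
    and int: "integrable M (\<lambda>x. (f x)\<^sup>2)" and mom: "(\<integral>x. (f x)\<^sup>2 \<partial>M) \<le> Mo"
    and b: "b > 0" and n: "n \<ge> 1" and R: "R \<ge> 0" and K: "K \<ge> 0"
    and bias: "c * exp (- R\<^sup>2 / 4) * (Mo + 1)\<^sup>2 \<le> K\<^sup>2 / n"
  shows "whp (PiM {..<n} (\<lambda>_. M)) ((2 + n * c) * exp (- R\<^sup>2 / 4))
    (\<lambda>D. \<bar>(\<Sum>i<n. f (D i)) / n - integral\<^sup>L M f\<bar> \<le> (b * R + K) / sqrt n)"
proof (rule whpI)
  let ?P = "PiM {..<n} (\<lambda>_. M)"
  interpret prob_space ?P by (rule prob_space_PiM) (rule M)
  note [measurable] = whp_pred[OF G]
  have [measurable]: "(\<lambda>D. (\<Sum>i<n. f (D i)) / n) \<in> borel_measurable ?P" by measurable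
  show "Measurable.pred ?P (\<lambda>D. \<bar>(\<Sum>i<n. f (D i)) / n - integral\<^sup>L M f\<bar> \<le> (b * R + K) / sqrt n)"
    by measurable
  let ?\<epsilon> = "c * exp (- R\<^sup>2 / 4)"
  have Mo: "Mo \<ge> 0" using mom by (rule order_trans[rotated]) (intro Bochner_Integration.integral_nonneg, auto)
  have n0: "real n > 0" using n by simp
  have "sqrt (?\<epsilon> * (Mo + 1)\<^sup>2) \<le> sqrt (K\<^sup>2 / n)" using bias by (rule real_sqrt_le_mono)
  hence "sqrt ?\<epsilon> * (Mo + 1) \<le> K / sqrt n" using Mo K by (simp add: real_sqrt_mult real_sqrt_divide)
  moreover have "0 \<le> sqrt ?\<epsilon> * (Mo + 1)" using Mo c by (intro mult_nonneg_nonneg) auto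
  ultimately have \<delta>: "sqrt ?\<epsilon> * (Mo + 1) / 2 \<le> K / sqrt n" by linarith
  have "measure ?P {D \<in> space ?P. \<not> \<bar>(\<Sum>i<n. f (D i)) / n - integral\<^sup>L M f\<bar> \<le> (b * R + K) / sqrt n}
      \<le> measure ?P {D \<in> space ?P. b * R / sqrt n + K / sqrt n \<le> \<bar>(\<Sum>i<n. f (D i)) / n - integral\<^sup>L M f\<bar>}"
    by (rule finite_measure_mono) (auto simp: add_divide_distrib)
  also have "\<dots> \<le> 2 * exp (- R\<^sup>2 / 2) + n * ?\<epsilon>"
    by (rule truncated_mean_concentration[where G = G and Mo = Mo])
       (use M bd whp_measure[OF G] c int mom b n R \<delta> in auto)
  also have "\<dots> \<le> 2 * exp (- R\<^sup>2 / 4) + n * ?\<epsilon>" using exp_square_half_le by simp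
  finally show "measure ?P {D \<in> space ?P. \<not> \<bar>(\<Sum>i<n. f (D i)) / n - integral\<^sup>L M f\<bar> \<le> (b * R + K) / sqrt n}
      \<le> (2 + n * c) * exp (- R\<^sup>2 / 4)" by (simp add: algebra_simps)
qed

lemma whp_dotp_le:
  assumes u: "(\<Sum>k<d. (u k)\<^sup>2) = 1" and R: "R \<ge> 0"
  shows "whp (gauss_vec d) (gauss_moment 0 * exp (- R\<^sup>2 / 4)) (\<lambda>x. \<bar>dotp d u x\<bar> \<le> R)"
proof (rule whpI)
  have "measure (gauss_vec d) {x \<in> space (gauss_vec d). R < \<bar>dotp d u x\<bar>} = measure std_normal {z. R < \<bar>z\<bar>}"
    by (rule measure_dotp[OF u]) measurable
  thus "measure (gauss_vec d) {x \<in> space (gauss_vec d). \<not> \<bar>dotp d u x\<bar> \<le> R} \<le> gauss_moment 0 * exp (- R\<^sup>2 / 4)"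
    using gauss_tail_prob[OF R] by (simp add: not_le)
qed measurable

lemma prob_space_dataset: "prob_space (dataset n d)"
  unfolding dataset_def by (rule prob_space_PiM) (rule prob_space_gauss_vec)

text \<open>One statement for all the empirical moments in use: target times coordinate, coordinate
  alone, and products of two coordinates. The second moment of the product is bounded by fourth
  moments of the factors, so independence of the two projections does not enter.\<close>

lemma whp_dataset_product:
  fixes G1 G2 :: "real \<Rightarrow> real" and n m :: nat and c C R :: real
  assumes u: "(\<Sum>k<d. (u k)\<^sup>2) = 1" and v: "(\<Sum>k<d. (v k)\<^sup>2) = 1"
    and [measurable]: "G1 \<in> borel_measurable borel" "G2 \<in> borel_measurable borel"
    and G1: "\<And>z. \<bar>G1 z\<bar> \<le> C * (1 + \<bar>z\<bar>) ^ m" and G2: "\<And>z. \<bar>G2 z\<bar> \<le> C * (1 + \<bar>z\<bar>) ^ m" and C: "C \<ge> 1"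
    and n: "n \<ge> 1" and R: "R \<ge> 1" and small: "exp (- R\<^sup>2 / 4) \<le> 1 / n"
  defines "c \<equiv> 2 * gauss_moment 0 + 1"
  shows "whp (dataset n d) ((2 + n * c) * exp (- R\<^sup>2 / 4))
    (\<lambda>D. \<bar>(\<Sum>s<n. G1 (dotp d u (D s)) * G2 (dotp d v (D s))) / n
        - (\<integral>x. G1 (dotp d u x) * G2 (dotp d v x) \<partial>gauss_vec d)\<bar>
      \<le> ((C * (2 * R) ^ m)\<^sup>2 * R + c * (2 * C ^ 4 * gauss_moment (4 * m) + 1)) / sqrt n)"
proof -
  let ?f = "\<lambda>x. G1 (dotp d u x) * G2 (dotp d v x)" and ?P = "gauss_vec d"
  have c1: "c \<ge> 1" using gauss_moment_nonneg by (simp add: c_def)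
  have q: "integrable ?P (\<lambda>x. (G (dotp d w x)) ^ 4)" "(\<integral>x. (G (dotp d w x)) ^ 4 \<partial>?P) \<le> C ^ 4 * gauss_moment (4 * m)"
    if w: "(\<Sum>k<d. (w k)\<^sup>2) = 1" and [measurable]: "G \<in> borel_measurable borel" and G: "\<And>z. \<bar>G z\<bar> \<le> C * (1 + \<bar>z\<bar>) ^ m"
    for G :: "real \<Rightarrow> real" and w
  proof -
    have b: "\<bar>(G z) ^ 4\<bar> \<le> C ^ 4 * (1 + \<bar>z\<bar>) ^ (4 * m)" for z
      using power_mono[OF G[of z], of 4] by (simp add: power_mult_distrib power_abs power_mult[symmetric] mult.commute)
    have "integrable std_normal (\<lambda>z. (G z) ^ 4)" by (rule integrable_std_normal_poly[OF _ b]) measurable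
    thus "integrable ?P (\<lambda>x. (G (dotp d w x)) ^ 4)" by (subst integrable_dotp[OF w, of "\<lambda>z. (G z) ^ 4"]) auto
    have "(\<integral>x. (G (dotp d w x)) ^ 4 \<partial>?P) = (\<integral>z. (G z) ^ 4 \<partial>std_normal)"
      by (rule integral_dotp[OF w]) measurable
    also have "\<dots> \<le> C ^ 4 * gauss_moment (4 * m)" by (rule integral_std_normal_poly_le[OF _ b]) measurable
    finally show "(\<integral>x. (G (dotp d w x)) ^ 4 \<partial>?P) \<le> C ^ 4 * gauss_moment (4 * m)" .
  qed
  note q1 = q[OF u _ G1] and q2 = q[OF v _ G2]
  have le: "(?f x)\<^sup>2 \<le> (G1 (dotp d u x)) ^ 4 + (G2 (dotp d v x)) ^ 4" for x
  proof -
    have "2 * p * q \<le> r \<Longrightarrow> 0 \<le> p * q \<Longrightarrow> p * q \<le> r" for p q r :: real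
      unfolding mult.assoc by linarith
    from this[OF sum_squares_bound[of "(G1 (dotp d u x))\<^sup>2" "(G2 (dotp d v x))\<^sup>2"]] show ?thesis
      by (simp add: power_mult_distrib power_mult[symmetric])
  qed
  have i4: "integrable ?P (\<lambda>x. (G1 (dotp d u x)) ^ 4 + (G2 (dotp d v x)) ^ 4)"
    using q1(1) q2(1) by (intro Bochner_Integration.integrable_add) auto
  have int: "integrable ?P (\<lambda>x. (?f x)\<^sup>2)"
  proof (rule Bochner_Integration.integrable_bound[OF i4])
    show "AE x in ?P. norm ((?f x)\<^sup>2) \<le> norm ((G1 (dotp d u x)) ^ 4 + (G2 (dotp d v x)) ^ 4)"
      unfolding real_norm_def using le by (intro AE_I2) (simp add: order_trans[OF _ abs_ge_self])
  qed measurable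
  have mom: "(\<integral>x. (?f x)\<^sup>2 \<partial>?P) \<le> 2 * C ^ 4 * gauss_moment (4 * m)"
  proof -
    have "(\<integral>x. (?f x)\<^sup>2 \<partial>?P) \<le> (\<integral>x. (G1 (dotp d u x)) ^ 4 + (G2 (dotp d v x)) ^ 4 \<partial>?P)"
      by (rule integral_mono[OF int i4 le])
    also have "\<dots> = (\<integral>x. (G1 (dotp d u x)) ^ 4 \<partial>?P) + (\<integral>x. (G2 (dotp d v x)) ^ 4 \<partial>?P)"
      using q1(1) q2(1) by (intro Bochner_Integration.integral_add) auto
    finally show ?thesis using q1(2) q2(2) by simp
  qed
  have tail: "whp ?P (c * exp (- R\<^sup>2 / 4)) (\<lambda>x. \<bar>dotp d u x\<bar> \<le> R \<and> \<bar>dotp d v x\<bar> \<le> R)"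
  proof (rule whp_mono)
    show "whp ?P (gauss_moment 0 * exp (- R\<^sup>2 / 4) + gauss_moment 0 * exp (- R\<^sup>2 / 4)) (\<lambda>x. \<bar>dotp d u x\<bar> \<le> R \<and> \<bar>dotp d v x\<bar> \<le> R)"
      by (intro whp_conj prob_space_gauss_vec whp_dotp_le u v) (use R in auto)
    show "gauss_moment 0 * exp (- R\<^sup>2 / 4) + gauss_moment 0 * exp (- R\<^sup>2 / 4) \<le> c * exp (- R\<^sup>2 / 4)"
      by (simp add: c_def algebra_simps)
  qed
  have Gb: "C * (1 + \<bar>z\<bar>) ^ m \<le> C * (2 * R) ^ m" if "\<bar>z\<bar> \<le> R" for z
    using that R C by (intro mult_left_mono power_mono) auto
  let ?Mo = "2 * C ^ 4 * gauss_moment (4 * m)"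
  have Mo0: "?Mo \<ge> 0" using C gauss_moment_nonneg by simp
  show ?thesis
    unfolding dataset_def
  proof (rule whp_mean[OF prob_space_gauss_vec _ _ tail c1 int mom])
    fix x assume "\<bar>dotp d u x\<bar> \<le> R \<and> \<bar>dotp d v x\<bar> \<le> R"
    hence "\<bar>G1 (dotp d u x)\<bar> \<le> C * (2 * R) ^ m" "\<bar>G2 (dotp d v x)\<bar> \<le> C * (2 * R) ^ m"
      using G1 G2 Gb by (meson order_trans)+
    thus "\<bar>?f x\<bar> \<le> (C * (2 * R) ^ m)\<^sup>2"
      unfolding abs_mult power2_eq_square by (intro mult_mono) auto
  next
    have "c * exp (- R\<^sup>2 / 4) * (?Mo + 1)\<^sup>2 \<le> c * (1 / n) * (?Mo + 1)\<^sup>2"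
      using c1 small by (intro mult_right_mono mult_left_mono) auto
    also have "\<dots> = c * (?Mo + 1)\<^sup>2 / n" by simp
    also have "\<dots> \<le> (c * (?Mo + 1))\<^sup>2 / n"
      using c1 by (intro divide_right_mono) (auto simp: power_mult_distrib power2_eq_square[of c] mult_right_mono)
    finally show "c * exp (- R\<^sup>2 / 4) * (?Mo + 1)\<^sup>2 \<le> (c * (?Mo + 1))\<^sup>2 / n" .
    show "(C * (2 * R) ^ m)\<^sup>2 > 0" using C R by (simp add: zero_less_power2) 
    show "c * (?Mo + 1) \<ge> 0" using c1 Mo0 by (intro mult_nonneg_nonneg) auto
  qed (use n R in auto)
qed

lemma pred_le_const:
  assumes [measurable]: "f \<in> borel_measurable M"
  shows "Measurable.pred M (\<lambda>x. f x \<le> (c :: real))"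
  by measurable

lemma whp_distr:
  assumes [measurable]: "T \<in> measurable M N" "Measurable.pred N P" and w: "whp M q (\<lambda>x. P (T x))"
  shows "whp (distr M N T) q P"
proof (rule whpI)
  show "Measurable.pred (distr M N T) P" by simp
  have "measure (distr M N T) {x \<in> space N. \<not> P x} = measure M (T -` {x \<in> space N. \<not> P x} \<inter> space M)"
    by (rule measure_distr) measurable
  also have "T -` {x \<in> space N. \<not> P x} \<inter> space M = {x \<in> space M. \<not> P (T x)}"
    using measurable_space[OF assms(1)] by auto
  finally show "measure (distr M N T) {x \<in> space (distr M N T). \<not> P x} \<le> q"
    using whp_measure[OF w] by simp
qed

text \<open>On the typical event the coordinates are of order R / sqrt d, so the rescaled product is
  of order R^2 whatever \<open>d\<close> is. For the bias only the crude second moment d^2 is used;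
  its square and the factor \<open>d\<close> in \<open>c\<close> produce the d^5 of the
  hypothesis.\<close>

lemma whp_sphere_cov:
  fixes m :: nat and c R :: real
  assumes d: "d \<ge> 1" and k: "k < d" and l: "l < d" and m: "m \<ge> 1" and R: "R \<ge> 1"
    and small: "real d ^ 5 * exp (- R\<^sup>2 / 4) \<le> 1 / m"
  defines "c \<equiv> 2 + d * gauss_moment 0"
  shows "whp (PiM {..<m} (\<lambda>_. sphere_unif d)) ((2 + m * c) * exp (- R\<^sup>2 / 4))
    (\<lambda>V. \<bar>real d / m * (\<Sum>j<m. V j k * V j l) - (if k = l then 1 else 0)\<bar>
      \<le> (4 * R\<^sup>2 / trunc_moment\<^sup>2 * R + 4 * (2 + gauss_moment 0)) / sqrt m)"
proof -
  let ?N = "PiM {..<d} (\<lambda>_. borel :: real measure)" and ?K = "4 * (2 + gauss_moment 0)"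
  let ?f = "\<lambda>v. real d * (v k * v l)" and ?r = "2 * R / (trunc_moment * sqrt d)"
  have d0: "real d \<ge> 1" using d by simp
  have c1: "c \<ge> 1" using gauss_moment_nonneg by (simp add: c_def)
  have kk[measurable]: "(\<lambda>v. v k) \<in> borel_measurable ?N" and ll[measurable]: "(\<lambda>v. v l) \<in> borel_measurable ?N"
    using k l by (auto intro: measurable_coordinate)
  have f[measurable]: "?f \<in> borel_measurable ?N"
    by (intro borel_measurable_times borel_measurable_const kk ll)
  have f': "?f \<in> borel_measurable (sphere_unif d)"
    unfolding measurable_cong_sets[OF sphere_unif_sets refl] by (rule f)
  have G: "whp (sphere_unif d) (c * exp (- R\<^sup>2 / 4)) (\<lambda>v. \<forall>k<d. \<bar>v k\<bar> \<le> ?r)"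
    unfolding sphere_unif_normalized
  proof (rule whp_distr)
    have p: "Measurable.pred ?N (\<lambda>v. \<forall>k\<in>{..<d}. \<bar>v k\<bar> \<le> ?r)"
    proof (rule pred_intros_finite(3)[rotated])
      fix k assume "k \<in> {..<d}"
      hence [measurable]: "(\<lambda>v. v k) \<in> borel_measurable ?N" by (auto intro: measurable_coordinate)
      show "Measurable.pred ?N (\<lambda>v. \<bar>v k\<bar> \<le> ?r)" by measurable
    qed simp
    thus p': "Measurable.pred ?N (\<lambda>v. \<forall>k<d. \<bar>v k\<bar> \<le> ?r)" by (simp add: Ball_def)
    show "whp (gauss_vec d) (c * exp (- R\<^sup>2 / 4)) (\<lambda>x. \<forall>k<d. \<bar>normalized d x k\<bar> \<le> ?r)"
      unfolding c_def
      by (rule whpI[OF measurable_compose[OF measurable_normalized p'] normalized_tail[OF d R]])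
  qed simp
  have I: "(\<integral>v. F v \<partial>sphere_unif d) = (\<integral>x. F (normalized d x) \<partial>gauss_vec d)"
    if "F \<in> borel_measurable ?N" for F :: "_ \<Rightarrow> real"
    unfolding sphere_unif_normalized by (rule integral_distr[OF measurable_normalized that])
  have sq[measurable]: "(\<lambda>v. (?f v)\<^sup>2) \<in> borel_measurable ?N" by (intro borel_measurable_power f)
  have fb: "\<bar>(?f (normalized d x))\<^sup>2\<bar> \<le> real d ^ 2" for x
  proof -
    have "\<bar>normalized d x k\<bar> * \<bar>normalized d x l\<bar> \<le> 1 * 1" by (intro mult_mono normalized_le_one k l) auto
    hence "\<bar>?f (normalized d x)\<bar> \<le> real d" by (simp add: abs_mult mult_left_le)
    from power_mono[OF this, of 2] show ?thesis by simp
  qed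
  have m2: "(\<lambda>x. (?f (normalized d x))\<^sup>2) \<in> borel_measurable (gauss_vec d)"
    by (rule measurable_compose[OF measurable_normalized sq])
  have i2: "integrable (gauss_vec d) (\<lambda>x. (?f (normalized d x))\<^sup>2)"
    by (rule gauss_vec.integrable_const_bound[OF _ m2]) (use fb in auto)
  have E: "integral\<^sup>L (sphere_unif d) ?f = (if k = l then 1 else 0)"
    unfolding I[OF f] using normalized_cov[OF d k l] d0 by simp
  have "whp (PiM {..<m} (\<lambda>_. sphere_unif d)) ((2 + m * c) * exp (- R\<^sup>2 / 4))
    (\<lambda>V. \<bar>(\<Sum>j<m. ?f (V j)) / m - integral\<^sup>L (sphere_unif d) ?f\<bar> \<le> (4 * R\<^sup>2 / trunc_moment\<^sup>2 * R + ?K) / sqrt m)"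
  proof (rule whp_mean[OF prob_space_sphere_unif f' _ G c1, where Mo = "real d ^ 2"])
    fix v assume v: "\<forall>k<d. \<bar>v k\<bar> \<le> ?r"
    have "\<bar>?f v\<bar> = d * (\<bar>v k\<bar> * \<bar>v l\<bar>)" by (simp add: abs_mult)
    also have "\<dots> \<le> d * (?r * ?r)" using v k l R trunc_moment by (intro mult_left_mono mult_mono) auto
    also have "\<dots> = 4 * R\<^sup>2 / trunc_moment\<^sup>2" using d0 by (simp add: power2_eq_square field_simps)
    finally show "\<bar>?f v\<bar> \<le> 4 * R\<^sup>2 / trunc_moment\<^sup>2" .
  next
    show "integrable (sphere_unif d) (\<lambda>v. (?f v)\<^sup>2)"
      unfolding sphere_unif_normalized using i2 by (subst integrable_distr_eq[OF measurable_normalized sq])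
    have "(\<integral>v. (?f v)\<^sup>2 \<partial>sphere_unif d) = (\<integral>x. (?f (normalized d x))\<^sup>2 \<partial>gauss_vec d)" by (rule I[OF sq])
    also have "\<dots> \<le> (\<integral>x. real d ^ 2 \<partial>gauss_vec d)"
      by (rule integral_mono[OF i2]) (use fb in \<open>auto intro: order_trans[OF abs_ge_self]\<close>)
    also have "\<dots> = real d ^ 2" by (simp add: gauss_vec.prob_space)
    finally show "(\<integral>v. (?f v)\<^sup>2 \<partial>sphere_unif d) \<le> real d ^ 2" .
    show "4 * R\<^sup>2 / trunc_moment\<^sup>2 > 0" using R trunc_moment by simp
    show K0: "0 \<le> ?K" using gauss_moment_nonneg by simp
    have "c * exp (- R\<^sup>2 / 4) * (real d ^ 2 + 1)\<^sup>2 \<le> ((2 + gauss_moment 0) * d) * exp (- R\<^sup>2 / 4) * (2 * real d ^ 2)\<^sup>2"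
    proof (intro mult_mono mult_right_mono power_mono)
      show "c \<le> (2 + gauss_moment 0) * d" using d0 by (simp add: c_def algebra_simps)
    qed (use d0 gauss_moment_nonneg in auto)
    also have "\<dots> = ?K * (real d ^ 5 * exp (- R\<^sup>2 / 4))" by (simp add: eval_nat_numeral)
    also have "\<dots> \<le> ?K * (1 / m)" using small K0 by (rule mult_left_mono)
    also have "\<dots> \<le> ?K\<^sup>2 / m"
    proof -
      have "1 \<le> ?K" using gauss_moment_nonneg[of 0] by simp
      hence "?K * 1 \<le> ?K * ?K" by (intro mult_left_mono) auto
      thus ?thesis by (simp add: power2_eq_square divide_right_mono)
    qed
    finally show "c * exp (- R\<^sup>2 / 4) * (real d ^ 2 + 1)\<^sup>2 \<le> ?K\<^sup>2 / m" .
  qed (use m R in auto)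
  moreover have "(\<Sum>j<m. ?f (V j)) / m = real d / m * (\<Sum>j<m. V j k * V j l)" for V
    by (simp add: sum_distrib_left sum_divide_distrib)
  ultimately show ?thesis unfolding E by simp
qed

section \<open>Random features from signs and biases\<close>

lemma prob_space_rademacher: "prob_space rademacher"
  by (simp add: rademacher_def prob_space_measure_pmf)

lemma rademacher_sets[measurable_cong, simp]: "sets rademacher = sets (count_space UNIV)"
  by (simp add: rademacher_def)

lemma integral_rademacher: "integral\<^sup>L rademacher f = (f 1 + f (-1)) / (2 :: real)"
  unfolding rademacher_def by (subst integral_pmf_of_set) (auto simp: add.commute)

lemma whp_rademacher: "whp rademacher 0 (\<lambda>a. \<bar>a\<bar> = 1)"
proof (rule whpI)
  have "AE a in rademacher. \<bar>a\<bar> = 1" unfolding rademacher_def by (auto simp: AE_measure_pmf_iff)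
  thus "measure rademacher {a \<in> space rademacher. \<not> \<bar>a\<bar> = 1} \<le> 0"
    using prob_space.prob_eq_0[OF prob_space_rademacher, of "{a \<in> space rademacher. \<not> \<bar>a\<bar> = 1}"]
    by (simp add: rademacher_def)
qed (simp add: rademacher_def)

text \<open>Defined by the sign of \<open>\<sigma>\<close> rather than by its value, so that it is
  bounded for every real \<open>\<sigma>\<close>: the space underlying \<open>rademacher\<close> is
  the whole line.\<close>

definition unit_fun :: "(real \<Rightarrow> real) \<Rightarrow> (real \<Rightarrow> real) \<Rightarrow> (real \<Rightarrow> real) \<Rightarrow> real \<Rightarrow> real \<Rightarrow> real \<Rightarrow> real" where
  "unit_fun h h' h'' s \<sigma> b
    = (if \<sigma> > 0 then unit_coef 1 h h' h'' b * relu (s + b) else unit_coef (-1) h h' h'' b * relu (- s + b))"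

lemma unit_fun_cell:
  assumes "\<bar>a i\<bar> = 1" shows "unit_fun h h' h'' s (a i) (b i) = unit_coef (a i) h h' h'' (b i) * cell a b i s"
proof -
  from assms have "a i = 1 \<or> a i = -1" by linarith
  thus ?thesis using unit_coef_nonpos[of "b i"] by (auto simp: unit_fun_def cell_def)
qed

text \<open>Signs and biases live in two separate product spaces, so Hoeffding is used twice: for
  the conditional means given the signs, and, with the signs frozen, for the biases. Each feature is
  at most \<open>10 * M / std_normal_density 2\<close> times 3, since the ReLU argument is at most
  3. The factor \<open>PV\<close> carries along the rest of the sample space.\<close>

lemma whp_units:
  fixes h h' h'' :: "real \<Rightarrow> real" and m :: nat and M R s :: real
  assumes D: "\<And>x. (h has_real_derivative h' x) (at x)" "\<And>x. (h' has_real_derivative h'' x) (at x)"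
    and mh[measurable]: "h'' \<in> borel_measurable borel"
    and b0: "\<And>x. \<bar>x\<bar> \<le> 1 \<Longrightarrow> \<bar>h x\<bar> \<le> M" and b1: "\<And>x. \<bar>x\<bar> \<le> 1 \<Longrightarrow> \<bar>h' x\<bar> \<le> M"
    and b2: "\<And>x. \<bar>x\<bar> \<le> 1 \<Longrightarrow> \<bar>h'' x\<bar> \<le> M" and M: "M > 0"
    and s: "\<bar>s\<bar> \<le> 1" and m: "m \<ge> 1" and R: "R \<ge> 1" and PV: "prob_space PV"
  shows "whp (PiM {..<m} (\<lambda>_. rademacher) \<Otimes>\<^sub>M PiM {..<m} (\<lambda>_. std_normal) \<Otimes>\<^sub>M PV) (4 * exp (- R\<^sup>2 / 4))
    (\<lambda>\<omega>. \<bar>(\<Sum>i<m. unit_fun h h' h'' s (fst \<omega> i) (fst (snd \<omega>) i)) / m - h s\<bar>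
       \<le> 2 * (30 * M / std_normal_density 2) * R / sqrt m)"
proof -
  let ?f = "unit_fun h h' h'' s" and ?b = "30 * M / std_normal_density 2"
  let ?PA = "PiM {..<m} (\<lambda>_. rademacher)" and ?PB = "PiM {..<m} (\<lambda>_. std_normal)"
  define \<mu> where "\<mu> \<sigma> = (\<integral>b. ?f \<sigma> b \<partial>std_normal)" for \<sigma>
  have bp: "?b > 0" using M by (simp add: normal_density_pos)
  have fm[measurable]: "?f \<sigma> \<in> borel_measurable borel" for \<sigma>
    unfolding unit_fun_def by (cases "\<sigma> > 0") (simp_all, measurable)
  have fb: "\<bar>?f \<sigma> b\<bar> \<le> ?b" for \<sigma> b
  proof -
    have "\<bar>unit_coef \<sigma>' h h' h'' b * relu (t + b)\<bar> \<le> ?b" if "\<bar>\<sigma>'\<bar> = 1" "\<bar>t\<bar> \<le> 1" for \<sigma>' t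
    proof (cases "0 < b \<and> b \<le> 2")
      case True
      have "\<bar>unit_coef \<sigma>' h h' h'' b\<bar> \<le> 10 * M / std_normal_density 2"
        using unit_coef_bound[OF b0 b1 b2 that(1), where b = b] True by simp
      moreover have "\<bar>relu (t + b)\<bar> \<le> 3" using True that by (auto simp: relu_def)
      ultimately have "\<bar>unit_coef \<sigma>' h h' h'' b\<bar> * \<bar>relu (t + b)\<bar> \<le> 10 * M / std_normal_density 2 * 3"
        using M by (intro mult_mono) (auto simp: normal_density_nonneg)
      thus ?thesis by (simp add: abs_mult)
    next
      case False
      hence "unit_coef \<sigma>' h h' h'' b = 0" using unit_coef_bound[OF b0 b1 b2 that(1), where b = b] by auto
      thus ?thesis using bp by simp
    qed
    from this[of 1 s] this[of "-1" "- s"] show ?thesis using s by (auto simp: unit_fun_def)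
  qed
  have \<mu>b: "\<bar>\<mu> \<sigma>\<bar> \<le> ?b" for \<sigma>
  proof -
    have "\<bar>\<mu> \<sigma>\<bar> \<le> (\<integral>b. \<bar>?f \<sigma> b\<bar> \<partial>std_normal)" unfolding \<mu>_def by (rule integral_abs_bound)
    also have "\<dots> \<le> (\<integral>b. ?b \<partial>std_normal)"
      by (rule integral_mono) (use fb in \<open>auto intro!: std_normal.integrable_const_bound[of _ ?b] AE_I2\<close>)
    also have "\<dots> = ?b" using std_normal.prob_space by simp
    finally show ?thesis .
  qed
  have E: "integral\<^sup>L rademacher \<mu> = h s"
    unfolding integral_rademacher \<mu>_def
    using unit_coef_representation[OF D mh b2 s] by (simp add: unit_fun_def[abs_def])
  have PA: "prob_space ?PA" by (rule prob_space_PiM) (rule prob_space_rademacher)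
  have PB: "prob_space ?PB" by (rule prob_space_PiM) (rule prob_space_std_normal)
  interpret PBV: pair_prob_space ?PB PV using PB PV by (simp add: pair_prob_space_def pair_sigma_finite_def prob_space_imp_sigma_finite)
  have PBV: "prob_space (?PB \<Otimes>\<^sub>M PV)" by (rule PBV.prob_space_axioms)
  interpret P: pair_prob_space ?PA "?PB \<Otimes>\<^sub>M PV"
    using PA PBV by (simp add: pair_prob_space_def pair_sigma_finite_def prob_space_imp_sigma_finite)
  have ca[measurable]: "(\<lambda>\<omega>. fst \<omega> i) \<in> measurable (?PA \<Otimes>\<^sub>M ?PB \<Otimes>\<^sub>M PV) (count_space UNIV)" if "i < m" for i
  proof -
    have "(\<lambda>a. a i) \<in> measurable ?PA rademacher" using that by (intro measurable_component_singleton) simp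
    hence "(\<lambda>a. a i) \<in> measurable ?PA (count_space UNIV)" by (simp only: measurable_cong_sets[OF refl rademacher_sets])
    thus ?thesis by (rule measurable_compose[OF measurable_fst])
  qed
  have cb[measurable]: "(\<lambda>\<omega>. fst (snd \<omega>) i) \<in> borel_measurable (?PA \<Otimes>\<^sub>M ?PB \<Otimes>\<^sub>M PV)" if "i < m" for i
  proof -
    have "(\<lambda>a. a i) \<in> measurable ?PB std_normal" using that by (intro measurable_component_singleton) simp
    hence "(\<lambda>a. a i) \<in> measurable ?PB borel" by (simp only: measurable_cong_sets[OF refl std_normal_sets])
    thus ?thesis by (rule measurable_compose[OF measurable_compose[OF measurable_snd measurable_fst]])
  qed
  have fst_i: "(\<lambda>\<omega>. ?f (fst \<omega> i) (fst (snd \<omega>) i)) \<in> borel_measurable (?PA \<Otimes>\<^sub>M ?PB \<Otimes>\<^sub>M PV)" if i: "i < m" for i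
  proof -
    have p: "Measurable.pred (?PA \<Otimes>\<^sub>M ?PB \<Otimes>\<^sub>M PV) (\<lambda>\<omega>. fst \<omega> i > 0)"
      by (rule measurable_compose[OF ca[OF i]]) simp
    hence p': "{\<omega> \<in> space (?PA \<Otimes>\<^sub>M ?PB \<Otimes>\<^sub>M PV). 0 < fst \<omega> i} \<in> sets (?PA \<Otimes>\<^sub>M ?PB \<Otimes>\<^sub>M PV)"
      by (simp add: pred_def)
    have r: "(\<lambda>b. relu (t + b)) \<in> borel_measurable borel" for t by measurable
    show ?thesis unfolding unit_fun_def
      by (intro measurable_If borel_measurable_times measurable_compose[OF cb[OF i]] unit_coef_measurable mh r p')
  qed
  have mu_i: "(\<lambda>\<omega>. \<mu> (fst \<omega> i)) \<in> borel_measurable (?PA \<Otimes>\<^sub>M ?PB \<Otimes>\<^sub>M PV)" if i: "i < m" for i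
    by (rule measurable_compose[OF ca[OF i]]) simp
  have A: "whp (?PA \<Otimes>\<^sub>M ?PB \<Otimes>\<^sub>M PV) (2 * exp (- R\<^sup>2 / 4))
      (\<lambda>\<omega>. \<bar>(\<Sum>i<m. \<mu> (fst \<omega> i)) / m - h s\<bar> \<le> ?b * R / sqrt m)"
  proof (rule whp_fst[OF PA PBV, where P = "\<lambda>a. \<bar>(\<Sum>i<m. \<mu> (a i)) / m - h s\<bar> \<le> ?b * R / sqrt m"])
    have "whp ?PA (2 * exp (- R\<^sup>2 / 4))
       (\<lambda>a. \<bar>(\<Sum>i<m. \<mu> (a i)) / m - (\<Sum>i<m. integral\<^sup>L rademacher \<mu>) / m\<bar> \<le> ?b * R / sqrt m)"
      by (rule whp_Hoeffding) (use prob_space_rademacher \<mu>b bp m R in auto)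
    thus "whp ?PA (2 * exp (- R\<^sup>2 / 4)) (\<lambda>a. \<bar>(\<Sum>i<m. \<mu> (a i)) / m - h s\<bar> \<le> ?b * R / sqrt m)"
      using m by (simp add: E)
  qed
  have B: "whp (?PA \<Otimes>\<^sub>M ?PB \<Otimes>\<^sub>M PV) (2 * exp (- R\<^sup>2 / 4))
      (\<lambda>\<omega>. \<bar>(\<Sum>i<m. ?f (fst \<omega> i) (fst (snd \<omega>) i)) / m - (\<Sum>i<m. \<mu> (fst \<omega> i)) / m\<bar> \<le> ?b * R / sqrt m)"
  proof (rule whp_pair[OF PA PBV])
    have "(\<lambda>\<omega>. \<bar>(\<Sum>i<m. ?f (fst \<omega> i) (fst (snd \<omega>) i)) / m - (\<Sum>i<m. \<mu> (fst \<omega> i)) / m\<bar>) \<in> borel_measurable (?PA \<Otimes>\<^sub>M ?PB \<Otimes>\<^sub>M PV)"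
      using fst_i mu_i by (intro borel_measurable_abs borel_measurable_diff borel_measurable_divide borel_measurable_sum) auto
    thus "Measurable.pred (?PA \<Otimes>\<^sub>M ?PB \<Otimes>\<^sub>M PV)
      (\<lambda>\<omega>. \<bar>(\<Sum>i<m. ?f (fst \<omega> i) (fst (snd \<omega>) i)) / m - (\<Sum>i<m. \<mu> (fst \<omega> i)) / m\<bar> \<le> ?b * R / sqrt m)"
      by (rule pred_le_const)
    fix a assume "a \<in> space ?PA"
    have "whp ?PB (2 * exp (- R\<^sup>2 / 4))
       (\<lambda>b. \<bar>(\<Sum>i<m. ?f (a i) (b i)) / m - (\<Sum>i<m. integral\<^sup>L std_normal (?f (a i))) / m\<bar> \<le> ?b * R / sqrt m)"
      by (rule whp_Hoeffding[where f = "\<lambda>i. ?f (a i)"]) (use prob_space_std_normal fb bp m R fm in \<open>auto cong: measurable_cong_sets\<close>)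
    from whp_fst[OF PB PV this]
    show "whp (?PB \<Otimes>\<^sub>M PV) (2 * exp (- R\<^sup>2 / 4))
      (\<lambda>y. \<bar>(\<Sum>i<m. ?f (fst (a, y) i) (fst (snd (a, y)) i)) / m - (\<Sum>i<m. \<mu> (fst (a, y) i)) / m\<bar> \<le> ?b * R / sqrt m)"
      by (simp add: \<mu>_def[abs_def])
  qed
  have "whp (?PA \<Otimes>\<^sub>M ?PB \<Otimes>\<^sub>M PV) (2 * exp (- R\<^sup>2 / 4) + 2 * exp (- R\<^sup>2 / 4))
    (\<lambda>\<omega>. \<bar>(\<Sum>i<m. \<mu> (fst \<omega> i)) / m - h s\<bar> \<le> ?b * R / sqrt m
      \<and> \<bar>(\<Sum>i<m. ?f (fst \<omega> i) (fst (snd \<omega>) i)) / m - (\<Sum>i<m. \<mu> (fst \<omega> i)) / m\<bar> \<le> ?b * R / sqrt m)"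
    by (rule whp_conj[OF P.prob_space_axioms A B])
  hence "whp (?PA \<Otimes>\<^sub>M ?PB \<Otimes>\<^sub>M PV) (2 * exp (- R\<^sup>2 / 4) + 2 * exp (- R\<^sup>2 / 4))
    (\<lambda>\<omega>. \<bar>(\<Sum>i<m. ?f (fst \<omega> i) (fst (snd \<omega>) i)) / m - h s\<bar> \<le> 2 * ?b * R / sqrt m)"
  proof (rule whp_weaken[OF P.prob_space_axioms])
    have "(\<lambda>\<omega>. \<bar>(\<Sum>i<m. ?f (fst \<omega> i) (fst (snd \<omega>) i)) / m - h s\<bar>) \<in> borel_measurable (?PA \<Otimes>\<^sub>M ?PB \<Otimes>\<^sub>M PV)"
      using fst_i by (intro borel_measurable_abs borel_measurable_diff borel_measurable_divide borel_measurable_sum) auto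
    thus "Measurable.pred (?PA \<Otimes>\<^sub>M ?PB \<Otimes>\<^sub>M PV)
      (\<lambda>\<omega>. \<bar>(\<Sum>i<m. ?f (fst \<omega> i) (fst (snd \<omega>) i)) / m - h s\<bar> \<le> 2 * ?b * R / sqrt m)"
      by (rule pred_le_const)
    fix \<omega> assume "\<bar>(\<Sum>i<m. \<mu> (fst \<omega> i)) / m - h s\<bar> \<le> ?b * R / sqrt m
      \<and> \<bar>(\<Sum>i<m. ?f (fst \<omega> i) (fst (snd \<omega>) i)) / m - (\<Sum>i<m. \<mu> (fst \<omega> i)) / m\<bar> \<le> ?b * R / sqrt m"
    moreover have "\<bar>x - z\<bar> \<le> t \<Longrightarrow> \<bar>y - x\<bar> \<le> t \<Longrightarrow> \<bar>y - z\<bar> \<le> t + t" for x y z t :: real by linarith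
    ultimately have "\<bar>(\<Sum>i<m. ?f (fst \<omega> i) (fst (snd \<omega>) i)) / m - h s\<bar> \<le> ?b * R / sqrt m + ?b * R / sqrt m" by blast
    also have "\<dots> = 2 * (?b * R / sqrt m)" by (rule mult_2[symmetric])
    also have "\<dots> = 2 * ?b * R / sqrt m" by (simp only: mult.assoc times_divide_eq_right)
    finally show "\<bar>(\<Sum>i<m. ?f (fst \<omega> i) (fst (snd \<omega>) i)) / m - h s\<bar> \<le> 2 * ?b * R / sqrt m" .
  qed
  thus ?thesis by (simp add: mult_ac)
qed

lemma whp_cdf:
  fixes n :: nat
  assumes w: "(\<Sum>k<d. (w k)\<^sup>2) = 1" and n: "n \<ge> 1" and R: "R \<ge> 0"
  shows "whp (dataset n d) (2 * exp (- R\<^sup>2 / 4))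
    (\<lambda>D. \<bar>(\<Sum>s<n. indicator {t..} (dotp d w (D s))) / n - measure std_normal {t..}\<bar> \<le> R / sqrt n)"
proof -
  have f: "(\<lambda>x. indicator {t..} (dotp d w x) :: real) \<in> borel_measurable (gauss_vec d)" by measurable
  have E: "(\<integral>x. indicator {t..} (dotp d w x) \<partial>gauss_vec d) = measure std_normal {t..}"
    using integral_dotp[OF w, of "indicator {t..}"] by simp
  have "whp (PiM {..<n} (\<lambda>_. gauss_vec d)) (2 * exp (- R\<^sup>2 / 4))
    (\<lambda>D. \<bar>(\<Sum>s<n. indicator {t..} (dotp d w (D s))) / n
      - (\<Sum>s<n. \<integral>x. indicator {t..} (dotp d w x) \<partial>gauss_vec d) / n\<bar> \<le> 1 * R / sqrt n)"
    by (rule whp_Hoeffding[where f = "\<lambda>_ x. indicator {t..} (dotp d w x)"])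
       (use prob_space_gauss_vec n R f in \<open>auto simp: indicator_def\<close>)
  thus ?thesis using n by (simp add: E dataset_def)
qed

lemma whp_dataset_bound:
  assumes u: "(\<Sum>k<d. (u k)\<^sup>2) = 1" and R: "R \<ge> 0" and s: "s < n"
  shows "whp (dataset n d) (gauss_moment 0 * exp (- R\<^sup>2 / 4)) (\<lambda>D. \<bar>dotp d u (D s)\<bar> \<le> R)"
  unfolding dataset_def
  by (rule whp_PiM_component[where M = "\<lambda>_. gauss_vec d" and P = "\<lambda>x. \<bar>dotp d u x\<bar> \<le> R"])
     (use prob_space_gauss_vec whp_dotp_le[OF u R] s in auto)

section \<open>The main theorem\<close>

lemma whp_snd:
  assumes "prob_space M" "prob_space N" "whp N q P"
  shows "whp (M \<Otimes>\<^sub>M N) q (\<lambda>z. P (snd z))"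
proof (rule whp_pair[OF assms(1,2)])
  note [measurable] = whp_pred[OF assms(3)]
  show "Measurable.pred (M \<Otimes>\<^sub>M N) (\<lambda>z. P (snd z))" by measurable
qed (use assms(3) in simp)

lemma prob_space_pair:
  assumes "prob_space M" "prob_space N" shows "prob_space (M \<Otimes>\<^sub>M N)"
proof -
  interpret pair_prob_space M N
    using assms by (simp add: pair_prob_space_def pair_sigma_finite_def prob_space_imp_sigma_finite)
  show ?thesis by (rule prob_space_axioms)
qed

lemma whp_le_mono:
  fixes f :: "'a \<Rightarrow> real"
  assumes M: "prob_space M" and w: "whp M q (\<lambda>x. \<bar>f x - c\<bar> \<le> t)" and [measurable]: "f \<in> borel_measurable M" and "t \<le> t'"
  shows "whp M q (\<lambda>x. \<bar>f x - c\<bar> \<le> t')"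
  by (rule whp_weaken[OF M w]) (use assms(4) in auto)

lemma dataset_dotp_measurable: "s < n \<Longrightarrow> (\<lambda>D. dotp d w (D s)) \<in> borel_measurable (dataset n d)"
  unfolding dataset_def
  by (rule measurable_compose[OF measurable_component_singleton[where M = "\<lambda>_. gauss_vec d"]]) auto

lemma dataset_coord_measurable: "s < n \<Longrightarrow> k < d \<Longrightarrow> (\<lambda>D. D s k) \<in> borel_measurable (dataset n d)"
  using dataset_dotp_measurable[of s n d "basis k"] by (simp add: basis(2))

section \<open>Constants attached to the target function\<close>

locale target =
  fixes g g' g'' :: "real \<Rightarrow> real" and A :: real and m :: nat
  assumes deriv1: "\<And>z. (g has_real_derivative g' z) (at z)"
    and deriv2: "\<And>z. (g' has_real_derivative g'' z) (at z)"
    and A: "A \<ge> 1" and m: "m \<ge> 1"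
    and g_le: "\<And>z. \<bar>g z\<bar> \<le> A * (1 + \<bar>z\<bar>) ^ m"
    and g'_le: "\<And>z. \<bar>g' z\<bar> \<le> A * (1 + \<bar>z\<bar>) ^ m"
    and g''_le: "\<And>z. \<bar>g'' z\<bar> \<le> A * (1 + \<bar>z\<bar>) ^ m"
    and nondeg: "(\<integral>z. g' z \<partial>std_normal) \<noteq> 0"
    and normalization: "(\<integral>z. (g z)\<^sup>2 \<partial>std_normal) \<le> 1"
begin

definition \<mu> :: real where "\<mu> = (\<integral>z. g' z \<partial>std_normal)"

definition tail_const :: real where "tail_const = 2 * gauss_moment 0 + 1"

text \<open>The sum of every constant that has to lie below \<open>B R\<close>: the size of
  \<open>\<mu>\<close> and of its inverse, and the factors in the bounds for dataset products,
  hidden units and sphere rows.\<close>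

definition scale :: real where
  "scale = 1 + \<bar>\<mu>\<bar> + 1 / \<bar>\<mu>\<bar> + (A * 2 ^ m)\<^sup>2 + 60 * (A * 2 ^ m) / std_normal_density 2
     + tail_const * (2 * A ^ 4 * gauss_moment (4 * m) + 1) + 4 / trunc_moment\<^sup>2 + 4 * (2 + gauss_moment 0)"

text \<open>The exponent covers the largest powers of \<open>R\<close> that occur:
  \<open>2 * m + 1\<close> from dataset products, \<open>m + 3\<close> from hidden units and 3 from
  sphere rows.\<close>

definition B :: "real \<Rightarrow> real" where "B R = scale * R ^ (2 * m + 3)"

lemma isCont_g': "isCont g' x"
  by (rule DERIV_isCont[OF deriv2])

lemma g_measurable[measurable]: "g \<in> borel_measurable borel"
  by (intro borel_measurable_continuous_onI continuous_at_imp_continuous_on ballI DERIV_isCont[OF deriv1])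

lemma g'_measurable[measurable]: "g' \<in> borel_measurable borel"
  by (intro borel_measurable_continuous_onI continuous_at_imp_continuous_on ballI isCont_g')

lemma g''_measurable[measurable]: "g'' \<in> borel_measurable borel"
proof (rule borel_measurable_LIMSEQ_real)
  fix x :: real
  have "((\<lambda>h. (g' (x + h) - g' x) / h) \<longlongrightarrow> g'' x) (at 0)"
    using deriv2[of x] by (simp add: DERIV_def)
  moreover have "filterlim (\<lambda>k. 1 / real (Suc k)) (at 0) sequentially"
    unfolding filterlim_at using LIMSEQ_inverse_real_of_nat by (simp add: inverse_eq_divide)
  ultimately show "(\<lambda>k. (g' (x + 1 / real (Suc k)) - g' x) / (1 / real (Suc k))) \<longlonglongrightarrow> g'' x"
    by (rule filterlim_compose)
qed measurable

lemma positive_constants: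
  "0 < A * 2 ^ m" "1 \<le> tail_const" "0 \<le> 60 * (A * 2 ^ m) / std_normal_density 2" "0 < \<bar>\<mu>\<bar>"
  "0 \<le> tail_const * (2 * A ^ 4 * gauss_moment (4 * m) + 1)" "0 \<le> 4 / trunc_moment\<^sup>2" "0 \<le> 4 * (2 + gauss_moment 0)"
proof -
  show "0 < A * 2 ^ m" "0 < \<bar>\<mu>\<bar>" using A nondeg by (auto simp: \<mu>_def)
  thus "0 \<le> 60 * (A * 2 ^ m) / std_normal_density 2" by (intro divide_nonneg_nonneg) auto
  show c: "1 \<le> tail_const" using gauss_moment_nonneg by (simp add: tail_const_def)
  show "0 \<le> tail_const * (2 * A ^ 4 * gauss_moment (4 * m) + 1)"
    using c A gauss_moment_nonneg by (intro mult_nonneg_nonneg add_nonneg_nonneg) auto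
  show "0 \<le> 4 / trunc_moment\<^sup>2" "0 \<le> 4 * (2 + gauss_moment 0)" using gauss_moment_nonneg by auto
qed

lemma scale_ge: "1 \<le> scale" "\<bar>\<mu>\<bar> \<le> scale" "1 / \<bar>\<mu>\<bar> \<le> scale"
  "(A * 2 ^ m)\<^sup>2 + tail_const * (2 * A ^ 4 * gauss_moment (4 * m) + 1) \<le> scale"
  "60 * (A * 2 ^ m) / std_normal_density 2 \<le> scale"
  "4 / trunc_moment\<^sup>2 + 4 * (2 + gauss_moment 0) \<le> scale"
proof -
  have "0 \<le> (A * 2 ^ m)\<^sup>2" "0 \<le> 1 / \<bar>\<mu>\<bar>" "0 \<le> \<bar>\<mu>\<bar>" by auto
  note a = this positive_constants
  show "1 \<le> scale" "\<bar>\<mu>\<bar> \<le> scale" "1 / \<bar>\<mu>\<bar> \<le> scale"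
    "(A * 2 ^ m)\<^sup>2 + tail_const * (2 * A ^ 4 * gauss_moment (4 * m) + 1) \<le> scale"
    "60 * (A * 2 ^ m) / std_normal_density 2 \<le> scale"
    "4 / trunc_moment\<^sup>2 + 4 * (2 + gauss_moment 0) \<le> scale"
    unfolding scale_def using a by linarith+
qed

lemma le_B:
  assumes R: "1 \<le> R" and "x \<le> q * R ^ i" "q \<le> scale" "i \<le> 2 * m + 3" "0 \<le> q"
  shows "x \<le> B R"
proof -
  have "q * R ^ i \<le> scale * R ^ (2 * m + 3)"
    using assms scale_ge(1) by (intro mult_mono power_increasing) auto
  thus ?thesis using assms(2) by (simp add: B_def)
qed

lemma R_le_B: "1 \<le> R \<Longrightarrow> R \<le> B R"
  by (rule le_B[where q = 1 and i = 1]) (use scale_ge in auto)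

lemma bound_on_R:
  assumes R: "1 \<le> R" and z: "\<bar>z\<bar> \<le> R" shows "A * (1 + \<bar>z\<bar>) ^ m \<le> A * 2 ^ m * R ^ m"
proof -
  have "(1 + \<bar>z\<bar>) ^ m \<le> (2 * R) ^ m" using R z by (intro power_mono) auto
  thus ?thesis using A by (simp add: power_mult_distrib mult_left_mono mult.assoc)
qed

lemma poly_const_le_scale: "A * 2 ^ m \<le> scale" 
proof -
  have "std_normal_density 2 \<le> 1"
  proof -
    have "1 / sqrt (2 * pi) \<le> 1" using pi_ge_two by (simp add: divide_le_eq)
    moreover have "exp (- (2::real)\<^sup>2 / 2) \<le> 1" by simp
    ultimately have "1 / sqrt (2 * pi) * exp (- 2\<^sup>2 / 2) \<le> 1 * (1::real)" by (intro mult_mono) auto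
    thus ?thesis by (simp add: std_normal_density_def)
  qed
  moreover have "std_normal_density 2 > 0" by (simp add: normal_density_pos)
  ultimately have "60 * (A * 2 ^ m) / 1 \<le> 60 * (A * 2 ^ m) / std_normal_density 2"
    using positive_constants(1) by (intro divide_left_mono) auto
  thus ?thesis using scale_ge(5) positive_constants(1) by linarith
qed

lemma g_B: "1 \<le> R \<Longrightarrow> \<bar>z\<bar> \<le> R \<Longrightarrow> \<bar>g z\<bar> \<le> B R" "1 \<le> R \<Longrightarrow> \<bar>z\<bar> \<le> R \<Longrightarrow> \<bar>g' z\<bar> \<le> B R"
  by (rule le_B[OF _ order_trans[OF g_le bound_on_R] poly_const_le_scale]; use positive_constants(1) in simp)
     (rule le_B[OF _ order_trans[OF g'_le bound_on_R] poly_const_le_scale]; use positive_constants(1) in simp)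

lemma g_Lipschitz:
  assumes R: "1 \<le> R" and x: "\<bar>x\<bar> \<le> R" and y: "\<bar>y\<bar> \<le> R"
  shows "\<bar>g x - g y\<bar> \<le> B R * \<bar>x - y\<bar>"
proof -
  have "norm (g y - g x) \<le> B R * norm (y - x)"
  proof (rule field_differentiable_bound[where S = "{-R..R}" and f' = g'])
    fix z assume "z \<in> {-R..R}"
    thus "norm (g' z) \<le> B R" using g_B(2)[OF R, of z] by (simp add: abs_le_iff)
    show "(g has_field_derivative g' z) (at z within {-R..R})"
      using deriv1 by (rule has_field_derivative_at_within)
  qed (use x y in \<open>auto simp: abs_le_iff\<close>)
  thus ?thesis by (simp add: abs_minus_commute)
qed

text \<open>The target as a function of the rescaled projection, so that [-R, R] becomes the
  interval [-1, 1] of the ReLU representation. Two derivatives cost R^2, the extra factor in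
  \<open>M\<close>.\<close>

definition hR :: "real \<Rightarrow> real \<Rightarrow> real" where "hR R s = g (R * s)"
definition hR' :: "real \<Rightarrow> real \<Rightarrow> real" where "hR' R s = R * g' (R * s)"
definition hR'' :: "real \<Rightarrow> real \<Rightarrow> real" where "hR'' R s = R\<^sup>2 * g'' (R * s)"

lemma hR_deriv: "(hR R has_real_derivative hR' R x) (at x)" "(hR' R has_real_derivative hR'' R x) (at x)"
proof -
  have "((\<lambda>s. g (R * s)) has_real_derivative g' (R * x) * R) (at x)"
    by (rule DERIV_chain2[OF deriv1]) (auto intro!: derivative_eq_intros)
  thus "(hR R has_real_derivative hR' R x) (at x)" by (simp add: hR_def[abs_def] hR'_def mult.commute)
  have "((\<lambda>s. R * g' (R * s)) has_real_derivative R * (g'' (R * x) * R)) (at x)"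
    by (rule DERIV_cmult[OF DERIV_chain2[OF deriv2]]) (auto intro!: derivative_eq_intros)
  thus "(hR' R has_real_derivative hR'' R x) (at x)"
    by (simp add: hR'_def[abs_def] hR''_def power2_eq_square mult_ac)
qed

lemma hR''_measurable[measurable]: "hR'' R \<in> borel_measurable borel"
  unfolding hR''_def by measurable

definition M :: "real \<Rightarrow> real" where "M R = R\<^sup>2 * (A * 2 ^ m * R ^ m)"

lemma M_pos: "1 \<le> R \<Longrightarrow> 0 < M R"
  using positive_constants(1) by (simp add: M_def)

lemma hR_bounds:
  assumes R: "1 \<le> R" and x: "\<bar>x\<bar> \<le> 1"
  shows "\<bar>hR R x\<bar> \<le> M R" "\<bar>hR' R x\<bar> \<le> M R" "\<bar>hR'' R x\<bar> \<le> M R"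
proof -
  have Rx: "\<bar>R * x\<bar> \<le> R" using R x by (simp add: abs_mult mult_left_le)
  let ?G = "A * 2 ^ m * R ^ m"
  have G0: "0 \<le> ?G" using positive_constants(1) R by simp
  have b: "\<bar>g (R * x)\<bar> \<le> ?G" "\<bar>g' (R * x)\<bar> \<le> ?G" "\<bar>g'' (R * x)\<bar> \<le> ?G"
    using order_trans[OF g_le bound_on_R[OF R Rx]] order_trans[OF g'_le bound_on_R[OF R Rx]]
      order_trans[OF g''_le bound_on_R[OF R Rx]] by auto
  have R2: "1 \<le> R\<^sup>2" "R \<le> R\<^sup>2" using R mult_left_mono[of 1 R R] by (auto simp: power2_eq_square intro: order_trans)
  have "\<bar>g (R * x)\<bar> \<le> R\<^sup>2 * ?G" using b(1) mult_right_mono[OF R2(1) G0] by linarith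
  thus "\<bar>hR R x\<bar> \<le> M R" by (simp add: hR_def M_def)
  have "R * \<bar>g' (R * x)\<bar> \<le> R\<^sup>2 * ?G" using R2 b(2) R by (intro mult_mono) auto
  thus "\<bar>hR' R x\<bar> \<le> M R" using R by (simp add: hR'_def M_def abs_mult)
  have "R\<^sup>2 * \<bar>g'' (R * x)\<bar> \<le> R\<^sup>2 * ?G" using b(3) by (intro mult_left_mono) auto
  thus "\<bar>hR'' R x\<bar> \<le> M R" by (simp add: hR''_def M_def abs_mult)
qed

abbreviation "unitR R s \<equiv> unit_fun (hR R) (hR' R) (hR'' R) s"
abbreviation "coefR R \<sigma> b \<equiv> unit_coef \<sigma> (hR R) (hR' R) (hR'' R) b"

lemma unit_le_B:
  assumes R: "1 \<le> R"
  shows "2 * (30 * M R / std_normal_density 2) * R \<le> B R" "10 * M R / std_normal_density 2 \<le> B R"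
proof -
  have \<phi>: "std_normal_density 2 > 0" by (simp add: normal_density_pos)
  show 1: "2 * (30 * M R / std_normal_density 2) * R \<le> B R"
    by (rule le_B[OF R _ scale_ge(5) _ positive_constants(3), where i = "m + 3"])
       (auto simp: M_def power_add eval_nat_numeral mult_ac)
  have "10 * M R / std_normal_density 2 * 1 \<le> 60 * M R / std_normal_density 2 * R"
    using R M_pos[OF R] \<phi> by (intro mult_mono divide_right_mono) auto
  thus "10 * M R / std_normal_density 2 \<le> B R" using 1 by simp
qed

lemma product_B:
  assumes R: "1 \<le> R"
  shows "(A * (2 * R) ^ m)\<^sup>2 * R + tail_const * (2 * A ^ 4 * gauss_moment (4 * m) + 1) \<le> B R"
proof (rule le_B[OF R _ scale_ge(4), where i = "2 * m + 1"])
  have "1 \<le> R ^ (2 * m + 1)" using R by (rule one_le_power)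
  from mult_left_mono[OF this positive_constants(5)]
  have l1: "tail_const * (2 * A ^ 4 * gauss_moment (4 * m) + 1) \<le> tail_const * (2 * A ^ 4 * gauss_moment (4 * m) + 1) * R ^ (2 * m + 1)"
    by (simp only: mult_1_right)
  have e1: "(A * (2 * R) ^ m)\<^sup>2 * R = (A * 2 ^ m)\<^sup>2 * R ^ (2 * m + 1)"
    by (simp add: power_mult_distrib power_mult[symmetric] mult.commute[of m 2])
  show "(A * (2 * R) ^ m)\<^sup>2 * R + tail_const * (2 * A ^ 4 * gauss_moment (4 * m) + 1)
      \<le> ((A * 2 ^ m)\<^sup>2 + tail_const * (2 * A ^ 4 * gauss_moment (4 * m) + 1)) * R ^ (2 * m + 1)"
    unfolding e1 distrib_right by (rule add_left_mono[OF l1])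
  show "0 \<le> (A * 2 ^ m)\<^sup>2 + tail_const * (2 * A ^ 4 * gauss_moment (4 * m) + 1)"
    using positive_constants(5) by (intro add_nonneg_nonneg) auto
qed simp

lemma sphere_B:
  assumes R: "1 \<le> R"
  shows "4 * R\<^sup>2 / trunc_moment\<^sup>2 * R + 4 * (2 + gauss_moment 0) \<le> B R"
proof (rule le_B[OF R _ scale_ge(6), where i = 3])
  have "1 \<le> R ^ 3" using R by (rule one_le_power)
  hence "4 * (2 + gauss_moment 0) * 1 \<le> 4 * (2 + gauss_moment 0) * R ^ 3"
    using positive_constants(7) by (rule mult_left_mono)
  thus "4 * R\<^sup>2 / trunc_moment\<^sup>2 * R + 4 * (2 + gauss_moment 0) \<le> (4 / trunc_moment\<^sup>2 + 4 * (2 + gauss_moment 0)) * R ^ 3"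
    by (simp add: distrib_right power2_eq_square power3_eq_cube)
qed (use positive_constants(6,7) in auto)

section \<open>The good event and its probability\<close>

definition good_D1 where
  "good_D1 d n R w D \<longleftrightarrow>
    (\<forall>k\<in>{..<d}. \<bar>(\<Sum>s<n. g (dotp d w (D s)) * D s k) / real n - \<mu> * w k\<bar> \<le> B R / sqrt n) \<and>
    (\<forall>k\<in>{..<d}. \<bar>(\<Sum>s<n. D s k) / real n\<bar> \<le> B R / sqrt n)"

definition good_D2 where
  "good_D2 d n J R w D \<longleftrightarrow>
    (\<forall>k\<in>{..<d}. \<forall>l\<in>{..<d}. \<bar>(\<Sum>s<n. D s k * D s l) / real n - (if k = l then 1 else 0)\<bar> \<le> B R / sqrt n) \<and>
    (\<forall>s\<in>{..<n}. \<forall>k\<in>{..<d}. \<bar>D s k\<bar> \<le> R) \<and> (\<forall>s\<in>{..<n}. \<bar>dotp d w (D s)\<bar> \<le> R) \<and>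
    (\<forall>j\<in>{..J}. \<bar>(\<Sum>s<n. indicator {grid R J j..} (dotp d w (D s))) / real n
      - measure std_normal {grid R J j..}\<bar> \<le> R / sqrt n)"

definition good_V where
  "good_V d m2 R V \<longleftrightarrow> (\<forall>k\<in>{..<d}. \<forall>l\<in>{..<d}.
      \<bar>real d / real m2 * (\<Sum>j<m2. V j k * V j l) - (if k = l then 1 else 0)\<bar> \<le> B R / sqrt m2)"

definition good_ab where
  "good_ab m1 J R a b \<longleftrightarrow> (\<forall>j\<in>{..J}.
      \<bar>(\<Sum>i<m1. unitR R (grid R J j / R) (a i) (b i)) / real m1 - hR R (grid R J j / R)\<bar>
        \<le> 2 * (30 * M R / std_normal_density 2) * R / sqrt m1)"

text \<open>The grid has \<open>n * m1\<close> cells: fine enough for both statistical errors, yet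
  polynomial, so that the union bound over thresholds is affordable.\<close>

definition good where
  "good d n m1 m2 R w \<omega> \<longleftrightarrow> (case \<omega> of (D1, D2, a, b, V) \<Rightarrow>
    good_D1 d n R w D1 \<and> good_D2 d n (n * m1) R w D2 \<and>
    (\<forall>i\<in>{..<m1}. \<bar>a i\<bar> = 1) \<and> (\<forall>i\<in>{..<m1}. \<bar>b i\<bar> \<le> R) \<and> good_ab m1 (n * m1) R a b \<and> good_V d m2 R V)"

lemma id_le: "\<bar>z\<bar> \<le> A * (1 + \<bar>z\<bar>) ^ m"
proof -
  have "\<bar>z\<bar> \<le> 1 * (1 + \<bar>z\<bar>) ^ 1" by simp
  also have "\<dots> \<le> A * (1 + \<bar>z\<bar>) ^ m" using A m by (intro mult_mono power_increasing) auto
  finally show ?thesis .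
qed

lemma one_le: "\<bar>1\<bar> \<le> A * (1 + \<bar>z\<bar>) ^ m"
  using mult_mono[of 1 A 1 "(1 + \<bar>z\<bar>) ^ m"] A by (simp add: one_le_power)

lemma whp_good_D1:
  assumes d: "d \<ge> 1" and n: "n \<ge> 1" and w: "(\<Sum>k<d. (w k)\<^sup>2) = 1" and R: "1 \<le> R" and small: "exp (- R\<^sup>2 / 4) \<le> 1 / n"
  shows "whp (dataset n d) (2 * (real d * ((2 + n * tail_const) * exp (- R\<^sup>2 / 4)))) (good_D1 d n R w)"
proof -
  have c: "whp (dataset n d) (card {..<d} * ((2 + n * tail_const) * exp (- R\<^sup>2 / 4)))
      (\<lambda>D. \<forall>k\<in>{..<d}. \<bar>(\<Sum>s<n. g (dotp d w (D s)) * D s k) / real n - \<mu> * w k\<bar> \<le> B R / sqrt n)"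
  proof (rule whp_Ball)
    fix k assume "k \<in> {..<d}" hence k: "k < d" by simp
    have E: "(\<integral>x. g (dotp d w x) * x k \<partial>gauss_vec d) = \<mu> * w k"
      using Stein_gauss_vec[OF deriv1 isCont_g' g_le g'_le w k] by (simp add: \<mu>_def)
    have q: "whp (dataset n d) ((2 + n * tail_const) * exp (- R\<^sup>2 / 4))
      (\<lambda>D. \<bar>(\<Sum>s<n. g (dotp d w (D s)) * dotp d (basis k) (D s)) / n
        - (\<integral>x. g (dotp d w x) * dotp d (basis k) x \<partial>gauss_vec d)\<bar>
      \<le> ((A * (2 * R) ^ m)\<^sup>2 * R + tail_const * (2 * A ^ 4 * gauss_moment (4 * m) + 1)) / sqrt n)"
      unfolding tail_const_def
      by (rule whp_dataset_product[where ?G2.0 = "\<lambda>z. z"]) (use w basis(1)[OF k] g_le id_le A n R small in auto)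
    show "whp (dataset n d) ((2 + n * tail_const) * exp (- R\<^sup>2 / 4))
      (\<lambda>D. \<bar>(\<Sum>s<n. g (dotp d w (D s)) * D s k) / real n - \<mu> * w k\<bar> \<le> B R / sqrt n)"
    proof (rule whp_le_mono[OF prob_space_dataset q[unfolded basis(2)[OF k] E]])
      show "(\<lambda>D. (\<Sum>s<n. g (dotp d w (D s)) * D s k) / real n) \<in> borel_measurable (dataset n d)"
        using k by (intro borel_measurable_divide borel_measurable_sum borel_measurable_times borel_measurable_const
            measurable_compose[OF dataset_dotp_measurable g_measurable] dataset_coord_measurable) auto
    qed (intro divide_right_mono product_B R, simp)
  qed simp
  have c': "whp (dataset n d) (card {..<d} * ((2 + n * tail_const) * exp (- R\<^sup>2 / 4)))
      (\<lambda>D. \<forall>k\<in>{..<d}. \<bar>(\<Sum>s<n. D s k) / real n\<bar> \<le> B R / sqrt n)"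
  proof (rule whp_Ball)
    fix k assume "k \<in> {..<d}" hence k: "k < d" by simp
    have q: "whp (dataset n d) ((2 + n * tail_const) * exp (- R\<^sup>2 / 4))
      (\<lambda>D. \<bar>(\<Sum>s<n. 1 * dotp d (basis k) (D s)) / n
        - (\<integral>x. 1 * dotp d (basis k) x \<partial>gauss_vec d)\<bar>
      \<le> ((A * (2 * R) ^ m)\<^sup>2 * R + tail_const * (2 * A ^ 4 * gauss_moment (4 * m) + 1)) / sqrt n)"
      unfolding tail_const_def
      by (rule whp_dataset_product[where ?G1.0 = "\<lambda>_. 1" and ?G2.0 = "\<lambda>z. z"])
         (use basis(1)[OF k] one_le id_le A n R small in auto)
    have "whp (dataset n d) ((2 + n * tail_const) * exp (- R\<^sup>2 / 4)) (\<lambda>D. \<bar>(\<Sum>s<n. D s k) / real n - 0\<bar> \<le> B R / sqrt n)"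
    proof (rule whp_le_mono[OF prob_space_dataset q[unfolded basis(2)[OF k] mult_1 gauss_vec_mean[OF k]]])
      show "(\<lambda>D. (\<Sum>s<n. D s k) / real n) \<in> borel_measurable (dataset n d)"
        using k by (intro borel_measurable_divide borel_measurable_sum borel_measurable_const dataset_coord_measurable) auto
    qed (intro divide_right_mono product_B R, simp)
    thus "whp (dataset n d) ((2 + n * tail_const) * exp (- R\<^sup>2 / 4)) (\<lambda>D. \<bar>(\<Sum>s<n. D s k) / real n\<bar> \<le> B R / sqrt n)"
      by simp
  qed simp
  show ?thesis
    using whp_conj[OF prob_space_dataset c c'] by (simp add: good_D1_def[abs_def])
qed

lemma whp_good_D2:
  fixes n J :: nat
  assumes d: "d \<ge> 1" and n: "n \<ge> 1" and w: "(\<Sum>k<d. (w k)\<^sup>2) = 1" and R: "1 \<le> R" and small: "exp (- R\<^sup>2 / 4) \<le> 1 / n"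
  shows "whp (dataset n d) (real d * (real d * ((2 + n * tail_const) * exp (- R\<^sup>2 / 4)))
    + (real n * (real d * (gauss_moment 0 * exp (- R\<^sup>2 / 4)))
    + (real n * (gauss_moment 0 * exp (- R\<^sup>2 / 4)) + real (J + 1) * (2 * exp (- R\<^sup>2 / 4))))) (good_D2 d n J R w)"
proof -
  let ?\<epsilon> = "exp (- R\<^sup>2 / 4)"
  note P = prob_space_dataset[of n d]
  have cov: "whp (dataset n d) ((2 + n * tail_const) * ?\<epsilon>)
      (\<lambda>D. \<bar>(\<Sum>s<n. D s k * D s l) / real n - (if k = l then 1 else 0)\<bar> \<le> B R / sqrt n)" if k: "k < d" and l: "l < d" for k l
  proof -
    have q: "whp (dataset n d) ((2 + n * tail_const) * ?\<epsilon>)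
      (\<lambda>D. \<bar>(\<Sum>s<n. dotp d (basis k) (D s) * dotp d (basis l) (D s)) / n
        - (\<integral>x. dotp d (basis k) x * dotp d (basis l) x \<partial>gauss_vec d)\<bar>
      \<le> ((A * (2 * R) ^ m)\<^sup>2 * R + tail_const * (2 * A ^ 4 * gauss_moment (4 * m) + 1)) / sqrt n)"
      unfolding tail_const_def
      by (rule whp_dataset_product[where ?G1.0 = "\<lambda>z. z" and ?G2.0 = "\<lambda>z. z"])
         (use basis(1)[OF k] basis(1)[OF l] id_le A n R small in auto)
    show ?thesis
    proof (rule whp_le_mono[OF P q[unfolded basis(2)[OF k] basis(2)[OF l] gauss_vec_cov[OF k l]]])
      show "(\<lambda>D. (\<Sum>s<n. D s k * D s l) / real n) \<in> borel_measurable (dataset n d)"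
        using k l by (intro borel_measurable_divide borel_measurable_sum borel_measurable_times borel_measurable_const
            dataset_coord_measurable) auto
    qed (intro divide_right_mono product_B R, simp)
  qed
  have c1: "whp (dataset n d) (card {..<d} * (card {..<d} * ((2 + n * tail_const) * ?\<epsilon>)))
      (\<lambda>D. \<forall>k\<in>{..<d}. \<forall>l\<in>{..<d}. \<bar>(\<Sum>s<n. D s k * D s l) / real n - (if k = l then 1 else 0)\<bar> \<le> B R / sqrt n)"
    by (intro whp_Ball cov) auto
  have b0: "whp (dataset n d) (gauss_moment 0 * ?\<epsilon>) (\<lambda>D. \<bar>D s k\<bar> \<le> R)" if "s < n" "k < d" for s k
    using whp_dataset_bound[OF basis(1)[OF that(2)], of R s n] R that by (simp add: basis(2))
  have c2: "whp (dataset n d) (card {..<n} * (card {..<d} * (gauss_moment 0 * ?\<epsilon>)))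
      (\<lambda>D. \<forall>s\<in>{..<n}. \<forall>k\<in>{..<d}. \<bar>D s k\<bar> \<le> R)"
    by (intro whp_Ball b0) auto
  have c3: "whp (dataset n d) (card {..<n} * (gauss_moment 0 * ?\<epsilon>)) (\<lambda>D. \<forall>s\<in>{..<n}. \<bar>dotp d w (D s)\<bar> \<le> R)"
    by (intro whp_Ball whp_dataset_bound w) (use R in auto)
  have c4: "whp (dataset n d) (card {..J} * (2 * ?\<epsilon>))
      (\<lambda>D. \<forall>j\<in>{..J}. \<bar>(\<Sum>s<n. indicator {grid R J j..} (dotp d w (D s))) / real n
        - measure std_normal {grid R J j..}\<bar> \<le> R / sqrt n)"
    by (intro whp_Ball whp_cdf w n) (use R in auto)
  show ?thesis
    using whp_conj[OF P c1 whp_conj[OF P c2 whp_conj[OF P c3 c4]]] by (simp add: good_D2_def[abs_def] add.commute)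
qed

lemma whp_good_V:
  fixes m2 :: nat
  assumes d: "d \<ge> 1" and m2: "m2 \<ge> 1" and R: "1 \<le> R" and small: "real d ^ 5 * exp (- R\<^sup>2 / 4) \<le> 1 / m2"
  shows "whp (PiM {..<m2} (\<lambda>_. sphere_unif d)) (real d * (real d * ((2 + m2 * (2 + d * gauss_moment 0)) * exp (- R\<^sup>2 / 4))))
    (good_V d m2 R)"
proof -
  let ?P = "PiM {..<m2} (\<lambda>_. sphere_unif d)"
  have P: "prob_space ?P" by (rule prob_space_PiM) (rule prob_space_sphere_unif)
  have c: "whp ?P ((2 + m2 * (2 + d * gauss_moment 0)) * exp (- R\<^sup>2 / 4))
      (\<lambda>V. \<bar>real d / real m2 * (\<Sum>j<m2. V j k * V j l) - (if k = l then 1 else 0)\<bar> \<le> B R / sqrt m2)"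
    if k: "k < d" and l: "l < d" for k l
  proof (rule whp_le_mono[OF P whp_sphere_cov[OF d k l m2 R small]])
    have comp: "(\<lambda>V. V j i) \<in> borel_measurable ?P" if "j < m2" "i < d" for i j
    proof -
      have "(\<lambda>V. V j) \<in> measurable ?P (sphere_unif d)"
        using that by (intro measurable_component_singleton) simp
      hence "(\<lambda>V. V j) \<in> measurable ?P (PiM {..<d} (\<lambda>_. borel))"
        by (simp only: measurable_cong_sets[OF refl sphere_unif_sets])
      thus ?thesis by (rule measurable_compose[OF _ measurable_coordinate[OF that(2)]])
    qed
    show "(\<lambda>V. real d / real m2 * (\<Sum>j<m2. V j k * V j l)) \<in> borel_measurable ?P"
      using k l by (intro borel_measurable_times borel_measurable_sum borel_measurable_const comp) auto
  qed (intro divide_right_mono sphere_B R, simp)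
  have "whp ?P (card {..<d} * (card {..<d} * ((2 + m2 * (2 + d * gauss_moment 0)) * exp (- R\<^sup>2 / 4))))
      (\<lambda>V. \<forall>k\<in>{..<d}. \<forall>l\<in>{..<d}. \<bar>real d / real m2 * (\<Sum>j<m2. V j k * V j l) - (if k = l then 1 else 0)\<bar> \<le> B R / sqrt m2)"
    by (intro whp_Ball c) auto
  thus ?thesis by (simp add: good_V_def[abs_def])
qed

lemma whp_good_ab:
  fixes m1 J :: nat
  assumes m1: "m1 \<ge> 1" and J: "J \<ge> 1" and R: "1 \<le> R" and PV: "prob_space PV"
  shows "whp (PiM {..<m1} (\<lambda>_. rademacher) \<Otimes>\<^sub>M PiM {..<m1} (\<lambda>_. std_normal) \<Otimes>\<^sub>M PV) (real (J + 1) * (4 * exp (- R\<^sup>2 / 4)))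
    (\<lambda>\<omega>. good_ab m1 J R (fst \<omega>) (fst (snd \<omega>)))"
proof -
  have "whp (PiM {..<m1} (\<lambda>_. rademacher) \<Otimes>\<^sub>M PiM {..<m1} (\<lambda>_. std_normal) \<Otimes>\<^sub>M PV) (card {..J} * (4 * exp (- R\<^sup>2 / 4)))
    (\<lambda>\<omega>. \<forall>j\<in>{..J}. \<bar>(\<Sum>i<m1. unitR R (grid R J j / R) (fst \<omega> i) (fst (snd \<omega>) i)) / m1 - hR R (grid R J j / R)\<bar>
       \<le> 2 * (30 * M R / std_normal_density 2) * R / sqrt m1)"
  proof (intro whp_Ball whp_units)
    fix j assume "j \<in> {..J}"
    hence "\<bar>grid R J j\<bar> \<le> R" using grid_bounds[of R j J] R J by auto
    thus "\<bar>grid R J j / R\<bar> \<le> 1" using R by (simp add: abs_divide)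
  qed (use hR_deriv hR_bounds[OF R] M_pos[OF R] m1 R PV hR''_measurable in auto)
  thus ?thesis by (simp add: good_ab_def[abs_def] add.commute)
qed

text \<open>Each count in the union bound is, up to constants, a product of at most four of the
  sizes, each of them at most \<open>N\<close>.\<close>

lemma le_power4:
  fixes N :: real
  assumes N: "1 \<le> N"
  shows "\<And>a. 0 \<le> a \<Longrightarrow> a \<le> N \<Longrightarrow> a \<le> N ^ 4"
    and "\<And>a b. 0 \<le> a \<Longrightarrow> a \<le> N \<Longrightarrow> 0 \<le> b \<Longrightarrow> b \<le> N \<Longrightarrow> a * b \<le> N ^ 4"
    and "\<And>a b c. 0 \<le> a \<Longrightarrow> a \<le> N \<Longrightarrow> 0 \<le> b \<Longrightarrow> b \<le> N \<Longrightarrow> 0 \<le> c \<Longrightarrow> c \<le> N \<Longrightarrow> a * b * c \<le> N ^ 4"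
    and "\<And>a b c e. 0 \<le> a \<Longrightarrow> a \<le> N \<Longrightarrow> 0 \<le> b \<Longrightarrow> b \<le> N \<Longrightarrow> 0 \<le> c \<Longrightarrow> c \<le> N \<Longrightarrow> 0 \<le> e \<Longrightarrow> e \<le> N \<Longrightarrow> a * b * c * e \<le> N ^ 4"
proof -
  have p: "N ^ i \<le> N ^ 4" if "i \<le> 4" for i using N that by (rule power_increasing[rotated])
  show "a \<le> N ^ 4" if "0 \<le> a" "a \<le> N" for a using p[of 1] that by simp
  show "a * b \<le> N ^ 4" if "0 \<le> a" "a \<le> N" "0 \<le> b" "b \<le> N" for a b
  proof -
    have "a * b \<le> N * N" using that N by (intro mult_mono) auto
    thus ?thesis using p[of 2] by (simp add: power2_eq_square)
  qed
  show "a * b * c \<le> N ^ 4" if "0 \<le> a" "a \<le> N" "0 \<le> b" "b \<le> N" "0 \<le> c" "c \<le> N" for a b c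
  proof -
    have "a * b * c \<le> N * N * N" using that N by (intro mult_mono) auto
    thus ?thesis using p[of 3] by (simp add: power3_eq_cube)
  qed
  show "a * b * c * e \<le> N ^ 4" if "0 \<le> a" "a \<le> N" "0 \<le> b" "b \<le> N" "0 \<le> c" "c \<le> N" "0 \<le> e" "e \<le> N" for a b c e
  proof -
    have "a * b * c * e \<le> N * N * N * N" using that N by (intro mult_mono) auto
    thus ?thesis by (simp add: power4_eq_xxxx)
  qed
qed

text \<open>A union bound over the components of the sample, each event being lifted to the product
  space. The largest count is d^2 * m2 * d, from the sphere rows; the factor 40 is generous.\<close>

lemma whp_good:
  fixes d n m1 m2 :: nat
  assumes pos: "d \<ge> 1" "n \<ge> 1" "m1 \<ge> 1" "m2 \<ge> 1" and w: "(\<Sum>k<d. (w k)\<^sup>2) = 1" and R: "1 \<le> R"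
    and small: "exp (- R\<^sup>2 / 4) \<le> 1 / n" "real d ^ 5 * exp (- R\<^sup>2 / 4) \<le> 1 / m2"
  defines "N \<equiv> real (d * n * m1 * m2)"
  shows "whp (sample_space d n m1 m2) (40 * (2 + tail_const) * (N ^ 4 * exp (- R\<^sup>2 / 4))) (good d n m1 m2 R w)"
proof -
  let ?\<epsilon> = "exp (- R\<^sup>2 / 4)" and ?DS = "dataset n d" and ?PA = "PiM {..<m1} (\<lambda>_. rademacher)"
    and ?PB = "PiM {..<m1} (\<lambda>_. std_normal)" and ?PV = "PiM {..<m2} (\<lambda>_. sphere_unif d)" and ?J = "n * m1"
  have DS: "prob_space ?DS" by (rule prob_space_dataset)
  have PA: "prob_space ?PA" by (rule prob_space_PiM) (rule prob_space_rademacher)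
  have PB: "prob_space ?PB" by (rule prob_space_PiM) (rule prob_space_std_normal)
  have PV: "prob_space ?PV" by (rule prob_space_PiM) (rule prob_space_sphere_unif)
  have P4: "prob_space (?PB \<Otimes>\<^sub>M ?PV)" by (intro prob_space_pair PB PV)
  have P3: "prob_space (?PA \<Otimes>\<^sub>M ?PB \<Otimes>\<^sub>M ?PV)" by (intro prob_space_pair PA P4)
  have P2: "prob_space (?DS \<Otimes>\<^sub>M ?PA \<Otimes>\<^sub>M ?PB \<Otimes>\<^sub>M ?PV)" by (intro prob_space_pair DS P3)
  have P1: "prob_space (?DS \<Otimes>\<^sub>M ?DS \<Otimes>\<^sub>M ?PA \<Otimes>\<^sub>M ?PB \<Otimes>\<^sub>M ?PV)" by (intro prob_space_pair DS P2)
  have J1: "?J \<ge> 1" using pos by simp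
  have eA: "whp ?PA (real (card {..<m1}) * 0) (\<lambda>a. \<forall>i\<in>{..<m1}. \<bar>a i\<bar> = 1)"
    by (intro whp_Ball whp_PiM_component[where M = "\<lambda>_. rademacher" and P = "\<lambda>a. \<bar>a\<bar> = 1"] whp_rademacher)
       (auto simp: prob_space_rademacher)
  have eb: "whp ?PB (card {..<m1} * (gauss_moment 0 * ?\<epsilon>)) (\<lambda>b. \<forall>i\<in>{..<m1}. \<bar>b i\<bar> \<le> R)"
  proof (intro whp_Ball whp_PiM_component[where M = "\<lambda>_. std_normal" and P = "\<lambda>b. \<bar>b\<bar> \<le> R"] whpI)
    show "measure std_normal {x \<in> space std_normal. \<not> \<bar>x\<bar> \<le> R} \<le> gauss_moment 0 * ?\<epsilon>"
      using gauss_tail_prob[of R] R by (simp add: not_le)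
  qed (auto simp: prob_space_std_normal)
  note e1 = whp_fst[OF DS P2 whp_good_D1[OF pos(1,2) w R small(1)]]
  note e2 = whp_snd[OF DS P2 whp_fst[OF DS P3 whp_good_D2[OF pos(1,2) w R small(1), where J = ?J]]]
  note e3 = whp_snd[OF DS P2 whp_snd[OF DS P3 whp_fst[OF PA P4 eA]]]
  note e4 = whp_snd[OF DS P2 whp_snd[OF DS P3 whp_snd[OF PA P4 whp_fst[OF PB PV eb]]]]
  note e5 = whp_snd[OF DS P2 whp_snd[OF DS P3 whp_good_ab[OF pos(3) J1 R PV]]]
  note e6 = whp_snd[OF DS P2 whp_snd[OF DS P3 whp_snd[OF PA P4 whp_snd[OF PB PV whp_good_V[OF pos(1,4) R small(2)]]]]]
  have good_eq: "good d n m1 m2 R w = (\<lambda>z. good_D1 d n R w (fst z) \<and> good_D2 d n ?J R w (fst (snd z))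
      \<and> (\<forall>i\<in>{..<m1}. \<bar>fst (snd (snd z)) i\<bar> = 1) \<and> (\<forall>i\<in>{..<m1}. \<bar>fst (snd (snd (snd z))) i\<bar> \<le> R)
      \<and> good_ab m1 ?J R (fst (snd (snd z))) (fst (snd (snd (snd z)))) \<and> good_V d m2 R (snd (snd (snd (snd z)))))"
    by (auto simp: good_def fun_eq_iff)
  note all = whp_conj[OF P1 e1 whp_conj[OF P1 e2 whp_conj[OF P1 e3 whp_conj[OF P1 e4 whp_conj[OF P1 e5 e6]]]]]
  show ?thesis
    unfolding sample_space_def good_eq
  proof (rule whp_mono[OF all])
    have r1: "real d \<ge> 1" "real n \<ge> 1" "real m1 \<ge> 1" "real m2 \<ge> 1" using pos by auto
    have "1 \<le> d * n * m1 * m2" using pos by simp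
    hence N1: "1 \<le> N" unfolding N_def by linarith
    have "d \<le> d * n * m1 * m2" "n \<le> d * n * m1 * m2" "m2 \<le> d * n * m1 * m2" "n * m1 \<le> d * n * m1 * m2" "m1 \<le> d * n * m1 * m2"
      using pos by auto
    hence le: "real d \<le> N" "real n \<le> N" "real m2 \<le> N" "real (n * m1) \<le> N" "real m1 \<le> N" unfolding N_def by linarith+
    have g0: "0 \<le> gauss_moment 0" by (rule gauss_moment_nonneg)
    let ?Y = "N ^ 4 * ?\<epsilon>" and ?X = "2 + tail_const"
    have Y0: "0 \<le> ?Y" using N1 by simp
    have X: "gauss_moment 0 \<le> ?X" "3 \<le> ?X" "0 \<le> tail_const" using g0 by (auto simp: tail_const_def)
    note l4 = le_power4[OF N1]
    have scale: "t * (x * ?\<epsilon>) \<le> y * ?Y" if "t * x \<le> y * N ^ 4" for t x y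
      using mult_right_mono[OF that, of ?\<epsilon>] by (simp add: mult_ac)
    have n2: "2 + real n * tail_const \<le> ?X * real n"
      using r1(2) X by (simp add: algebra_simps)
    have p1: "real d * ((2 + real n * tail_const) * ?\<epsilon>) \<le> ?X * ?Y"
    proof (rule scale)
      have "real d * (2 + real n * tail_const) \<le> real d * (?X * real n)" using n2 by (intro mult_left_mono) auto
      also have "\<dots> = ?X * (real d * real n)" by simp
      also have "\<dots> \<le> ?X * N ^ 4" using X le by (intro mult_left_mono l4) auto
      finally show "real d * (2 + real n * tail_const) \<le> ?X * N ^ 4" .
    qed
    have p2: "real d * (real d * ((2 + real n * tail_const) * ?\<epsilon>)) \<le> ?X * ?Y"
      unfolding mult.assoc[symmetric, of "real d" "real d"]
    proof (rule scale)
      have "real d * real d * (2 + real n * tail_const) \<le> real d * real d * (?X * real n)" using n2 by (intro mult_left_mono) auto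
      also have "\<dots> = ?X * (real d * real d * real n)" by simp
      also have "\<dots> \<le> ?X * N ^ 4" using X le by (intro mult_left_mono l4) auto
      finally show "real d * real d * (2 + real n * tail_const) \<le> ?X * N ^ 4" .
    qed
    have p3: "real n * (real d * (gauss_moment 0 * ?\<epsilon>)) \<le> ?X * ?Y"
      unfolding mult.assoc[symmetric, of "real n" "real d"]
    proof (rule scale)
      have "real n * real d * gauss_moment 0 \<le> N ^ 4 * ?X" using X le g0 N1 by (intro mult_mono l4) auto
      thus "real n * real d * gauss_moment 0 \<le> ?X * N ^ 4" by (simp add: mult_ac)
    qed
    have p4: "real k * (gauss_moment 0 * ?\<epsilon>) \<le> ?X * ?Y" if "real k \<le> N" for k
    proof (rule scale)
      have "real k * gauss_moment 0 \<le> N ^ 4 * ?X" using X that g0 N1 by (intro mult_mono l4) auto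
      thus "real k * gauss_moment 0 \<le> ?X * N ^ 4" by (simp add: mult_ac)
    qed
    have J4: "real (?J + 1) \<le> 2 * N ^ 4"
    proof -
      have "real (n * m1) \<le> N ^ 4" using le by (intro l4) auto
      moreover have "1 \<le> N ^ 4" using N1 by simp
      ultimately show ?thesis by simp
    qed
    have p5: "real (?J + 1) * (2 * ?\<epsilon>) \<le> 4 * ?Y"
      by (rule scale) (use J4 in simp)
    have p8: "real (?J + 1) * (4 * ?\<epsilon>) \<le> 8 * ?Y"
      by (rule scale) (use J4 in simp)
    have p9: "real d * (real d * ((2 + real m2 * (2 + real d * gauss_moment 0)) * ?\<epsilon>)) \<le> 4 * ?X * ?Y"
      unfolding mult.assoc[symmetric, of "real d" "real d"]
    proof (rule scale)
      have dm: "1 \<le> real m2 * real d" using mult_mono[of 1 "real m2" 1 "real d"] r1 by simp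
      have "real m2 * 2 \<le> real m2 * (2 * real d)" using r1 by (intro mult_left_mono) auto
      hence "2 + real m2 * (2 + real d * gauss_moment 0) \<le> real m2 * real d * (4 + gauss_moment 0)"
        using dm by (simp add: algebra_simps)
      also have "\<dots> \<le> real m2 * real d * (4 * ?X)" using X by (intro mult_left_mono) auto
      finally have "real d * real d * (2 + real m2 * (2 + real d * gauss_moment 0)) \<le> real d * real d * (real m2 * real d * (4 * ?X))"
        by (intro mult_left_mono) auto
      also have "\<dots> = 4 * ?X * (real d * real d * real m2 * real d)" by simp
      also have "\<dots> \<le> 4 * ?X * N ^ 4" using X le by (intro mult_left_mono l4) auto
      finally show "real d * real d * (2 + real m2 * (2 + real d * gauss_moment 0)) \<le> 4 * ?X * N ^ 4" .
    qed
    have XY: "3 * ?Y \<le> ?X * ?Y" using X Y0 by (intro mult_right_mono) auto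
    have XY4: "4 * ?X * ?Y = 4 * (?X * ?Y)" "40 * ?X * ?Y = 40 * (?X * ?Y)" by (simp_all only: mult.assoc)
    have XY0: "0 \<le> ?X * ?Y" using XY Y0 by linarith
    have c0: "real (card {..<m1}) * 0 = 0" "card {..<m1} = m1" by auto
    show "2 * (real d * ((2 + real n * tail_const) * ?\<epsilon>)) +
      (real d * (real d * ((2 + real n * tail_const) * ?\<epsilon>)) + (real n * (real d * (gauss_moment 0 * ?\<epsilon>)) +
         (real n * (gauss_moment 0 * ?\<epsilon>) + real (n * m1 + 1) * (2 * ?\<epsilon>))) +
       (real (card {..<m1}) * 0 + (real (card {..<m1}) * (gauss_moment 0 * ?\<epsilon>) +
         (real (n * m1 + 1) * (4 * ?\<epsilon>) +
          real d * (real d * ((2 + real m2 * (2 + real d * gauss_moment 0)) * ?\<epsilon>))))))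
      \<le> 40 * ?X * ?Y"
      unfolding c0 XY4(2)
      using p1 p2 p3 p4[OF le(2)] p4[OF le(5)] p5 p8 p9[unfolded XY4(1)] XY XY0 by linarith
  qed
qed

text \<open>The competitor is the importance weight of each unit at its own sign and bias;
  \<open>unit_fun_cell\<close> turns the random feature average into the output of the trained
  architecture with these weights.\<close>

lemma good_typical:
  fixes d n m1 m2 \<rho> :: nat and D1 D2 V :: "nat \<Rightarrow> nat \<Rightarrow> real" and a b w :: "nat \<Rightarrow> real"
  assumes pos: "d \<ge> 1" "n \<ge> 1" "m1 \<ge> 1" "m2 \<ge> 1" and w: "(\<Sum>k<d. (w k)\<^sup>2) = 1" and R: "1 \<le> R"
    and rho: "\<rho> = min n (min m1 m2)" "real d ^ 2 \<le> \<rho>" and good: "good d n m1 m2 R w (D1, D2, a, b, V)"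
  shows "typical_sample d n m1 m2 (n * m1) \<rho> (B R) R \<mu> (real d ^ 2 / \<rho> + 1 / sqrt n) g w D1 D2 V a b (\<lambda>i. coefR R (a i) (b i))"
proof -
  have g1: "good_D1 d n R w D1" and g2: "good_D2 d n (n * m1) R w D2" and ga: "\<And>i. i < m1 \<Longrightarrow> \<bar>a i\<bar> = 1"
    and gb: "\<And>i. i < m1 \<Longrightarrow> \<bar>b i\<bar> \<le> R" and gab: "good_ab m1 (n * m1) R a b" and gV: "good_V d m2 R V"
    using good by (auto simp: good_def)
  have RB: "R \<le> B R" by (rule R_le_B[OF R])
  show ?thesis
  proof
    show "sqrt (real n) \<le> real (n * m1)" "sqrt (real m1) \<le> real (n * m1)"
    proof -
      have "sqrt (real n) \<le> real n" "sqrt (real m1) \<le> real m1"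
        using pos by (auto intro!: real_le_lsqrt simp: power2_eq_square)
      moreover have "n \<le> n * m1" "m1 \<le> n * m1" using pos by auto
      hence "real n \<le> real (n * m1)" "real m1 \<le> real (n * m1)" by (simp_all only: of_nat_le_iff)
      ultimately show "sqrt (real n) \<le> real (n * m1)" "sqrt (real m1) \<le> real (n * m1)" by linarith+
    qed
    show "\<bar>\<mu>\<bar> \<le> B R" "1 / \<bar>\<mu>\<bar> \<le> B R"
      by (rule le_B[OF R, where i = 0 and q = "\<bar>\<mu>\<bar>"], use scale_ge in simp_all)
         (rule le_B[OF R, where i = 0 and q = "1 / \<bar>\<mu>\<bar>"], use scale_ge in simp_all)
    show "\<mu> \<noteq> 0" using positive_constants(4) by auto
    show "\<bar>coefR R (a i) (b i)\<bar> \<le> B R" if i: "i < m1" for i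
    proof -
      have "\<bar>coefR R (a i) (b i)\<bar> \<le> 10 * M R / std_normal_density 2 * indicator {0<..2} (b i)"
        using hR_bounds[OF R] ga[OF i] by (rule unit_coef_bound)
      also have "\<dots> \<le> 10 * M R / std_normal_density 2 * 1"
        using M_pos[OF R] by (intro mult_left_mono) (auto simp: indicator_def)
      also have "\<dots> \<le> B R" using unit_le_B(2)[OF R] by simp
      finally show ?thesis .
    qed
    show "\<bar>(\<Sum>s<n. indicator {grid R (n * m1) j..} (dotp d w (D2 s))) / real n - measure std_normal {grid R (n * m1) j..}\<bar>
        \<le> B R / sqrt n" if "j \<le> n * m1" for j
    proof -
      have "R / sqrt n \<le> B R / sqrt n" using RB by (intro divide_right_mono) auto
      thus ?thesis using g2 that unfolding good_D2_def by (meson atMost_iff order_trans)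
    qed
    show "\<bar>ridge_net m1 a b (\<lambda>i. coefR R (a i) (b i)) (grid R (n * m1) j / R) - g (grid R (n * m1) j)\<bar> \<le> B R / sqrt m1"
      if j: "j \<le> n * m1" for j
    proof -
      let ?s = "grid R (n * m1) j / R"
      have "ridge_net m1 a b (\<lambda>i. coefR R (a i) (b i)) ?s = (\<Sum>i<m1. unitR R ?s (a i) (b i)) / real m1"
        unfolding ridge_net_def using ga by (simp add: unit_fun_cell)
      moreover have "hR R ?s = g (grid R (n * m1) j)" using R by (simp add: hR_def)
      moreover have "\<bar>(\<Sum>i<m1. unitR R ?s (a i) (b i)) / real m1 - hR R ?s\<bar> \<le> 2 * (30 * M R / std_normal_density 2) * R / sqrt m1"
        using gab j unfolding good_ab_def by blast
      moreover have "2 * (30 * M R / std_normal_density 2) * R / sqrt m1 \<le> B R / sqrt m1"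
        by (intro divide_right_mono unit_le_B R) simp
      ultimately show ?thesis by linarith
    qed
    show "\<bar>b i\<bar> \<le> B R" if "i < m1" for i using gb[OF that] RB by linarith
    show "\<bar>D2 s k\<bar> \<le> B R" if "s < n" "k < d" for s k
    proof -
      have "\<bar>D2 s k\<bar> \<le> R" using g2 that by (auto simp: good_D2_def)
      thus ?thesis using RB by linarith
    qed
    show "\<bar>(\<Sum>s<n. g (dotp d w (D1 s)) * D1 s k) / real n - \<mu> * w k\<bar> \<le> B R / sqrt n" if "k < d" for k
      using g1 that unfolding good_D1_def by blast
    show "\<bar>(\<Sum>s<n. D1 s k) / real n\<bar> \<le> B R / sqrt n" if "k < d" for k
      using g1 that unfolding good_D1_def by blast
    show "\<bar>(\<Sum>s<n. D2 s k * D2 s l) / real n - (if k = l then 1 else 0)\<bar> \<le> B R / sqrt n" if "k < d" "l < d" for k l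
      using g2 that unfolding good_D2_def by blast
    show "\<bar>dotp d w (D2 s)\<bar> \<le> R" if "s < n" for s
      using g2 that unfolding good_D2_def by blast
    show "\<bar>real d / real m2 * (\<Sum>j<m2. V j k * V j l) - (if k = l then 1 else 0)\<bar> \<le> B R / sqrt m2" if "k < d" "l < d" for k l
      using gV that unfolding good_V_def by blast
    show "\<bar>g x\<bar> \<le> B R" if "\<bar>x\<bar> \<le> R" for x by (rule g_B(1)[OF R that])
    show "\<bar>g x - g y\<bar> \<le> B R * \<bar>x - y\<bar>" if "\<bar>x\<bar> \<le> R" "\<bar>y\<bar> \<le> R" for x y by (rule g_Lipschitz[OF R that])
    show "\<bar>a i\<bar> = 1" if "i < m1" for i by (rule ga[OF that])
  qed (use pos w R rho RB in simp_all)
qed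

section \<open>Population risk in the two regimes\<close>

lemma g_square_integrable: "integrable std_normal (\<lambda>z. (g z)\<^sup>2)"
proof (rule integrable_std_normal_poly[where C = "A\<^sup>2" and k = "m * 2"])
  fix z show "\<bar>(g z)\<^sup>2\<bar> \<le> A\<^sup>2 * (1 + \<bar>z\<bar>) ^ (m * 2)"
    using power_mono[OF g_le[of z], of 2] by (simp add: power_mult_distrib power_mult)
qed measurable

text \<open>For a fresh input the error along \<open>u\<close> splits into the direction error,
  whose second moment is exactly the squared norm of \<open>u - w\<close>, and the error along
  \<open>w\<close>. With A = 18 B^6 the powers are B^20 and B^21; the coefficients add up to less
  than 10^6.\<close>

lemma main_regime:
  fixes d n m1 m2 \<rho> T :: nat and \<eta>1 \<eta>2 lam e R :: real
  assumes pos: "d \<ge> 1" "n \<ge> 1" "m1 \<ge> 1" "m2 \<ge> 1" and w: "(\<Sum>k<d. (w k)\<^sup>2) = 1" and R: "1 \<le> R"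
    and rho: "\<rho> = min n (min m1 m2)" "real d ^ 2 \<le> \<rho>" and good: "good d n m1 m2 R w \<omega>"
    and tail: "(\<integral>z. (1 + z\<^sup>2 + (g z)\<^sup>2) * indicator {z. R < \<bar>z\<bar>} z \<partial>std_normal) \<le> 1 / n"
    and e: "e = real d ^ 2 / \<rho> + 1 / sqrt n"
    and eta1: "\<eta>1 = real m1 * real d * (1 / R) / (2 * real m2 * \<mu>)"
    and eta2: "\<eta>2 = 1 / (100 * B R ^ 10 * real d ^ 2)" and lam: "lam = e / m1"
    and T: "real (T - 1) \<ge> 2 * real m1 * real n / \<eta>2"
  shows "(case layerwise_train d n m1 m2 \<eta>1 \<eta>2 lam T (\<lambda>x. g (dotp d w x)) \<omega> of (a, W, b, V) \<Rightarrow>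
      (\<integral>\<^sup>+ x. ennreal ((net d m1 m2 a W b V x - g (dotp d w x))\<^sup>2) \<partial>gauss_vec d)) \<le> ennreal (10 ^ 6 * B R ^ 21 * e)"
proof -
  obtain D1 D2 a0 b V where \<omega>: "\<omega> = (D1, D2, a0, b, V)" by (metis prod_cases5)
  interpret T: typical_sample d n m1 m2 "n * m1" \<rho> "B R" R \<mu> e g w D1 D2 V a0 b "\<lambda>i. coefR R (a0 i) (b i)"
    unfolding e by (rule good_typical[OF pos w R rho good[unfolded \<omega>]])
  let ?B = "B R"
  obtain a W where train: "layerwise_train d n m1 m2 \<eta>1 \<eta>2 lam T (\<lambda>x. g (dotp d w x)) (D1, D2, a0, b, V) = (a, W, b, V)"
    and net: "\<And>x. net d m1 m2 a W b V x = T.F a (dotp d T.u x)"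
    and risk: "T.risk a \<le> 152 * ?B ^ 11 * e" and mean: "(\<Sum>i<m1. \<bar>a i\<bar>) / real m1 \<le> 18 * ?B ^ 6"
    by (rule T.training[OF eta1 eta2 lam T]) blast
  let ?A = "18 * ?B ^ 6"
  have A1: "1 \<le> ?A" using T.B_pow1[of 6] by linarith
  note pop = T.population_\<psi>[OF mean A1 g_measurable g_square_integrable integrable_std_normal_square prob_space_std_normal tail]
  have e0: "0 < e" by (rule T.e_bounds(3))
  have \<psi>m[measurable]: "T.\<psi> a \<in> borel_measurable borel"
    using pop(1) by (simp add: integrable_iff_bounded cong: measurable_cong_sets)
  have "(\<integral>\<^sup>+ x. ennreal ((net d m1 m2 a W b V x - g (dotp d w x))\<^sup>2) \<partial>gauss_vec d)
      \<le> (\<integral>\<^sup>+ x. ennreal (2 * ?A\<^sup>2) * ennreal ((dotp d T.v x)\<^sup>2) + ennreal 2 * ennreal (T.\<psi> a (dotp d w x)) \<partial>gauss_vec d)"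
  proof (rule nn_integral_mono)
    fix x
    have "(net d m1 m2 a W b V x - g (dotp d w x))\<^sup>2 \<le> 2 * ?A\<^sup>2 * (dotp d T.v x)\<^sup>2 + 2 * T.\<psi> a (dotp d w x)"
      unfolding net by (rule T.pointwise_error[OF mean])
    hence "ennreal ((net d m1 m2 a W b V x - g (dotp d w x))\<^sup>2) \<le> ennreal (2 * ?A\<^sup>2 * (dotp d T.v x)\<^sup>2 + 2 * T.\<psi> a (dotp d w x))"
      by (rule ennreal_leI)
    also have "\<dots> = ennreal (2 * ?A\<^sup>2) * ennreal ((dotp d T.v x)\<^sup>2) + ennreal 2 * ennreal (T.\<psi> a (dotp d w x))"
      by (subst ennreal_plus) (auto simp: ennreal_mult)
    finally show "ennreal ((net d m1 m2 a W b V x - g (dotp d w x))\<^sup>2)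
      \<le> ennreal (2 * ?A\<^sup>2) * ennreal ((dotp d T.v x)\<^sup>2) + ennreal 2 * ennreal (T.\<psi> a (dotp d w x))" .
  qed
  also have "\<dots> = ennreal (2 * ?A\<^sup>2) * (\<integral>\<^sup>+ x. ennreal ((dotp d T.v x)\<^sup>2) \<partial>gauss_vec d)
      + ennreal 2 * (\<integral>\<^sup>+ x. ennreal (T.\<psi> a (dotp d w x)) \<partial>gauss_vec d)"
    by (subst nn_integral_add) (auto simp: nn_integral_cmult)
  also have "(\<integral>\<^sup>+ x. ennreal (T.\<psi> a (dotp d w x)) \<partial>gauss_vec d) = ennreal (integral\<^sup>L std_normal (T.\<psi> a))"
    by (subst nn_integral_dotp[OF w, of "\<lambda>z. ennreal (T.\<psi> a z)"]) (auto intro!: nn_integral_eq_integral pop(1))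
  also have "(\<integral>\<^sup>+ x. ennreal ((dotp d T.v x)\<^sup>2) \<partial>gauss_vec d) = ennreal (\<Sum>k<d. (T.v k)\<^sup>2)"
    by (rule nn_integral_dotp_square)
  also have "ennreal (2 * ?A\<^sup>2) * ennreal (\<Sum>k<d. (T.v k)\<^sup>2) + ennreal 2 * ennreal (integral\<^sup>L std_normal (T.\<psi> a))
      = ennreal (2 * ?A\<^sup>2 * (\<Sum>k<d. (T.v k)\<^sup>2) + 2 * integral\<^sup>L std_normal (T.\<psi> a))"
    by (subst ennreal_plus) (auto simp: ennreal_mult sum_nonneg intro!: Bochner_Integration.integral_nonneg)
  also have "\<dots> \<le> ennreal (10 ^ 6 * ?B ^ 21 * e)"
  proof (rule ennreal_leI)
    have "2 * ?A\<^sup>2 * (\<Sum>k<d. (T.v k)\<^sup>2) \<le> 2 * ?A\<^sup>2 * (25 * ?B ^ 8 * e)"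
      using T.v_norm by (intro mult_left_mono) auto
    also have "\<dots> = 16200 * (?B ^ 20 * e)" by (simp add: power_mult_distrib power_mult[symmetric] power_add[symmetric])
    also have "\<dots> \<le> 16200 * (?B ^ 21 * e)" using T.B_pow[of 20 21] e0 by (intro mult_left_mono mult_right_mono) auto
    finally have 1: "2 * ?A\<^sup>2 * (\<Sum>k<d. (T.v k)\<^sup>2) \<le> 16200 * (?B ^ 21 * e)" .
    have "T.risk a \<le> 152 * (?B ^ 11 * e)" using risk by (simp only: mult.assoc)
    also have "\<dots> \<le> 152 * (?B ^ 21 * e)" using T.B_pow[of 11 21] e0 by (intro mult_left_mono mult_right_mono) auto
    finally have 2: "T.risk a \<le> 152 * (?B ^ 21 * e)" .
    have 3: "185 * ?A\<^sup>2 * ?B ^ 9 * e = 59940 * (?B ^ 21 * e)"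
      by (simp add: power_mult_distrib power_mult[symmetric] power_add[symmetric])
    have 4: "0 \<le> ?B ^ 21 * e" using T.B1 e0 by simp
    show "2 * ?A\<^sup>2 * (\<Sum>k<d. (T.v k)\<^sup>2) + 2 * integral\<^sup>L std_normal (T.\<psi> a) \<le> 10 ^ 6 * ?B ^ 21 * e"
    proof -
      have "X \<le> 16200 * t \<Longrightarrow> I \<le> 2 * r + 59940 * t \<Longrightarrow> r \<le> 152 * t \<Longrightarrow> 0 \<le> t \<Longrightarrow> X + 2 * I \<le> 10 ^ 6 * t"
        for X I r t :: real by simp
      from this[OF 1 pop(2)[unfolded 3] 2 4] show ?thesis by (simp only: mult.assoc)
    qed
  qed
  finally show ?thesis unfolding \<omega> train by simp
qed

text \<open>Zero step sizes and \<open>T = 1\<close> leave the network at initialization, where it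
  is a constant of size at most \<open>R\<close>. Together with the normalization of
  \<open>g\<close> the risk is at most 2 R^2 + 2.\<close>

lemma trivial_regime:
  fixes d n m1 m2 :: nat and R :: real
  assumes m1: "m1 \<ge> 1" and w: "(\<Sum>k<d. (w k)\<^sup>2) = 1" and R: "1 \<le> R" and good: "good d n m1 m2 R w \<omega>"
  shows "(case layerwise_train d n m1 m2 0 0 0 1 (\<lambda>x. g (dotp d w x)) \<omega> of (a, W, b, V) \<Rightarrow>
      (\<integral>\<^sup>+ x. ennreal ((net d m1 m2 a W b V x - g (dotp d w x))\<^sup>2) \<partial>gauss_vec d)) \<le> ennreal (4 * R\<^sup>2)"
proof -
  obtain D1 D2 a b V where \<omega>: "\<omega> = (D1, D2, a, b, V)" by (metis prod_cases5)
  have train: "layerwise_train d n m1 m2 0 0 0 1 (\<lambda>x. g (dotp d w x)) \<omega> = (a, \<lambda>_ _. 0, b, V)"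
    by (simp add: layerwise_train_def \<omega>)
  have ga: "\<And>i. i < m1 \<Longrightarrow> \<bar>a i\<bar> = 1" and gb: "\<And>i. i < m1 \<Longrightarrow> \<bar>b i\<bar> \<le> R"
    using good by (auto simp: good_def \<omega>)
  define c where "c = (1 / real m1) * (\<Sum>i<m1. a i * relu (b i))"
  have "\<bar>\<Sum>i<m1. a i * relu (b i)\<bar> \<le> (\<Sum>i<m1. R)"
  proof (rule order_trans[OF sum_abs], rule sum_mono)
    fix i assume "i \<in> {..<m1}"
    thus "\<bar>a i * relu (b i)\<bar> \<le> R" using ga[of i] gb[of i] R by (auto simp: abs_mult relu_def max_def)
  qed
  hence "\<bar>c\<bar> \<le> R" using m1 by (simp add: c_def abs_divide field_simps)
  hence c2: "c\<^sup>2 \<le> R\<^sup>2" using power_mono[of "\<bar>c\<bar>" R 2] by simp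
  have "(\<integral>\<^sup>+ x. ennreal ((net d m1 m2 a (\<lambda>_ _. 0) b V x - g (dotp d w x))\<^sup>2) \<partial>gauss_vec d)
      = (\<integral>\<^sup>+ z. ennreal ((c - g z)\<^sup>2) \<partial>std_normal)"
    unfolding net_W_zero c_def[symmetric]
    by (rule nn_integral_dotp[OF w, of "\<lambda>z. ennreal ((c - g z)\<^sup>2)"]) measurable
  also have "\<dots> \<le> (\<integral>\<^sup>+ z. ennreal (2 * c\<^sup>2 + 2 * (g z)\<^sup>2) \<partial>std_normal)"
  proof (intro nn_integral_mono ennreal_leI)
    fix z
    have "0 \<le> (c + g z)\<^sup>2" by simp
    thus "(c - g z)\<^sup>2 \<le> 2 * c\<^sup>2 + 2 * (g z)\<^sup>2" by (simp add: power2_sum power2_diff)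
  qed
  also have "\<dots> = ennreal (\<integral>z. 2 * c\<^sup>2 + 2 * (g z)\<^sup>2 \<partial>std_normal)"
    using g_square_integrable by (intro nn_integral_eq_integral) auto
  also have "(\<integral>z. 2 * c\<^sup>2 + 2 * (g z)\<^sup>2 \<partial>std_normal) = 2 * c\<^sup>2 + 2 * (\<integral>z. (g z)\<^sup>2 \<partial>std_normal)"
    using g_square_integrable std_normal.prob_space by simp
  also have "\<dots> \<le> 4 * R\<^sup>2"
    using c2 normalization R one_le_power[OF R, of 2] by linarith
  finally show ?thesis unfolding train by (simp add: ennreal_leI)
qed

lemma tail_integral:
  assumes "R \<ge> 0"
  shows "(\<integral>z. (1 + z\<^sup>2 + (g z)\<^sup>2) * indicator {z. R < \<bar>z\<bar>} z \<partial>std_normal)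
    \<le> 3 * A\<^sup>2 * gauss_moment (2 * m) * exp (- R\<^sup>2 / 4)"
proof (rule gauss_tail_integral[OF _ _ assms])
  fix z
  have A2: "1 \<le> A\<^sup>2" using A by simp
  have sq: "x\<^sup>2 \<le> A\<^sup>2 * (1 + \<bar>z\<bar>) ^ (2 * m)" if "\<bar>x\<bar> \<le> A * (1 + \<bar>z\<bar>) ^ m" for x
    using power_mono[OF that, of 2] by (simp add: power_mult_distrib power_mult[symmetric] mult.commute)
  from sq[OF one_le] sq[OF id_le] sq[OF g_le]
  have "1 + z\<^sup>2 + (g z)\<^sup>2 \<le> 3 * (A\<^sup>2 * (1 + \<bar>z\<bar>) ^ (2 * m))" by simp
  moreover have "0 \<le> 1 + z\<^sup>2 + (g z)\<^sup>2" by simp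
  ultimately show "\<bar>1 + z\<^sup>2 + (g z)\<^sup>2\<bar> \<le> 3 * A\<^sup>2 * (1 + \<bar>z\<bar>) ^ (2 * m)" by (simp add: mult_ac)
qed measurable

text \<open>Makes the constant in front of the Gaussian tail at most \<open>C\<close>, hence at most
  \<open>exp (C + 10)\<close>; the factor \<open>exp (- (C + 10))\<close> contained in
  \<open>exp (- R\<^sup>2 / 4)\<close> then absorbs it.\<close>

definition C_threshold :: real where "C_threshold = 1 + 3 * A\<^sup>2 * gauss_moment (2 * m)"

theorem layerwise_training_risk:
  assumes C: "C \<ge> C_threshold"
  shows "\<exists>(K::real) (p::nat) (r::nat). \<forall>d n m1 m2::nat. d \<ge> 1 \<longrightarrow> n \<ge> 1 \<longrightarrow> m1 \<ge> 1 \<longrightarrow> m2 \<ge> 1 \<longrightarrow>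
      (let N = real (d * n * m1 * m2); \<iota> = C * ln N in
       \<exists>\<eta>1 \<eta>2 lam :: real. \<exists>T::nat. T \<ge> 1 \<and> real T \<le> K * N ^ r \<and>
         (\<forall>w. (\<Sum>k<d. (w k)\<^sup>2) = 1 \<longrightarrow>
            (let fstar = (\<lambda>x. g (dotp d w x)) in
             \<exists>E \<in> sets (sample_space d n m1 m2).
               measure (sample_space d n m1 m2) E \<ge> 1 - 40 * (2 + tail_const) * N ^ 0 * exp (- \<iota>) \<and>
               (\<forall>\<omega>\<in>E.
                  (case layerwise_train d n m1 m2 \<eta>1 \<eta>2 lam T fstar \<omega> of (a, W, b, V) \<Rightarrow>
                    (\<integral>\<^sup>+ x. ennreal ((net d m1 m2 a W b V x - fstar x)\<^sup>2) \<partial>gauss_vec d))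
                  \<le> ennreal (K * (1 + ln N) ^ p *
                       (real d ^ 2 / real (min n (min m1 m2)) + 1 / sqrt (real n)))))))"
proof -
  have "0 \<le> 3 * A\<^sup>2 * gauss_moment (2 * m)" using gauss_moment_nonneg by simp
  with C have C1: "C \<ge> 1" unfolding C_threshold_def by linarith
  define P where "P = 2 * m + 3"
  \<comment> \<open>With \<open>R\<^sup>2 = \<kappa> * (1 + ln N)\<close>, the quantity
    \<open>exp (- R\<^sup>2 / 4)\<close> splits into \<open>exp (- (C + 10))\<close> for the tail
    constant, \<open>exp (- (C * ln N))\<close> for the required failure probability, and
    \<open>1 / N ^ 10\<close> for the polynomial factors.\<close>
  define \<kappa> where "\<kappa> = 4 * (C + 10)"
  have \<kappa>: "1 \<le> \<kappa>" using C1 by (simp add: \<kappa>_def)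
  \<comment> \<open>The logarithm-free part of \<open>10 ^ 6 * B R ^ 21\<close>. It also dominates
    the constants in the bound for \<open>T\<close> and in the trivial regime.\<close>
  define K where "K = 10 ^ 6 * scale ^ 21 * \<kappa> ^ (21 * P)"
  have K1: "202 * scale ^ 10 * \<kappa> ^ (10 * P) \<le> K" "4 * \<kappa> \<le> K" "1 \<le> K"
  proof -
    have q: "1 \<le> scale ^ i" "scale ^ 10 \<le> scale ^ 21" for i using scale_ge(1) by (auto intro: one_le_power power_increasing)
    have k: "\<kappa> ^ (10 * P) \<le> \<kappa> ^ (21 * P)" "\<kappa> ^ 1 \<le> \<kappa> ^ (21 * P)" "1 \<le> \<kappa> ^ (21 * P)"
      by (rule power_increasing, simp, rule \<kappa>)
         (rule power_increasing, simp add: P_def, rule \<kappa>, rule one_le_power, rule \<kappa>)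
    have qk: "scale ^ 10 * \<kappa> ^ (10 * P) \<le> scale ^ 21 * \<kappa> ^ (21 * P)" "1 * \<kappa> ^ 1 \<le> scale ^ 21 * \<kappa> ^ (21 * P)" "1 * 1 \<le> scale ^ 21 * \<kappa> ^ (21 * P)"
      using q k \<kappa> scale_ge(1) by (intro mult_mono; simp)+
    show "202 * scale ^ 10 * \<kappa> ^ (10 * P) \<le> K" "4 * \<kappa> \<le> K" "1 \<le> K"
    proof -
      have "s \<le> t \<Longrightarrow> 1 \<le> t \<Longrightarrow> 202 * s \<le> 10 ^ 6 * t" "s \<le> t \<Longrightarrow> 1 \<le> t \<Longrightarrow> 4 * s \<le> 10 ^ 6 * t"
        "1 \<le> t \<Longrightarrow> 1 \<le> 10 ^ 6 * t" for s t :: real by simp_all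
      note c = this
      show "202 * scale ^ 10 * \<kappa> ^ (10 * P) \<le> K" "4 * \<kappa> \<le> K" "1 \<le> K"
        using c(1)[OF qk(1)] c(2)[OF qk(2)] c(3) qk(3)
        unfolding K_def mult.assoc mult_1 power_one_right by blast+
    qed
  qed
  show ?thesis
  proof (rule exI[of _ K], rule exI[of _ "21 * P"], rule exI[of _ "10 * P + 2"], intro allI impI)
    fix d n m1 m2 :: nat
    assume pos: "d \<ge> 1" "n \<ge> 1" "m1 \<ge> 1" "m2 \<ge> 1"
    define N where "N = real (d * n * m1 * m2)"
    \<comment> \<open>The summand 1 keeps \<open>R\<close> at least 1 even when
      \<open>N = 1\<close>.\<close>
    define L where "L = 1 + ln N"
    define R where "R = sqrt (\<kappa> * L)"
    define \<rho> where "\<rho> = min n (min m1 m2)"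
    define e where "e = real d ^ 2 / \<rho> + 1 / sqrt n"
    let ?\<epsilon> = "exp (- R\<^sup>2 / 4)"
    have "1 \<le> d * n * m1 * m2" using pos by simp
    hence N1: "1 \<le> N" unfolding N_def by linarith
    have "d \<le> d * n * m1 * m2" "n \<le> d * n * m1 * m2" "m2 \<le> d * n * m1 * m2" "m1 \<le> d * n * m1 * m2" "d * d * m1 * n \<le> (d * n * m1 * m2) * (d * n * m1 * m2)"
    proof -
      show "d * d * m1 * n \<le> (d * n * m1 * m2) * (d * n * m1 * m2)"
      proof -
        have a: "d \<le> d * n * m1 * m2" using pos by simp
        have "d * m1 * n * 1 \<le> d * m1 * n * m2" using pos by (intro mult_le_mono2) simp
        hence b: "d * m1 * n \<le> d * n * m1 * m2" by (simp only: mult_1_right mult_ac)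
        have "d * (d * m1 * n) \<le> (d * n * m1 * m2) * (d * n * m1 * m2)" by (rule mult_le_mono[OF a b])
        thus ?thesis by (simp add: mult.assoc)
      qed
    qed (use pos in auto)
    hence le: "real d \<le> N" "real n \<le> N" "real m2 \<le> N" "real m1 \<le> N" "real (d * d * m1 * n) \<le> N * N"
      unfolding N_def of_nat_mult[symmetric] by (simp_all only: of_nat_le_iff)
    have L1: "1 \<le> L" using N1 by (simp add: L_def)
    have LN: "L \<le> N" using ln_le_minus_one[of N] N1 by (simp add: L_def)
    have \<kappa>L: "1 \<le> \<kappa> * L" using mult_mono[OF \<kappa> L1] \<kappa> by simp
    have R1: "1 \<le> R" using \<kappa>L by (simp add: R_def)
    have R2: "R\<^sup>2 = \<kappa> * L" using \<kappa>L by (simp add: R_def)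
    have RL: "R \<le> \<kappa> * L" unfolding R_def by (rule real_le_lsqrt) (use \<kappa>L self_le_power[OF \<kappa>L, of 2] in linarith, use \<kappa>L self_le_power[OF \<kappa>L, of 2] in simp)
    have \<epsilon>: "?\<epsilon> = exp (- (C + 10)) * (exp (- (C * ln N)) * (1 / N ^ 10))"
    proof -
      have "- R\<^sup>2 / 4 = - ((C + 10) * (1 + ln N))" by (simp add: R2 \<kappa>_def L_def)
      also have "\<dots> = - (C + 10) + (- (C * ln N) + (- (10 * ln N)))" by (simp add: algebra_simps)
      finally have "- R\<^sup>2 / 4 = - (C + 10) + (- (C * ln N) + (- (10 * ln N)))" .
      moreover have "exp (- (10 * ln N)) = 1 / N ^ 10"
        using N1 exp_of_nat_mult[of 10 "ln N"] by (simp add: exp_minus inverse_eq_divide)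
      ultimately show ?thesis by (simp only: exp_add)
    qed
    have N10: "0 < N ^ 10" using N1 by simp
    have eC: "exp (- (C + 10)) \<le> 1" "exp (- (C * ln N)) \<le> 1" using C1 N1 by auto
    have small0: "?\<epsilon> \<le> exp (- (C * ln N)) * (1 / N ^ 10)" "?\<epsilon> \<le> exp (- (C + 10)) * (1 / N ^ 10)"
    proof -
      have "?\<epsilon> \<le> 1 * (exp (- (C * ln N)) * (1 / N ^ 10))"
        unfolding \<epsilon> using eC N10 by (intro mult_right_mono) auto
      thus "?\<epsilon> \<le> exp (- (C * ln N)) * (1 / N ^ 10)" by simp
      have "?\<epsilon> \<le> exp (- (C + 10)) * (1 * (1 / N ^ 10))"
        unfolding \<epsilon> using eC N10 by (intro mult_left_mono mult_right_mono) auto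
      thus "?\<epsilon> \<le> exp (- (C + 10)) * (1 / N ^ 10)" by simp
    qed
    have Np: "N ^ i \<le> N ^ 10" if "i \<le> 10" for i using N1 that by (intro power_increasing) auto
    have eN: "?\<epsilon> \<le> 1 / N ^ 10"
    proof -
      have "exp (- (C + 10)) * (1 / N ^ 10) \<le> 1 * (1 / N ^ 10)" using eC N10 by (intro mult_right_mono) auto
      thus ?thesis using small0(2) by simp
    qed
    have inv: "1 / N ^ 10 \<le> 1 / n"
      using Np[of 1] le(2) pos N1 by (intro divide_left_mono) auto
    have small1: "?\<epsilon> \<le> 1 / n" using eN inv by linarith
    have small2: "real d ^ 5 * ?\<epsilon> \<le> 1 / m2"
    proof -
      have "real d ^ 5 * ?\<epsilon> \<le> N ^ 5 * (1 / N ^ 10)" using le(1) eN N1 by (intro mult_mono power_mono) auto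
      also have "\<dots> = 1 / N ^ 5" using N1 by (simp add: field_simps flip: power_add)
      also have "\<dots> \<le> 1 / m2"
      proof (rule divide_left_mono)
        have "N ^ 1 \<le> N ^ 5" using N1 by (intro power_increasing) auto
        thus "real m2 \<le> N ^ 5" using le(3) by simp
      qed (use pos N1 in auto)
      finally show ?thesis .
    qed
    have tail: "(\<integral>z. (1 + z\<^sup>2 + (g z)\<^sup>2) * indicator {z. R < \<bar>z\<bar>} z \<partial>std_normal) \<le> 1 / n"
    proof -
      let ?c = "3 * A\<^sup>2 * gauss_moment (2 * m)"
      have c0: "0 \<le> ?c" using gauss_moment_nonneg by simp
      have "?c \<le> exp (C + 10)" using C exp_ge_add_one_self[of "C + 10"] by (simp add: C_threshold_def)
      hence "?c * exp (- (C + 10)) \<le> exp (C + 10) * exp (- (C + 10))" by (intro mult_right_mono) auto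
      hence c1: "?c * exp (- (C + 10)) \<le> 1" by (simp add: exp_add[symmetric])
      have "(\<integral>z. (1 + z\<^sup>2 + (g z)\<^sup>2) * indicator {z. R < \<bar>z\<bar>} z \<partial>std_normal) \<le> ?c * ?\<epsilon>"
        by (rule tail_integral) (use R1 in simp)
      also have "\<dots> \<le> ?c * (exp (- (C + 10)) * (1 / N ^ 10))" using small0(2) c0 by (rule mult_left_mono)
      also have "\<dots> = (?c * exp (- (C + 10))) * (1 / N ^ 10)" by simp
      also have "\<dots> \<le> 1 * (1 / N ^ 10)" using c1 N10 by (intro mult_right_mono) auto
      finally show ?thesis using inv by linarith
    qed
    define \<eta>2 where "\<eta>2 = 1 / (100 * B R ^ 10 * real d ^ 2)"
    \<comment> \<open>The algorithm performs \<open>T - 1\<close> steps on the output weights, hence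
      the added 1.\<close>
    define T where "T = 1 + nat \<lceil>2 * real m1 * real n / \<eta>2\<rceil>"
    have BR1: "1 \<le> B R" using R_le_B[OF R1] R1 by linarith
    have BK: "B R ^ i \<le> scale ^ i * \<kappa> ^ (i * P) * L ^ (i * P)" for i
    proof -
      have "B R \<le> scale * (\<kappa> * L) ^ P" unfolding B_def P_def[symmetric] using RL R1 scale_ge(1) by (intro mult_left_mono power_mono) auto
      hence "B R ^ i \<le> (scale * (\<kappa> * L) ^ P) ^ i" using BR1 by (intro power_mono) auto
      also have "\<dots> = scale ^ i * \<kappa> ^ (i * P) * L ^ (i * P)"
        by (simp add: power_mult_distrib power_mult[symmetric] mult.commute[of P])
      finally show ?thesis .
    qed
    have T1: "real (T - 1) \<ge> 2 * real m1 * real n / \<eta>2"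
      unfolding T_def using real_nat_ceiling_ge by simp
    have T2: "real T \<le> K * N ^ (10 * P + 2)"
    proof -
      have x: "2 * real m1 * real n / \<eta>2 = 200 * B R ^ 10 * real (d * d * m1 * n)"
        by (simp add: \<eta>2_def power2_eq_square)
      have "1 \<le> d * d * m1 * n" using pos by simp
      hence dm: "1 \<le> real (d * d * m1 * n)" by linarith
      have one: "1 * 1 \<le> B R ^ 10 * real (d * d * m1 * n)" using BR1 dm by (intro mult_mono) (auto intro: one_le_power)
      have "real T \<le> 2 + 2 * real m1 * real n / \<eta>2"
      proof -
        have "0 \<le> 2 * real m1 * real n / \<eta>2" using x one by linarith
        hence "real (nat \<lceil>2 * real m1 * real n / \<eta>2\<rceil>) = of_int \<lceil>2 * real m1 * real n / \<eta>2\<rceil>"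
          by (intro of_nat_nat) simp
        thus ?thesis unfolding T_def using of_int_ceiling_le_add_one[of "2 * real m1 * real n / \<eta>2"]
          by (simp only: of_nat_add of_nat_1)
      qed
      also have "\<dots> \<le> 202 * (B R ^ 10 * real (d * d * m1 * n))"
      proof -
        have "1 * 1 \<le> y \<Longrightarrow> 2 + 200 * y \<le> 202 * y" for y :: real by simp
        from this[OF one] show ?thesis unfolding x by (simp only: mult.assoc)
      qed
      also have "\<dots> \<le> 202 * ((scale ^ 10 * \<kappa> ^ (10 * P) * L ^ (10 * P)) * (N * N))"
      proof (intro mult_left_mono mult_mono BK le(5))
        show "0 \<le> scale ^ 10 * \<kappa> ^ (10 * P) * L ^ (10 * P)"
          using scale_ge(1) \<kappa> L1 by (intro mult_nonneg_nonneg zero_le_power) auto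
      qed simp_all
      also have "\<dots> = (202 * scale ^ 10 * \<kappa> ^ (10 * P)) * (L ^ (10 * P) * N\<^sup>2)" by (simp add: power2_eq_square)
      also have "\<dots> \<le> K * (N ^ (10 * P) * N\<^sup>2)"
        using K1 LN L1 N1 by (intro mult_mono power_mono) auto
      finally show ?thesis by (simp only: power_add)
    qed
    have e0: "0 \<le> e" by (simp add: e_def)
    have prob: "\<exists>E\<in>sets (sample_space d n m1 m2).
        measure (sample_space d n m1 m2) E \<ge> 1 - 40 * (2 + tail_const) * N ^ 0 * exp (- (C * ln N)) \<and> (\<forall>\<omega>\<in>E. good d n m1 m2 R w \<omega>)"
      if w: "(\<Sum>k<d. (w k)\<^sup>2) = 1" for w
    proof -
      let ?S = "sample_space d n m1 m2"
      interpret S: prob_space ?S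
        unfolding sample_space_def
        by (intro prob_space_pair prob_space_dataset prob_space_PiM prob_space_rademacher prob_space_std_normal prob_space_sphere_unif)
      have W: "whp ?S (40 * (2 + tail_const) * (N ^ 4 * ?\<epsilon>)) (good d n m1 m2 R w)"
        unfolding N_def by (rule whp_good[OF pos w R1 small1 small2])
      note [measurable] = whp_pred[OF W]
      let ?E = "{\<omega> \<in> space ?S. good d n m1 m2 R w \<omega>}"
      have E: "?E \<in> sets ?S" by measurable
      have "measure ?S {\<omega> \<in> space ?S. \<not> good d n m1 m2 R w \<omega>} = 1 - measure ?S ?E"
        by (rule S.prob_neg) measurable
      hence "measure ?S ?E \<ge> 1 - 40 * (2 + tail_const) * (N ^ 4 * ?\<epsilon>)" using whp_measure[OF W] by linarith
      \<comment> \<open>The union bound factor \<open>N ^ 4\<close> is absorbed by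
        \<open>1 / N ^ 10\<close>, so the final failure probability carries no power of
        \<open>N\<close>.\<close>
      moreover have "N ^ 4 * ?\<epsilon> \<le> exp (- (C * ln N))"
      proof -
        have "N ^ 4 * ?\<epsilon> \<le> N ^ 10 * (exp (- (C * ln N)) * (1 / N ^ 10))"
          using Np[of 4] small0(1) N1 by (intro mult_mono) auto
        also have "\<dots> = exp (- (C * ln N))" using N10 by simp
        finally show ?thesis .
      qed
      hence "40 * (2 + tail_const) * (N ^ 4 * ?\<epsilon>) \<le> 40 * (2 + tail_const) * exp (- (C * ln N))"
        using positive_constants(2) by (intro mult_left_mono) auto
      ultimately have "measure ?S ?E \<ge> 1 - 40 * (2 + tail_const) * N ^ 0 * exp (- (C * ln N))" by simp
      thus ?thesis using E by blast
    qed
    have "\<exists>\<eta>1 \<eta>2 lam :: real. \<exists>T::nat. T \<ge> 1 \<and> real T \<le> K * N ^ (10 * P + 2) \<and>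
        (\<forall>w \<omega>. (\<Sum>k<d. (w k)\<^sup>2) = 1 \<longrightarrow> good d n m1 m2 R w \<omega> \<longrightarrow>
          (case layerwise_train d n m1 m2 \<eta>1 \<eta>2 lam T (\<lambda>x. g (dotp d w x)) \<omega> of (a, W, b, V) \<Rightarrow>
            (\<integral>\<^sup>+ x. ennreal ((net d m1 m2 a W b V x - g (dotp d w x))\<^sup>2) \<partial>gauss_vec d)) \<le> ennreal (K * L ^ (21 * P) * e))"
    \<comment> \<open>The distinction involves only the sizes, so the hyperparameters are fixed
      before the direction and the sample. In the second case \<open>e \<ge> 1\<close>, and a
      polylogarithmic risk bound is enough.\<close>
    proof (cases "real d ^ 2 \<le> \<rho>")
      case True
      show ?thesis
      proof (intro exI conjI allI impI)
        show "1 \<le> T" by (simp add: T_def)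
        show "real T \<le> K * N ^ (10 * P + 2)" by (rule T2)
        fix w \<omega> assume w: "(\<Sum>k<d. (w k)\<^sup>2) = 1" and good: "good d n m1 m2 R w \<omega>"
        have "(case layerwise_train d n m1 m2 (real m1 * real d * (1 / R) / (2 * real m2 * \<mu>)) \<eta>2 (e / real m1) T
              (\<lambda>x. g (dotp d w x)) \<omega> of (a, W, b, V) \<Rightarrow>
            (\<integral>\<^sup>+ x. ennreal ((net d m1 m2 a W b V x - g (dotp d w x))\<^sup>2) \<partial>gauss_vec d)) \<le> ennreal (10 ^ 6 * B R ^ 21 * e)"
          by (rule main_regime[OF pos w R1 \<rho>_def True good tail e_def refl \<eta>2_def refl T1])
        also have "\<dots> \<le> ennreal (K * L ^ (21 * P) * e)"
        proof (intro ennreal_leI mult_right_mono e0)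
          have "10 ^ 6 * B R ^ 21 \<le> 10 ^ 6 * (scale ^ 21 * \<kappa> ^ (21 * P) * L ^ (21 * P))" using BK[of 21] by (intro mult_left_mono) auto
          thus "10 ^ 6 * B R ^ 21 \<le> K * L ^ (21 * P)" by (simp add: K_def mult_ac)
        qed
        finally show "(case layerwise_train d n m1 m2 (real m1 * real d * (1 / R) / (2 * real m2 * \<mu>)) \<eta>2 (e / real m1) T
              (\<lambda>x. g (dotp d w x)) \<omega> of (a, W, b, V) \<Rightarrow>
            (\<integral>\<^sup>+ x. ennreal ((net d m1 m2 a W b V x - g (dotp d w x))\<^sup>2) \<partial>gauss_vec d)) \<le> ennreal (K * L ^ (21 * P) * e)" .
      qed
    next
      case False
      have r0: "real \<rho> > 0" using pos by (simp add: \<rho>_def)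
      have "1 \<le> real d ^ 2 / \<rho>" using False r0 by simp
      moreover have "0 \<le> 1 / sqrt n" by simp
      ultimately have e1: "1 \<le> e" unfolding e_def by linarith
      show ?thesis
      proof (intro exI conjI allI impI)
        show "1 \<le> (1::nat)" by simp
        have "1 * 1 \<le> K * N ^ (10 * P + 2)" using K1(3) N1 by (intro mult_mono one_le_power) auto
        thus "real 1 \<le> K * N ^ (10 * P + 2)" by simp
        fix w \<omega> assume w: "(\<Sum>k<d. (w k)\<^sup>2) = 1" and good: "good d n m1 m2 R w \<omega>"
        have "(case layerwise_train d n m1 m2 0 0 0 1 (\<lambda>x. g (dotp d w x)) \<omega> of (a, W, b, V) \<Rightarrow>
            (\<integral>\<^sup>+ x. ennreal ((net d m1 m2 a W b V x - g (dotp d w x))\<^sup>2) \<partial>gauss_vec d)) \<le> ennreal (4 * R\<^sup>2)"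
          by (rule trivial_regime[OF pos(3) w R1 good])
        also have "\<dots> \<le> ennreal (K * L ^ (21 * P) * e)"
        proof (rule ennreal_leI)
          have "4 * R\<^sup>2 = (4 * \<kappa>) * L ^ 1 * 1" by (simp add: R2)
          also have "\<dots> \<le> K * L ^ (21 * P) * e"
            using K1 L1 e1 \<kappa> by (intro mult_mono power_increasing) (auto simp: P_def)
          finally show "4 * R\<^sup>2 \<le> K * L ^ (21 * P) * e" .
        qed
        finally show "(case layerwise_train d n m1 m2 0 0 0 1 (\<lambda>x. g (dotp d w x)) \<omega> of (a, W, b, V) \<Rightarrow>
            (\<integral>\<^sup>+ x. ennreal ((net d m1 m2 a W b V x - g (dotp d w x))\<^sup>2) \<partial>gauss_vec d)) \<le> ennreal (K * L ^ (21 * P) * e)" .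
      qed
    qed
    then obtain \<eta>1 \<eta>2 lam T where T: "T \<ge> 1" "real T \<le> K * N ^ (10 * P + 2)"
      and bound: "\<And>w \<omega>. (\<Sum>k<d. (w k)\<^sup>2) = 1 \<Longrightarrow> good d n m1 m2 R w \<omega> \<Longrightarrow>
          (case layerwise_train d n m1 m2 \<eta>1 \<eta>2 lam T (\<lambda>x. g (dotp d w x)) \<omega> of (a, W, b, V) \<Rightarrow>
            (\<integral>\<^sup>+ x. ennreal ((net d m1 m2 a W b V x - g (dotp d w x))\<^sup>2) \<partial>gauss_vec d)) \<le> ennreal (K * L ^ (21 * P) * e)"
      by blast
    show "let N = real (d * n * m1 * m2); \<iota> = C * ln N in
       \<exists>\<eta>1 \<eta>2 lam :: real. \<exists>T::nat. T \<ge> 1 \<and> real T \<le> K * N ^ (10 * P + 2) \<and>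
         (\<forall>w. (\<Sum>k<d. (w k)\<^sup>2) = 1 \<longrightarrow>
            (let fstar = (\<lambda>x. g (dotp d w x)) in
             \<exists>E \<in> sets (sample_space d n m1 m2).
               measure (sample_space d n m1 m2) E \<ge> 1 - 40 * (2 + tail_const) * N ^ 0 * exp (- \<iota>) \<and>
               (\<forall>\<omega>\<in>E.
                  (case layerwise_train d n m1 m2 \<eta>1 \<eta>2 lam T fstar \<omega> of (a, W, b, V) \<Rightarrow>
                    (\<integral>\<^sup>+ x. ennreal ((net d m1 m2 a W b V x - fstar x)\<^sup>2) \<partial>gauss_vec d))
                  \<le> ennreal (K * (1 + ln N) ^ (21 * P) *
                       (real d ^ 2 / real (min n (min m1 m2)) + 1 / sqrt (real n))))))"
      unfolding Let_def N_def[symmetric] L_def[symmetric] \<rho>_def[symmetric] e_def[symmetric]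
    proof (rule exI[of _ \<eta>1], rule exI[of _ \<eta>2], rule exI[of _ lam], rule exI[of _ T], intro conjI allI impI)
      show "1 \<le> T" "real T \<le> K * N ^ (10 * P + 2)" by (rule T)+
      fix w :: "nat \<Rightarrow> real" assume w: "(\<Sum>k<d. (w k)\<^sup>2) = 1"
      from prob[OF w] obtain E where E: "E \<in> sets (sample_space d n m1 m2)"
        "measure (sample_space d n m1 m2) E \<ge> 1 - 40 * (2 + tail_const) * N ^ 0 * exp (- (C * ln N))"
        "\<And>\<omega>. \<omega> \<in> E \<Longrightarrow> good d n m1 m2 R w \<omega>" by blast
      show "\<exists>E \<in> sets (sample_space d n m1 m2).
               measure (sample_space d n m1 m2) E \<ge> 1 - 40 * (2 + tail_const) * N ^ 0 * exp (- (C * ln N)) \<and>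
               (\<forall>\<omega>\<in>E.
                  (case layerwise_train d n m1 m2 \<eta>1 \<eta>2 lam T (\<lambda>x. g (dotp d w x)) \<omega> of (a, W, b, V) \<Rightarrow>
                    (\<integral>\<^sup>+ x. ennreal ((net d m1 m2 a W b V x - g (dotp d w x))\<^sup>2) \<partial>gauss_vec d))
                  \<le> ennreal (K * L ^ (21 * P) * e))"
        by (intro bexI[of _ E] conjI ballI bound w E)
    qed
  qed
qed

end

text \<open>Growth bounds may be enlarged in both parameters, which lets \<open>g\<close>,
  \<open>g'\<close> and \<open>g''\<close> share one constant and one exponent.\<close>

lemma poly_bounded_mono:
  assumes "poly_bounded h"
  obtains C k where "\<And>C' k' z. C \<le> C' \<Longrightarrow> k \<le> k' \<Longrightarrow> \<bar>h z\<bar> \<le> C' * (1 + \<bar>z\<bar>) ^ k'"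
proof -
  from assms obtain C k where h: "\<And>z. \<bar>h z\<bar> \<le> C * (1 + \<bar>z\<bar>) ^ k" unfolding poly_bounded_def by blast
  have "\<bar>h z\<bar> \<le> C' * (1 + \<bar>z\<bar>) ^ k'" if "C \<le> C'" "k \<le> k'" for C' k' z
  proof -
    have "0 \<le> C" using h[of 0] by simp
    hence "C * (1 + \<bar>z\<bar>) ^ k \<le> C' * (1 + \<bar>z\<bar>) ^ k'" using that by (intro mult_mono power_increasing) auto
    thus ?thesis using h[of z] by linarith
  qed
  thus thesis by (rule that)
qed

theorem theorem2:
  fixes g g' g'' :: "real \<Rightarrow> real"
  assumes deriv1: "\<forall>z. (g has_real_derivative g' z) (at z)"
      and deriv2: "\<forall>z. (g' has_real_derivative g'' z) (at z)"
      and pb0: "poly_bounded g" and pb1: "poly_bounded g'" and pb2: "poly_bounded g''"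
      and nondeg: "(\<integral>z. g' z \<partial>std_normal) \<noteq> 0"
      and normalization: "(\<integral>z. (g z)\<^sup>2 \<partial>std_normal) \<le> 1"
  shows "\<exists>(q::nat) (c::real) (C0::real). \<forall>C\<ge>C0. \<exists>(K::real) (p::nat) (r::nat).
    \<forall>d n m1 m2::nat. d \<ge> 1 \<longrightarrow> n \<ge> 1 \<longrightarrow> m1 \<ge> 1 \<longrightarrow> m2 \<ge> 1 \<longrightarrow>
      (let N = real (d * n * m1 * m2); \<iota> = C * ln N in
       \<exists>\<eta>1 \<eta>2 lam :: real. \<exists>T::nat. T \<ge> 1 \<and> real T \<le> K * N ^ r \<and>
         (\<forall>w. (\<Sum>k<d. (w k)\<^sup>2) = 1 \<longrightarrow>
            (let fstar = (\<lambda>x. g (dotp d w x)) in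
             \<exists>E \<in> sets (sample_space d n m1 m2).
               measure (sample_space d n m1 m2) E \<ge> 1 - c * N ^ q * exp (- \<iota>) \<and>
               (\<forall>\<omega>\<in>E.
                  (case layerwise_train d n m1 m2 \<eta>1 \<eta>2 lam T fstar \<omega> of (a, W, b, V) \<Rightarrow>
                    (\<integral>\<^sup>+ x. ennreal ((net d m1 m2 a W b V x - fstar x)\<^sup>2) \<partial>gauss_vec d))
                  \<le> ennreal (K * (1 + ln N) ^ p *
                       (real d ^ 2 / real (min n (min m1 m2)) + 1 / sqrt (real n)))))))"
proof -
  obtain A0 k0 where 0: "\<And>C' k' z. A0 \<le> C' \<Longrightarrow> k0 \<le> k' \<Longrightarrow> \<bar>g z\<bar> \<le> C' * (1 + \<bar>z\<bar>) ^ k'"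
    using poly_bounded_mono[OF pb0] by blast
  obtain A1 k1 where 1: "\<And>C' k' z. A1 \<le> C' \<Longrightarrow> k1 \<le> k' \<Longrightarrow> \<bar>g' z\<bar> \<le> C' * (1 + \<bar>z\<bar>) ^ k'"
    using poly_bounded_mono[OF pb1] by blast
  obtain A2 k2 where 2: "\<And>C' k' z. A2 \<le> C' \<Longrightarrow> k2 \<le> k' \<Longrightarrow> \<bar>g'' z\<bar> \<le> C' * (1 + \<bar>z\<bar>) ^ k'"
    using poly_bounded_mono[OF pb2] by blast
  define A where "A = max 1 (max A0 (max A1 A2))"
  define m where "m = max 1 (max k0 (max k1 k2))"
  interpret target g g' g'' A m
  proof
    show "A \<ge> 1" "m \<ge> 1" by (auto simp: A_def m_def)
    show "\<bar>g z\<bar> \<le> A * (1 + \<bar>z\<bar>) ^ m" for z by (rule 0) (auto simp: A_def m_def)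
    show "\<bar>g' z\<bar> \<le> A * (1 + \<bar>z\<bar>) ^ m" for z by (rule 1) (auto simp: A_def m_def)
    show "\<bar>g'' z\<bar> \<le> A * (1 + \<bar>z\<bar>) ^ m" for z by (rule 2) (auto simp: A_def m_def)
  qed (use deriv1 deriv2 nondeg normalization in auto)
  show ?thesis
    \<comment> \<open>The exponent \<open>q = 0\<close> is possible because the choice of
      \<open>R\<close> already absorbs the polynomial prefactor.\<close>
    by (rule exI[of _ 0], rule exI[of _ "40 * (2 + tail_const)"], rule exI[of _ C_threshold]) (intro allI impI layerwise_training_risk)
qed

end
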